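(* For any infinite countable groups $\Gamma_1$ and $\Gamma_2$, one has $\Gamma_1*\Gamma_2\in\mathcal H(\mathbb U_{\mathbb Q^+})$.
   Context: $\mathbb U_{\mathbb Q^+}$ is the rational Urysohn space: the unique (up to isometry) countable metric space with metric taking values in $\mathbb Q^+=\mathbb Q\cap[0,+\infty[$ such that whenever $X\subseteq Y$ are finite metric spaces with rational distances, every isometric embedding $X\to\mathbb U_{\mathbb Q^+}$ extends to an isometric embedding $Y\to\mathbb U_{\mathbb Q^+}$. An action of a group $\Gamma$ by isometries on $\mathbb U_{\mathbb Q^+}$ is homogeneous if for every isometry $\varphi$ between two finite subsets of $\mathbb U_{\mathbb Q^+}$ there is $\gamma\in\Gamma$ with $\gamma x=\varphi(x)$ for all $x\in\operatorname{dom}\varphi$. $\mathcal H(\mathbb U_{\mathbb Q^+})$ is the class of countable groups which admit a faithful homogeneous action by isometries on $\mathbb U_{\mathbb Q^+}$. *)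

theory Defs
  imports "HOL-Analysis.Abstract_Metric_Spaces" "HOL-Algebra.Group_Action"
begin

section \<open>Free products of two groups\<close>

text \<open>
  The free product is realised on reduced words: lists of non-identity elements, alternately taken
  from the left and the right factor. The empty word is the identity, and two words are multiplied
  by pushing the letters of the first onto the second, merging and cancelling where necessary.
\<close>

definition fp_words :: "('a, 'm) monoid_scheme \<Rightarrow> ('b, 'n) monoid_scheme \<Rightarrow> ('a + 'b) list set" where
  "fp_words G H = {w. set w \<subseteq> Inl ` (carrier G - {\<one>\<^bsub>G\<^esub>}) \<union> Inr ` (carrier H - {\<one>\<^bsub>H\<^esub>}) \<and>
                      successively (\<lambda>x y. isl x \<noteq> isl y) w}"

fun fp_push :: "('a, 'm) monoid_scheme \<Rightarrow> ('b, 'n) monoid_scheme \<Rightarrow> 'a + 'b \<Rightarrow> ('a + 'b) list \<Rightarrow> ('a + 'b) list" where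
  "fp_push G H (Inl a) (Inl b # w) =
     (if a \<otimes>\<^bsub>G\<^esub> b = \<one>\<^bsub>G\<^esub> then w else Inl (a \<otimes>\<^bsub>G\<^esub> b) # w)"
| "fp_push G H (Inr a) (Inr b # w) =
     (if a \<otimes>\<^bsub>H\<^esub> b = \<one>\<^bsub>H\<^esub> then w else Inr (a \<otimes>\<^bsub>H\<^esub> b) # w)"
| "fp_push G H x w = x # w"

definition free_product :: "('a, 'm) monoid_scheme \<Rightarrow> ('b, 'n) monoid_scheme \<Rightarrow> ('a + 'b) list monoid" where
  "free_product G H = \<lparr>carrier = fp_words G H, mult = foldr (fp_push G H), one = []\<rparr>"

definition fp_inl :: "('a, 'm) monoid_scheme \<Rightarrow> 'a \<Rightarrow> ('a + 'b) list" where
  "fp_inl G a = (if a = \<one>\<^bsub>G\<^esub> then [] else [Inl a])"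

definition fp_inr :: "('b, 'n) monoid_scheme \<Rightarrow> 'b \<Rightarrow> ('a + 'b) list" where
  "fp_inr H b = (if b = \<one>\<^bsub>H\<^esub> then [] else [Inr b])"

lemma free_product_simps [simp]:
  "carrier (free_product G H) = fp_words G H"
  "mult (free_product G H) = foldr (fp_push G H)"
  "one (free_product G H) = []"
  by (simp_all add: free_product_def)

lemma fp_words_Nil [simp]: "[] \<in> fp_words G H"
  by (simp add: fp_words_def)

lemma fp_words_ConsD:
  "x # w \<in> fp_words G H \<Longrightarrow> w \<in> fp_words G H"
  "x # w \<in> fp_words G H \<Longrightarrow> [x] \<in> fp_words G H"
  by (auto simp: fp_words_def successively_Cons)

lemma fp_words_singleton [simp]:
  "[Inl a] \<in> fp_words G H \<longleftrightarrow> a \<in> carrier G \<and> a \<noteq> \<one>\<^bsub>G\<^esub>"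
  "[Inr b] \<in> fp_words G H \<longleftrightarrow> b \<in> carrier H \<and> b \<noteq> \<one>\<^bsub>H\<^esub>"
  by (auto simp: fp_words_def)

lemma fp_push_reduced: "x # w \<in> fp_words G H \<Longrightarrow> fp_push G H x w = x # w"
  by (cases x; cases w; cases "hd w") (auto simp: fp_words_def)

lemma fp_push_closed:
  assumes "group G" "group H" "[x] \<in> fp_words G H" "w \<in> fp_words G H"
  shows "fp_push G H x w \<in> fp_words G H"
proof -
  interpret G: group G by fact
  interpret H: group H by fact
  show ?thesis
    using assms(3,4)
    by (cases x; cases w; cases "hd w") (auto simp: fp_words_def successively_Cons)
qed

lemma fp_mult_closed:
  assumes "group G" "group H" "u \<in> fp_words G H" "w \<in> fp_words G H"
  shows "foldr (fp_push G H) u w \<in> fp_words G H"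
  using assms(3)
proof (induction u)
  case (Cons x u)
  then show ?case
    using fp_push_closed[OF assms(1,2)] fp_words_ConsD by fastforce
qed (use assms(4) in simp)

lemma fp_push_push_Inl:
  assumes "group G" "a \<in> carrier G" "b \<in> carrier G" "a \<noteq> \<one>\<^bsub>G\<^esub>" "b \<noteq> \<one>\<^bsub>G\<^esub>" "w \<in> fp_words G H"
  shows "fp_push G H (Inl a) (fp_push G H (Inl b) w) =
    (if a \<otimes>\<^bsub>G\<^esub> b = \<one>\<^bsub>G\<^esub> then w else fp_push G H (Inl (a \<otimes>\<^bsub>G\<^esub> b)) w)"
proof -
  interpret G: group G by fact
  consider (nil) "w = []" | (l) c v where "w = Inl c # v" | (r) c v where "w = Inr c # v"
    by (metis list.exhaust sum.exhaust)
  then show ?thesis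
  proof cases
    case l
    have c: "c \<in> carrier G" "c \<noteq> \<one>\<^bsub>G\<^esub>" and v: "\<And>e z. v \<noteq> Inl e # z"
      using assms(6) l by (auto simp: fp_words_def successively_Cons)
    have push_v: "fp_push G H (Inl e) v = Inl e # v" for e
      using v by (cases v; cases "hd v") auto
    have assoc: "a \<otimes>\<^bsub>G\<^esub> b \<otimes>\<^bsub>G\<^esub> c = a \<otimes>\<^bsub>G\<^esub> (b \<otimes>\<^bsub>G\<^esub> c)"
      using assms c by (simp add: G.m_assoc)
    have 1: "a \<otimes>\<^bsub>G\<^esub> (b \<otimes>\<^bsub>G\<^esub> c) = c" if "a \<otimes>\<^bsub>G\<^esub> b = \<one>\<^bsub>G\<^esub>"
      using assoc that c by simp
    have 2: "a \<otimes>\<^bsub>G\<^esub> b \<otimes>\<^bsub>G\<^esub> c = a" if "b \<otimes>\<^bsub>G\<^esub> c = \<one>\<^bsub>G\<^esub>"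
      using assoc that assms by simp
    have 3: "a = c" if "a \<otimes>\<^bsub>G\<^esub> b = \<one>\<^bsub>G\<^esub>" "b \<otimes>\<^bsub>G\<^esub> c = \<one>\<^bsub>G\<^esub>"
      using 1 2 that assms by simp
    show ?thesis
      using l c 1 2 3 assoc assms push_v by auto
  qed auto
qed

lemma fp_push_push_Inr:
  assumes "group H" "a \<in> carrier H" "b \<in> carrier H" "a \<noteq> \<one>\<^bsub>H\<^esub>" "b \<noteq> \<one>\<^bsub>H\<^esub>" "w \<in> fp_words G H"
  shows "fp_push G H (Inr a) (fp_push G H (Inr b) w) =
    (if a \<otimes>\<^bsub>H\<^esub> b = \<one>\<^bsub>H\<^esub> then w else fp_push G H (Inr (a \<otimes>\<^bsub>H\<^esub> b)) w)"
proof -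
  interpret H: group H by fact
  consider (nil) "w = []" | (l) c v where "w = Inl c # v" | (r) c v where "w = Inr c # v"
    by (metis list.exhaust sum.exhaust)
  then show ?thesis
  proof cases
    case r
    have c: "c \<in> carrier H" "c \<noteq> \<one>\<^bsub>H\<^esub>" and v: "\<And>e z. v \<noteq> Inr e # z"
      using assms(6) r by (auto simp: fp_words_def successively_Cons)
    have push_v: "fp_push G H (Inr e) v = Inr e # v" for e
      using v by (cases v; cases "hd v") auto
    have assoc: "a \<otimes>\<^bsub>H\<^esub> b \<otimes>\<^bsub>H\<^esub> c = a \<otimes>\<^bsub>H\<^esub> (b \<otimes>\<^bsub>H\<^esub> c)"
      using assms c by (simp add: H.m_assoc)
    have 1: "a \<otimes>\<^bsub>H\<^esub> (b \<otimes>\<^bsub>H\<^esub> c) = c" if "a \<otimes>\<^bsub>H\<^esub> b = \<one>\<^bsub>H\<^esub>"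
      using assoc that c by simp
    have 2: "a \<otimes>\<^bsub>H\<^esub> b \<otimes>\<^bsub>H\<^esub> c = a" if "b \<otimes>\<^bsub>H\<^esub> c = \<one>\<^bsub>H\<^esub>"
      using assoc that assms by simp
    have 3: "a = c" if "a \<otimes>\<^bsub>H\<^esub> b = \<one>\<^bsub>H\<^esub>" "b \<otimes>\<^bsub>H\<^esub> c = \<one>\<^bsub>H\<^esub>"
      using 1 2 that assms by simp
    show ?thesis
      using r c 1 2 3 assoc assms push_v by auto
  qed auto
qed

lemma fp_mult_push:
  assumes "group G" "group H" "[x] \<in> fp_words G H" "u \<in> fp_words G H" "w \<in> fp_words G H"
  shows "foldr (fp_push G H) (fp_push G H x u) w = fp_push G H x (foldr (fp_push G H) u w)"
proof (cases u)
  case (Cons y v)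
  have y: "[y] \<in> fp_words G H" and v: "v \<in> fp_words G H"
    using fp_words_ConsD assms(4) Cons by blast+
  have vw: "foldr (fp_push G H) v w \<in> fp_words G H"
    using fp_mult_closed assms v by blast
  show ?thesis
    using assms(3) y fp_push_push_Inl[OF assms(1) _ _ _ _ vw] fp_push_push_Inr[OF assms(2) _ _ _ _ vw] Cons
    by (cases x; cases y) auto
qed auto

lemma fp_mult_assoc:
  assumes "group G" "group H" "u \<in> fp_words G H" "v \<in> fp_words G H" "w \<in> fp_words G H"
  shows "foldr (fp_push G H) (foldr (fp_push G H) u v) w =
         foldr (fp_push G H) u (foldr (fp_push G H) v w)"
  using assms(3)
proof (induction u)
  case (Cons x u)
  have x: "[x] \<in> fp_words G H" and u: "u \<in> fp_words G H"
    using fp_words_ConsD Cons.prems by blast+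
  then show ?case
    using Cons.IH fp_mult_push[OF assms(1,2) x fp_mult_closed[OF assms(1,2) u assms(4)] assms(5)]
    by simp
qed simp

lemma fp_mult_Nil: "u \<in> fp_words G H \<Longrightarrow> foldr (fp_push G H) u [] = u"
proof (induction u)
  case (Cons x u)
  then show ?case
    using fp_words_ConsD(1) fp_push_reduced by fastforce
qed simp

lemma fp_left_inverse:
  assumes "group G" "group H" "u \<in> fp_words G H"
  shows "\<exists>v \<in> fp_words G H. foldr (fp_push G H) v u = []"
  using assms(3)
proof (induction u)
  case Nil
  then show ?case by (intro bexI[of _ "[]"]) auto
next
  case (Cons x u)
  interpret G: group G by fact
  interpret H: group H by fact
  have x: "[x] \<in> fp_words G H" and u: "u \<in> fp_words G H"
    using fp_words_ConsD Cons.prems by blast+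
  obtain v where v: "v \<in> fp_words G H" "foldr (fp_push G H) v u = []"
    using Cons.IH u by blast
  define y where "y = (case x of Inl a \<Rightarrow> Inl (inv\<^bsub>G\<^esub> a) | Inr b \<Rightarrow> Inr (inv\<^bsub>H\<^esub> b))"
  have y: "[y] \<in> fp_words G H" "fp_push G H y (x # u) = u"
    using x by (auto simp: y_def split: sum.splits)
  have "foldr (fp_push G H) (foldr (fp_push G H) v [y]) (x # u) = []"
    using fp_mult_assoc[OF assms(1,2) v(1) y(1) Cons.prems] y v by simp
  then show ?case
    using fp_mult_closed assms v y by blast
qed

proposition group_free_product:
  assumes "group G" "group H"
  shows "group (free_product G H)"
  by (rule groupI) (use assms fp_mult_closed fp_mult_assoc fp_left_inverse in auto)

lemma fp_inl_hom:
  assumes "group G"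
  shows "fp_inl G \<in> hom G (free_product G H)"
proof -
  interpret G: group G by fact
  show ?thesis
    by (auto simp: hom_def fp_inl_def)
qed

lemma fp_inr_hom:
  assumes "group H"
  shows "fp_inr H \<in> hom H (free_product G H)"
proof -
  interpret H: group H by fact
  show ?thesis
    by (auto simp: hom_def fp_inr_def)
qed

text \<open>The construction is the coproduct of the two factors in the category of groups.\<close>

theorem free_product_universal:
  assumes G: "group G" and H: "group H" and K: "group K"
    and f: "f \<in> hom G K" and g: "g \<in> hom H K"
  obtains F where "F \<in> hom (free_product G H) K"
    and "\<And>a. a \<in> carrier G \<Longrightarrow> F (fp_inl G a) = f a"
    and "\<And>b. b \<in> carrier H \<Longrightarrow> F (fp_inr H b) = g b"
    and "\<And>F' u. \<lbrakk>F' \<in> hom (free_product G H) K;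
                \<And>a. a \<in> carrier G \<Longrightarrow> F' (fp_inl G a) = f a;
                \<And>b. b \<in> carrier H \<Longrightarrow> F' (fp_inr H b) = g b;
                u \<in> carrier (free_product G H)\<rbrakk> \<Longrightarrow> F' u = F u"
proof -
  interpret G: group G by fact
  interpret H: group H by fact
  interpret K: group K by fact
  interpret f: group_hom G K f by unfold_locales (fact f)
  interpret g: group_hom H K g by unfold_locales (fact g)
  interpret P: group "free_product G H" by (rule group_free_product) fact+
  define s where "s x = (case x of Inl a \<Rightarrow> f a | Inr b \<Rightarrow> g b)" for x
  define F where "F u = foldr (\<lambda>x r. s x \<otimes>\<^bsub>K\<^esub> r) u \<one>\<^bsub>K\<^esub>" for u
  have F_simps [simp]: "F [] = \<one>\<^bsub>K\<^esub>" "F (x # u) = s x \<otimes>\<^bsub>K\<^esub> F u" for x u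
    by (auto simp: F_def)
  have s_closed: "s x \<in> carrier K" if "[x] \<in> fp_words G H" for x
    using that by (cases x) (auto simp: s_def)
  have F_closed: "F u \<in> carrier K" if "u \<in> fp_words G H" for u
    using that
  proof (induction u)
    case (Cons x u)
    then show ?case
      using fp_words_ConsD[OF Cons.prems] s_closed by simp
  qed simp
  have F_push: "F (fp_push G H x u) = s x \<otimes>\<^bsub>K\<^esub> F u"
    if x: "[x] \<in> fp_words G H" and u: "u \<in> fp_words G H" for x u
  proof (cases u)
    case (Cons y v)
    have y: "[y] \<in> fp_words G H" and v: "F v \<in> carrier K"
      using u Cons fp_words_ConsD F_closed by blast+
    show ?thesis
    proof (cases x; cases y)
      fix a b assume xy: "x = Inl a" "y = Inl b"
      then have ab: "a \<in> carrier G" "b \<in> carrier G" using x y by auto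
      have "f (a \<otimes>\<^bsub>G\<^esub> b) \<otimes>\<^bsub>K\<^esub> F v = f a \<otimes>\<^bsub>K\<^esub> (f b \<otimes>\<^bsub>K\<^esub> F v)"
        using ab v by (simp add: K.m_assoc)
      then show ?thesis
        using xy Cons v ab f.hom_one by (auto simp: s_def simp del: f.hom_mult)
    next
      fix a b assume xy: "x = Inr a" "y = Inr b"
      then have ab: "a \<in> carrier H" "b \<in> carrier H" using x y by auto
      have "g (a \<otimes>\<^bsub>H\<^esub> b) \<otimes>\<^bsub>K\<^esub> F v = g a \<otimes>\<^bsub>K\<^esub> (g b \<otimes>\<^bsub>K\<^esub> F v)"
        using ab v by (simp add: K.m_assoc)
      then show ?thesis
        using xy Cons v ab g.hom_one by (auto simp: s_def simp del: g.hom_mult)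
    qed (use Cons in auto)
  qed simp
  have F_mult: "F (foldr (fp_push G H) u v) = F u \<otimes>\<^bsub>K\<^esub> F v"
    if "u \<in> fp_words G H" "v \<in> fp_words G H" for u v
    using that(1)
  proof (induction u)
    case (Cons x u)
    then have "[x] \<in> fp_words G H" "u \<in> fp_words G H"
      using fp_words_ConsD by blast+
    then show ?case
      using Cons.IH that(2) F_push fp_mult_closed[OF G H] F_closed s_closed
      by (simp add: K.m_assoc)
  qed (use that F_closed in simp)
  show thesis
  proof
    show F_hom: "F \<in> hom (free_product G H) K"
      using F_closed F_mult by (auto simp: hom_def)
    show "F (fp_inl G a) = f a" if "a \<in> carrier G" for a
      using that by (auto simp: fp_inl_def s_def)
    show "F (fp_inr H b) = g b" if "b \<in> carrier H" for b
      using that by (auto simp: fp_inr_def s_def)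
    fix F' u
    assume F': "F' \<in> hom (free_product G H) K"
      and inl: "\<And>a. a \<in> carrier G \<Longrightarrow> F' (fp_inl G a) = f a"
      and inr: "\<And>b. b \<in> carrier H \<Longrightarrow> F' (fp_inr H b) = g b"
      and "u \<in> carrier (free_product G H)"
    then have "u \<in> fp_words G H" by simp
    then show "F' u = F u"
    proof (induction u)
      case Nil
      then show ?case
        using hom_one[OF F' P.group_axioms K] by simp
    next
      case (Cons x u)
      then have x: "[x] \<in> fp_words G H" and u: "u \<in> fp_words G H"
        using fp_words_ConsD by blast+
      have "F' [x] = s x"
        using x inl inr by (cases x) (force simp: s_def fp_inl_def fp_inr_def)+
      moreover have "F' (foldr (fp_push G H) [x] u) = F' [x] \<otimes>\<^bsub>K\<^esub> F' u"
        using hom_mult[OF F', of "[x]" u] x u by (simp del: foldr.simps)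
      ultimately show ?case
        using Cons u fp_push_reduced by (metis F_simps(2) foldr.simps comp_apply id_apply)
    qed
  qed
qed


section \<open>The rational Urysohn space\<close>

definition isometric_on :: "'a set \<Rightarrow> ('a \<Rightarrow> 'a \<Rightarrow> real) \<Rightarrow> ('b \<Rightarrow> 'b \<Rightarrow> real) \<Rightarrow> ('a \<Rightarrow> 'b) \<Rightarrow> bool" where
  "isometric_on X e d f \<longleftrightarrow> (\<forall>x\<in>X. \<forall>y\<in>X. d (f x) (f y) = e x y)"

text \<open>
  Finite test spaces are taken on sets of naturals: every finite metric space is isometric to one of
  these, and a locale assumption cannot quantify over types. These axioms determine the space up to
  isometry. Since the empty subspace is allowed as \<open>X\<close>, they also force \<open>U\<close> to be nonempty.
\<close>

locale rational_urysohn_space = Metric_space U d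
  for U :: "'u set" and d :: "'u \<Rightarrow> 'u \<Rightarrow> real" +
  assumes countable: "countable U"
    and rational: "\<And>x y. \<lbrakk>x \<in> U; y \<in> U\<rbrakk> \<Longrightarrow> d x y \<in> \<rat>"
    and extension:
      "\<And>(X :: nat set) Y e f.
         \<lbrakk>finite Y; Metric_space Y e; \<And>x y. \<lbrakk>x \<in> Y; y \<in> Y\<rbrakk> \<Longrightarrow> e x y \<in> \<rat>;
          X \<subseteq> Y; f \<in> X \<rightarrow> U; isometric_on X e d f\<rbrakk>
         \<Longrightarrow> \<exists>g. g \<in> Y \<rightarrow> U \<and> isometric_on Y e d g \<and> (\<forall>x\<in>X. g x = f x)"


section \<open>Homogeneous actions by isometries\<close>

definition acts_by_isometries ::
  "('g, 'm) monoid_scheme \<Rightarrow> 'u set \<Rightarrow> ('u \<Rightarrow> 'u \<Rightarrow> real) \<Rightarrow> ('g \<Rightarrow> 'u \<Rightarrow> 'u) \<Rightarrow> bool" where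
  "acts_by_isometries G U d \<alpha> \<longleftrightarrow>
     group_action G U \<alpha> \<and> (\<forall>\<gamma>\<in>carrier G. isometric_on U d d (\<alpha> \<gamma>))"

definition homogeneous_action ::
  "('g, 'm) monoid_scheme \<Rightarrow> 'u set \<Rightarrow> ('u \<Rightarrow> 'u \<Rightarrow> real) \<Rightarrow> ('g \<Rightarrow> 'u \<Rightarrow> 'u) \<Rightarrow> bool" where
  "homogeneous_action G U d \<alpha> \<longleftrightarrow>
     acts_by_isometries G U d \<alpha> \<and>
     (\<forall>A B \<phi>. finite A \<and> A \<subseteq> U \<and> finite B \<and> B \<subseteq> U \<and> bij_betw \<phi> A B \<and> isometric_on A d d \<phi> \<longrightarrow>
        (\<exists>\<gamma>\<in>carrier G. \<forall>x\<in>A. \<alpha> \<gamma> x = \<phi> x))"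

definition homogeneous_class :: "'u set \<Rightarrow> ('u \<Rightarrow> 'u \<Rightarrow> real) \<Rightarrow> ('g, 'm) monoid_scheme set" where
  "homogeneous_class U d =
     {G. group G \<and> countable (carrier G) \<and>
         (\<exists>\<alpha>. faithful_action G U \<alpha> \<and> homogeneous_action G U d \<alpha>)}"

end

theory Submission
  imports Defs
begin

text \<open>
  Every infinite countable group \<open>\<Gamma>\<close> acts freely by isometries on the rational Urysohn space so that
  for some sequence \<open>c n\<close> in \<open>\<Gamma>\<close> and all points \<open>x\<close>, \<open>y\<close> one has \<open>d x (c n y) = n\<close> for almost all
  \<open>n\<close>. Such an action is the limit of a tower of locally finite \<open>\<Gamma>\<close>-invariant metrics on
  \<open>\<Gamma> \<times> {..<n}\<close>. Each step adds a free orbit that realizes a prescribed one-point extension, and then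
  shortcuts of length \<open>n\<close> from \<open>x\<close> to \<open>c n y\<close>; these do not affect distances up to \<open>n\<close>, so that all
  distances stabilize.

  Let \<open>G\<close> and \<open>H\<close> act in this way. For an isometry \<open>w\<close> of the Urysohn space, \<open>G\<close> together with
  \<open>w\<inverse> H w\<close> defines an action of the free product, and a generic \<open>w\<close> built by back and forth makes it
  faithful and homogeneous. Let \<open>p\<close> be a finite approximation of \<open>w\<close> and let \<open>A \<rightarrow> B\<close> be an isometry
  of finite sets with all distances between \<open>A\<close> and \<open>B\<close> equal to one large number \<open>R\<close>. Choose
  \<open>h0 \<in> H\<close> with \<open>d a (h0 a') = R\<close> on \<open>A\<close>. For large \<open>K\<close> some \<open>g \<in> G\<close> moves \<open>A\<close> and \<open>B\<close> to distance
  \<open>K\<close> from the domain of \<open>p\<close>, and some \<open>k \<in> H\<close> moves \<open>A\<close> and \<open>h0 A\<close> to distance \<open>K\<close> from its range.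
  Therefore \<open>p\<close> extends by \<open>g A \<rightarrow> k A\<close> and \<open>g B \<rightarrow> k h0 A\<close>, after which
  \<open>g\<inverse> (w\<inverse> k h0 k\<inverse> w) g\<close> maps \<open>A\<close> to \<open>B\<close>. In general, \<open>A \<rightarrow> B\<close> is the composition of two such
  isometries through a copy of \<open>A\<close> at distance \<open>R\<close> from \<open>A \<union> B\<close>.
\<close>

section \<open>Metrics and Katetov functions\<close>

text \<open>\<open>Metric_space\<close> asks for nonnegativity and symmetry at all arguments, also
  outside the carrier. Cutting the function off to 0 there leaves only conditions on points of
  \<open>M\<close>.\<close>

lemma Metric_space_cong_on:
  assumes "\<And>x y. \<lbrakk>x \<in> M; y \<in> M\<rbrakk> \<Longrightarrow> 0 \<le> d x y"
    "\<And>x y. \<lbrakk>x \<in> M; y \<in> M\<rbrakk> \<Longrightarrow> d x y = d y x"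
    "\<And>x y. \<lbrakk>x \<in> M; y \<in> M\<rbrakk> \<Longrightarrow> d x y = 0 \<longleftrightarrow> x = y"
    "\<And>x y z. \<lbrakk>x \<in> M; y \<in> M; z \<in> M\<rbrakk> \<Longrightarrow> d x z \<le> d x y + d y z"
  shows "Metric_space M (\<lambda>x y. if x \<in> M \<and> y \<in> M then d x y else 0)"
  by unfold_locales (use assms in auto)

text \<open>The four inequalities on \<open>f\<close> are the triangle inequalities for triangles
  with vertices on both sides. The absolute value in \<open>g\<close> keeps distances nonnegative
  off the carriers, where \<open>f\<close> is arbitrary.\<close>

lemma Metric_space_glue:
  assumes A: "Metric_space A d" and B: "Metric_space B e"
    and pos: "\<And>a b. \<lbrakk>a \<in> A; b \<in> B\<rbrakk> \<Longrightarrow> 0 < f a b"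
    and Af: "\<And>a a' b. \<lbrakk>a \<in> A; a' \<in> A; b \<in> B\<rbrakk> \<Longrightarrow> f a b \<le> d a a' + f a' b"
    and fA: "\<And>a a' b. \<lbrakk>a \<in> A; a' \<in> A; b \<in> B\<rbrakk> \<Longrightarrow> d a a' \<le> f a b + f a' b"
    and Bf: "\<And>a b b'. \<lbrakk>a \<in> A; b \<in> B; b' \<in> B\<rbrakk> \<Longrightarrow> f a b \<le> f a b' + e b b'"
    and fB: "\<And>a b b'. \<lbrakk>a \<in> A; b \<in> B; b' \<in> B\<rbrakk> \<Longrightarrow> e b b' \<le> f a b + f a b'"
  defines "g \<equiv> \<lambda>x y. case (x, y) of (Inl a, Inl a') \<Rightarrow> d a a' | (Inr b, Inr b') \<Rightarrow> e b b'
                 | (Inl a, Inr b) \<Rightarrow> \<bar>f a b\<bar> | (Inr b, Inl a) \<Rightarrow> \<bar>f a b\<bar>"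
  shows "Metric_space (A <+> B) g"
proof -
  interpret A: Metric_space A d by fact
  interpret B: Metric_space B e by fact
  have abs: "\<bar>f a b\<bar> = f a b" if "a \<in> A" "b \<in> B" for a b
    using pos[OF that] by simp
  have ne: "f a b \<noteq> 0" if "a \<in> A" "b \<in> B" for a b
    using pos[OF that] by simp
  show ?thesis
  proof
    show "0 \<le> g x y" for x y
      by (auto simp: g_def split: sum.split)
    show "g x y = g y x" for x y
      by (auto simp: g_def A.commute B.commute split: sum.split)
    show "g x y = 0 \<longleftrightarrow> x = y" if "x \<in> A <+> B" "y \<in> A <+> B" for x y
      using that ne by (auto simp: g_def)
    have 1: "f a b \<le> f a b' + e b' b" if "a \<in> A" "b \<in> B" "b' \<in> B" for a b b'
      using Bf[OF that] by (simp add: B.commute)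
    have 2: "f a b \<le> f a' b + d a' a" if "a \<in> A" "a' \<in> A" "b \<in> B" for a a' b
      using Af[OF that] by (simp add: A.commute)
    have 3: "f a b \<le> e b b' + f a b'" if "a \<in> A" "b \<in> B" "b' \<in> B" for a b b'
      using Bf[OF that] by simp
    show "g x z \<le> g x y + g y z" if "x \<in> A <+> B" "y \<in> A <+> B" "z \<in> A <+> B" for x y z
      using that Af fA Bf fB A.triangle B.triangle 1 2 3 by (auto simp: g_def abs)
  qed
qed

lemma Metric_space_pullback:
  assumes "Metric_space N e" "inj_on f M" "f ` M \<subseteq> N"
  shows "Metric_space M (\<lambda>x y. e (f x) (f y))"
proof -
  interpret Metric_space N e by fact
  show ?thesis
    using assms(2,3) by unfold_locales (auto simp: commute inj_on_eq_iff image_subset_iff intro: triangle)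
qed

lemma common_denominator:
  assumes "finite S" "\<And>s. s \<in> S \<Longrightarrow> k s \<in> \<rat>"
  obtains q :: nat where "0 < q" "\<And>s. s \<in> S \<Longrightarrow> real q * k s \<in> \<int>"
proof -
  have "\<exists>q>0. \<forall>s\<in>S. real q * k s \<in> \<int>"
    using assms
  proof (induction S)
    case empty
    then show ?case by (intro exI[of _ 1]) auto
  next
    case (insert x S)
    then obtain q where q: "0 < q" "\<forall>s\<in>S. real q * k s \<in> \<int>"
      by auto
    obtain a b :: int where ab: "b > 0" "k x = of_int a / of_int b"
      using insert.prems[of x] by (auto elim!: Rats_cases')
    have "real (q * nat b) * k s \<in> \<int>" if "s \<in> insert x S" for s
    proof (cases "s = x")
      case True
      then have "real (q * nat b) * k s = of_int (int q * a)"
        using ab by simp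
      then show ?thesis
        by (metis Ints_of_int)
    next
      case False
      then have "real q * k s \<in> \<int>"
        using q that by auto
      then have "of_nat (nat b) * (real q * k s) \<in> \<int>"
        by (rule Ints_mult[OF Ints_of_nat])
      then show ?thesis
        by (simp add: mult_ac)
    qed
    then show ?case
      using q(1) ab(1) by (intro exI[of _ "q * nat b"]) auto
  qed
  then show thesis
    using that by blast
qed

text \<open>A Katetov function prescribes the distances from a new point: these are the triangle
  inequalities with that point as a vertex. Positivity is asked for separately where the new point
  has to lie outside \<open>S\<close>.\<close>

definition katetov :: "'x set \<Rightarrow> ('x \<Rightarrow> 'x \<Rightarrow> real) \<Rightarrow> ('x \<Rightarrow> real) \<Rightarrow> bool" where
  "katetov S d k \<longleftrightarrow> (\<forall>x\<in>S. \<forall>y\<in>S. d x y \<le> k x + k y \<and> k x \<le> d x y + k y)"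

lemma katetovD:
  assumes "katetov S d k" "x \<in> S" "y \<in> S"
  shows "d x y \<le> k x + k y" "k x \<le> d x y + k y"
  using assms by (auto simp: katetov_def)

text \<open>For nonempty \<open>S\<close>, the largest Katetov extension: the shortest way from
  \<open>x\<close> to a new point that is attached only along \<open>S\<close>.\<close>

definition kext :: "'x set \<Rightarrow> ('x \<Rightarrow> 'x \<Rightarrow> real) \<Rightarrow> ('x \<Rightarrow> real) \<Rightarrow> 'x \<Rightarrow> real" where
  "kext S d k x = (MIN s\<in>S. k s + d s x)"

lemma kext_le: "\<lbrakk>finite S; s \<in> S\<rbrakk> \<Longrightarrow> kext S d k x \<le> k s + d s x"
  by (simp add: kext_def)

lemma kext_attained:
  assumes "finite S" "S \<noteq> {}"
  obtains s where "s \<in> S" "kext S d k x = k s + d s x"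
proof -
  have "(MIN s\<in>S. k s + d s x) \<in> (\<lambda>s. k s + d s x) ` S"
    using assms by (intro Min_in) auto
  then show thesis
    using that by (auto simp: kext_def)
qed

section \<open>Extension of Katetov functions\<close>

context Metric_space
begin

lemma kext_eq:
  assumes "finite S" "S \<subseteq> M" "katetov S d k" "x \<in> S"
  shows "kext S d k x = k x"
proof (rule antisym)
  show "kext S d k x \<le> k x"
    using kext_le[OF assms(1,4), of d k x] assms(2,4) by (auto simp: subset_iff)
  obtain s where "s \<in> S" "kext S d k x = k s + d s x"
    using kext_attained[of S d k x] assms(1,4) by blast
  then show "k x \<le> kext S d k x"
    using katetovD(2)[OF assms(3,4), of s] commute[of s x] by simp
qed

lemma katetov_kext:
  assumes "finite S" "S \<noteq> {}" "S \<subseteq> M" "katetov S d k"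
  shows "katetov M d (kext S d k)"
  unfolding katetov_def
proof (intro ballI conjI)
  fix x y assume xy: "x \<in> M" "y \<in> M"
  obtain s where s: "s \<in> S" "kext S d k x = k s + d s x"
    using kext_attained[OF assms(1,2)] by metis
  obtain t where t: "t \<in> S" "kext S d k y = k t + d t y"
    using kext_attained[OF assms(1,2)] by metis
  have M: "s \<in> M" "t \<in> M"
    using s t assms(3) by auto
  show "d x y \<le> kext S d k x + kext S d k y"
    using s t katetovD(1)[OF assms(4) s(1) t(1)] triangle[OF xy(1) M(1) xy(2)] triangle[OF M xy(2)]
      commute[of x s] by linarith
  show "kext S d k x \<le> d x y + kext S d k y"
    using kext_le[OF assms(1) t(1), of d k x] t(2) triangle[OF M(2) xy(2,1)] commute[of x y] by linarith
qed

lemma kext_pos: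
  assumes "finite S" "S \<noteq> {}" "\<And>s. s \<in> S \<Longrightarrow> 0 < k s"
  shows "0 < kext S d k x"
proof -
  obtain s where "s \<in> S" "kext S d k x = k s + d s x"
    using kext_attained[OF assms(1,2)] by metis
  then show ?thesis
    using assms(3)[of s] by (simp add: add_pos_nonneg)
qed

end

section \<open>Proper length functions on groups\<close>

text \<open>The group is exhausted by finite symmetric sets \<open>Q n\<close> that contain the
  identity and whose products lie in \<open>Q (Suc n)\<close>; the length of an element is the first
  index at which it appears.\<close>

lemma (in group) exists_proper_length:
  assumes "countable (carrier G)"
  obtains len :: "'a \<Rightarrow> nat"
  where "\<And>x. x \<in> carrier G \<Longrightarrow> len x = 0 \<longleftrightarrow> x = \<one>" "\<And>x. x \<in> carrier G \<Longrightarrow> len (inv x) = len x"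
    "\<And>x y. \<lbrakk>x \<in> carrier G; y \<in> carrier G\<rbrakk> \<Longrightarrow> len (x \<otimes> y) \<le> len x + len y"
    "\<And>n. finite {x \<in> carrier G. len x \<le> n}"
proof -
  define e where "e = from_nat_into (carrier G)"
  have e: "e n \<in> carrier G" for n
    by (simp add: e_def from_nat_into carrier_not_empty)
  define Q where "Q = rec_nat {\<one>} (\<lambda>n Q. (Q <#> Q) \<union> {e n, inv e n})"
  have Q0: "Q 0 = {\<one>}" and QS: "Q (Suc n) = (Q n <#> Q n) \<union> {e n, inv e n}" for n
    by (simp_all add: Q_def)
  have Q: "finite (Q n) \<and> Q n \<subseteq> carrier G \<and> \<one> \<in> Q n \<and> (\<forall>x\<in>Q n. inv x \<in> Q n)" for n
  proof (induction n)
    case (Suc n)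
    then have "\<one> \<otimes> \<one> \<in> Q n <#> Q n" "finite (Q n <#> Q n)"
      unfolding set_mult_def by blast+
    moreover have "inv x \<in> Q n <#> Q n" if "x \<in> Q n <#> Q n" for x
      using that Suc by (auto simp: set_mult_def subset_iff inv_mult_group) blast
    ultimately show ?case
      using Suc e by (auto simp: QS set_mult_def)
  qed (simp add: Q0)
  have Qm: "x \<otimes> y \<in> Q (Suc n)" if "x \<in> Q n" "y \<in> Q n" for x y n
    using that by (auto simp: QS set_mult_def)
  have mono: "mono Q"
    unfolding mono_iff_le_Suc using Qm[of _ _ "\<one>"] Q by (metis r_one subset_iff)
  have UQ: "\<exists>n. x \<in> Q n" if x: "x \<in> carrier G" for x
  proof -
    obtain n where "e n = x"
      using assms(1) x unfolding e_def by (meson from_nat_into_surj)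
    then show ?thesis
      using QS[of n] by blast
  qed
  define len where "len x = (LEAST n. x \<in> Q n)" for x
  have in_Q: "x \<in> Q n \<longleftrightarrow> len x \<le> n" if x: "x \<in> carrier G" for x n
  proof
    show "len x \<le> n" if "x \<in> Q n"
      using that by (simp add: len_def Least_le)
    have "x \<in> Q (len x)"
      using UQ[OF x] unfolding len_def by (metis LeastI)
    then show "x \<in> Q n" if "len x \<le> n"
      using that mono by (meson monoD subsetD)
  qed
  have l0: "len x = 0 \<longleftrightarrow> x = \<one>" if "x \<in> carrier G" for x
    using in_Q[OF that, of 0] by (simp add: Q0)
  show thesis
  proof
    show "finite {x \<in> carrier G. len x \<le> n}" for n
      using Q[of n] in_Q by (auto elim!: rev_finite_subset)
    fix x assume x: "x \<in> carrier G"
    show "len x = 0 \<longleftrightarrow> x = \<one>"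
      by (rule l0[OF x])
    have "len (inv y) \<le> len y" if "y \<in> carrier G" for y
      using in_Q[of y] in_Q[of "inv y"] that Q by auto
    from this[OF x] this[of "inv x"] show "len (inv x) = len x"
      using x by auto
    fix y assume y: "y \<in> carrier G"
    have "x \<otimes> y \<in> Q (Suc (max (len x) (len y)))"
      by (intro Qm) (simp_all add: in_Q x y)
    then have max: "len (x \<otimes> y) \<le> Suc (max (len x) (len y))"
      using in_Q x y by blast
    show "len (x \<otimes> y) \<le> len x + len y"
    \<comment> \<open>A product costs at most one more than the maximum. This is at most the sum
      because elements other than the identity have length at least 1.\<close>
    proof (cases "x = \<one> \<or> y = \<one>")
      case False
      then have "len x \<noteq> 0" "len y \<noteq> 0"
        using l0 x y by auto
      then show ?thesis
        using max by linarith
    qed (use x y in auto)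
  qed
qed

section \<open>Free orbits\<close>

context group
begin

definition act :: "'a \<Rightarrow> 'a \<times> nat \<Rightarrow> 'a \<times> nat" where
  "act \<gamma> x = (\<gamma> \<otimes> fst x, snd x)"

text \<open>The union of \<open>n\<close> free orbits. Numbering the orbits keeps all stages of the
  tower nested inside one type.\<close>

definition Orb :: "nat \<Rightarrow> ('a \<times> nat) set" where
  "Orb n = carrier G \<times> {..<n}"

lemma act_closed [simp]: "\<lbrakk>\<gamma> \<in> carrier G; x \<in> Orb n\<rbrakk> \<Longrightarrow> act \<gamma> x \<in> Orb n"
  by (auto simp: act_def Orb_def)

lemma act_act: "\<lbrakk>\<gamma> \<in> carrier G; \<gamma>' \<in> carrier G; x \<in> Orb n\<rbrakk> \<Longrightarrow> act \<gamma> (act \<gamma>' x) = act (\<gamma> \<otimes> \<gamma>') x"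
  by (auto simp: act_def Orb_def m_assoc)

lemma act_one [simp]: "x \<in> Orb n \<Longrightarrow> act \<one> x = x"
  by (auto simp: act_def Orb_def)

lemma act_inv [simp]:
  "\<lbrakk>\<gamma> \<in> carrier G; x \<in> Orb n\<rbrakk> \<Longrightarrow> act (inv \<gamma>) (act \<gamma> x) = x"
  "\<lbrakk>\<gamma> \<in> carrier G; x \<in> Orb n\<rbrakk> \<Longrightarrow> act \<gamma> (act (inv \<gamma>) x) = x"
  by (simp_all add: act_act)

lemma act_inj: "\<lbrakk>\<gamma> \<in> carrier G; \<gamma>' \<in> carrier G; x \<in> Orb n; act \<gamma> x = act \<gamma>' x\<rbrakk> \<Longrightarrow> \<gamma> = \<gamma>'"
  by (auto simp: act_def Orb_def)

text \<open>By freeness \<gamma> can be read off from the image of \<open>x\<close>. Together with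
  finite balls this lets an infinite group move finite sets arbitrarily far.\<close>

lemma finite_act_preimage:
  assumes "finite B" "x \<in> Orb n"
  shows "finite {\<gamma> \<in> carrier G. act \<gamma> x \<in> B}"
  by (rule inj_on_finite[OF _ _ assms(1), of "\<lambda>\<gamma>. act \<gamma> x"]) (auto intro: inj_onI act_inj assms(2))

lemma finite_act_inv_preimage:
  assumes "finite B" "x \<in> Orb n"
  shows "finite {\<gamma> \<in> carrier G. act (inv \<gamma>) x \<in> B}"
  by (rule inj_on_finite[OF _ _ finite_act_preimage[OF assms], of "\<lambda>\<gamma>. inv \<gamma>"]) (auto intro: inj_on_subset[OF inv_inj])

text \<open>The common denominator turns distances into integers after scaling, which keeps suprema
  of such metrics rational. Finite balls are what makes far translates available.\<close>

definition locally_finite_metric :: "nat \<Rightarrow> ('a \<times> nat \<Rightarrow> 'a \<times> nat \<Rightarrow> real) \<Rightarrow> bool" where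
  "locally_finite_metric n d \<longleftrightarrow> Metric_space (Orb n) d \<and>
     (\<exists>q::nat. 0 < q \<and> (\<forall>x\<in>Orb n. \<forall>y\<in>Orb n. real q * d x y \<in> \<int>)) \<and>
     (\<forall>\<gamma>\<in>carrier G. \<forall>x\<in>Orb n. \<forall>y\<in>Orb n. d (act \<gamma> x) (act \<gamma> y) = d x y) \<and>
     (\<forall>x\<in>Orb n. \<forall>r. finite {y \<in> Orb n. d x y \<le> r})"

text \<open>On one copy of the group, a proper length of the quotient of two elements is a
  left-invariant metric; properness makes its balls finite.\<close>

lemma exists_base_metric:
  assumes "countable (carrier G)"
  shows "\<exists>d. locally_finite_metric 1 d"
proof -
  obtain len :: "'a \<Rightarrow> nat"
    where l0: "\<And>x. x \<in> carrier G \<Longrightarrow> len x = 0 \<longleftrightarrow> x = \<one>"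
      and li: "\<And>x. x \<in> carrier G \<Longrightarrow> len (inv x) = len x"
      and lm: "\<And>x y. \<lbrakk>x \<in> carrier G; y \<in> carrier G\<rbrakk> \<Longrightarrow> len (x \<otimes> y) \<le> len x + len y"
      and lf: "\<And>n. finite {x \<in> carrier G. len x \<le> n}"
    using exists_proper_length[OF assms] by blast
  define d0 where "d0 x y = real (len (inv (fst x) \<otimes> fst y))" for x y :: "'a \<times> nat"
  define d where "d = (\<lambda>x y. if x \<in> Orb 1 \<and> y \<in> Orb 1 then d0 x y else 0)"
  have dd: "d x y = d0 x y" if "x \<in> Orb 1" "y \<in> Orb 1" for x y
    using that by (simp add: d_def)
  have "Metric_space (Orb 1) d"
    unfolding d_def
  proof (rule Metric_space_cong_on)
    fix x y assume xy: "x \<in> Orb 1" "y \<in> Orb 1"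
    then obtain a b where ab: "a \<in> carrier G" "b \<in> carrier G" "x = (a, 0)" "y = (b, 0)"
      by (auto simp: Orb_def)
    have "inv (inv a \<otimes> b) = inv b \<otimes> a"
      using ab by (simp add: inv_mult_group)
    then show "d0 x y = d0 y x"
      using li[of "inv a \<otimes> b"] ab by (simp add: d0_def)
    have "inv a \<otimes> b = \<one> \<longleftrightarrow> a = b"
      using ab by (metis inv_closed inv_inv l_inv inv_equality)
    then show "d0 x y = 0 \<longleftrightarrow> x = y"
      using ab l0[of "inv a \<otimes> b"] by (simp add: d0_def)
    fix z assume "z \<in> Orb 1"
    then obtain c where c: "c \<in> carrier G" "z = (c, 0)"
      by (auto simp: Orb_def)
    have "inv a \<otimes> c = (inv a \<otimes> b) \<otimes> (inv b \<otimes> c)"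
      using ab c by (simp add: m_assoc) (simp add: m_assoc[symmetric])
    then show "d0 x z \<le> d0 x y + d0 y z"
      using lm[of "inv a \<otimes> b" "inv b \<otimes> c"] ab c by (simp add: d0_def)
  qed (simp add: d0_def)
  moreover have "\<exists>q::nat. 0 < q \<and> (\<forall>x\<in>Orb 1. \<forall>y\<in>Orb 1. real q * d x y \<in> \<int>)"
    by (intro exI[of _ 1]) (auto simp: dd d0_def)
  moreover have "d (act \<gamma> x) (act \<gamma> y) = d x y"
    if \<gamma>: "\<gamma> \<in> carrier G" and xy: "x \<in> Orb 1" "y \<in> Orb 1" for \<gamma> x y
  proof -
    obtain a b where ab: "a \<in> carrier G" "b \<in> carrier G" "x = (a, 0)" "y = (b, 0)"
      using xy by (auto simp: Orb_def)
    have "inv (\<gamma> \<otimes> a) \<otimes> (\<gamma> \<otimes> b) = inv a \<otimes> b"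
      using ab \<gamma> by (simp add: inv_mult_group m_assoc) (simp add: m_assoc[symmetric])
    then show ?thesis
      using \<gamma> xy ab by (simp add: dd d0_def) (simp add: act_def)
  qed
  moreover have "finite {y \<in> Orb 1. d x y \<le> r}" if x: "x \<in> Orb 1" for x r
  proof -
    obtain a where a: "a \<in> carrier G" "x = (a, 0)"
      using x by (auto simp: Orb_def)
    have "finite ((\<lambda>b. (a \<otimes> b, 0 :: nat)) ` {b \<in> carrier G. len b \<le> nat \<lfloor>r\<rfloor>})"
      using lf by simp
    then show ?thesis
    proof (rule rev_finite_subset; safe)
      fix b i assume b: "(b, i) \<in> Orb 1" "d x (b, i) \<le> r"
      then have "b = a \<otimes> (inv a \<otimes> b)" "i = 0" "b \<in> carrier G"
        using a by (auto simp: Orb_def m_assoc[symmetric])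
      moreover have "len (inv a \<otimes> b) \<le> nat \<lfloor>r\<rfloor>"
        using b a x by (simp add: dd d0_def le_nat_floor)
      ultimately show "(b, i) \<in> (\<lambda>b. (a \<otimes> b, 0)) ` {b \<in> carrier G. len b \<le> nat \<lfloor>r\<rfloor>}"
        using a by (auto intro!: image_eqI[where x = "inv a \<otimes> b"])
    qed
  qed
  ultimately show ?thesis
    unfolding locally_finite_metric_def by blast
qed

text \<open>The new orbit is attached along \<open>S\<close> by free amalgamation.\<close>

lemma extend_metric_by_orbit:
  assumes lfm: "locally_finite_metric n d"
    and S: "finite S" "S \<noteq> {}" "S \<subseteq> Orb n"
    and k: "katetov S d k" "\<And>s. s \<in> S \<Longrightarrow> 0 < k s" "\<And>s. s \<in> S \<Longrightarrow> k s \<in> \<rat>"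
  obtains d' v where "locally_finite_metric (Suc n) d'"
    "\<And>x y. \<lbrakk>x \<in> Orb n; y \<in> Orb n\<rbrakk> \<Longrightarrow> d' x y = d x y"
    "v \<in> Orb (Suc n)" "\<And>s. s \<in> S \<Longrightarrow> d' s v = k s"
proof -
  interpret Metric_space "Orb n" d
    using lfm by (simp add: locally_finite_metric_def)
  obtain q0 :: nat where q0': "0 < q0 \<and> (\<forall>x\<in>Orb n. \<forall>y\<in>Orb n. real q0 * d x y \<in> \<int>)"
    using lfm unfolding locally_finite_metric_def by blast
  then have q0: "0 < q0" "\<And>x y. \<lbrakk>x \<in> Orb n; y \<in> Orb n\<rbrakk> \<Longrightarrow> real q0 * d x y \<in> \<int>"
    by blast+
  obtain q1 :: nat where q1: "0 < q1" "\<And>s. s \<in> S \<Longrightarrow> real q1 * k s \<in> \<int>"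
    using common_denominator[of S k] S(1) k(3) by metis
  have inv: "d (act \<gamma> x) (act \<gamma> y) = d x y"
    if "\<gamma> \<in> carrier G" "x \<in> Orb n" "y \<in> Orb n" for \<gamma> x y
    using lfm that unfolding locally_finite_metric_def by blast
  have lf: "finite {y \<in> Orb n. d x y \<le> r}" if "x \<in> Orb n" for x r
    using lfm that unfolding locally_finite_metric_def by blast
  define q where "q = q0 * q1"
  have q_pos: "0 < q"
    using q0(1) q1(1) by (simp add: q_def)
  have q_d: "real q * d x y \<in> \<int>" if "x \<in> Orb n" "y \<in> Orb n" for x y
  proof -
    have "real q * d x y = real q1 * (real q0 * d x y)"
      by (simp add: q_def)
    then show ?thesis
      using Ints_mult[OF Ints_of_nat q0(2)[OF that], of q1] by (simp only:)
  qed
  have q_k: "real q * k s \<in> \<int>" if "s \<in> S" for s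
  proof -
    have "real q * k s = real q0 * (real q1 * k s)"
      by (simp add: q_def)
    then show ?thesis
      using Ints_mult[OF Ints_of_nat q1(2)[OF that], of q0] by (simp only:)
  qed
  \<comment> \<open>\<open>\<kappa> x\<close> will be the distance from \<open>x\<close> to the base
    point \<open>v = (\<one>, n)\<close> of the new orbit.\<close>
  define \<kappa> where "\<kappa> = kext S d k"
  have \<kappa>_S: "\<kappa> s = k s" if "s \<in> S" for s
    unfolding \<kappa>_def using that S k(1) by (intro kext_eq)
  have \<kappa>_katetov: "katetov (Orb n) d \<kappa>"
    unfolding \<kappa>_def using S k(1) by (intro katetov_kext)
  note \<kappa>_sum = katetovD(1)[OF \<kappa>_katetov] and \<kappa>_lip = katetovD(2)[OF \<kappa>_katetov]
  have \<kappa>_pos: "0 < \<kappa> x" for x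
    unfolding \<kappa>_def using S k(2) by (intro kext_pos)
  have \<kappa>_att: "\<exists>s\<in>S. \<kappa> x = \<kappa> s + d s x" for x
    using kext_attained[OF S(1,2), of d k x] \<kappa>_S unfolding \<kappa>_def by metis
  have \<kappa>_Ints: "real q * \<kappa> x \<in> \<int>" if x: "x \<in> Orb n" for x
  proof -
    obtain s where s: "s \<in> S" "\<kappa> x = k s + d s x"
      using \<kappa>_att[of x] \<kappa>_S by auto
    then show ?thesis
      using q_d[of s x] q_k[of s] x S(3) by (auto simp: distrib_left)
  qed
  have \<kappa>_fin: "finite {x \<in> Orb n. \<kappa> x \<le> r}" for r
  proof (rule finite_subset)
    show "{x \<in> Orb n. \<kappa> x \<le> r} \<subseteq> (\<Union>s\<in>S. {x \<in> Orb n. d s x \<le> r})"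
    proof
      fix x assume x: "x \<in> {x \<in> Orb n. \<kappa> x \<le> r}"
      obtain s where "s \<in> S" "\<kappa> x = \<kappa> s + d s x"
        using \<kappa>_att by blast
      then show "x \<in> (\<Union>s\<in>S. {x \<in> Orb n. d s x \<le> r})"
        using \<kappa>_pos[of s] x by (intro UN_I[of s]) auto
    qed
  qed (use S lf in auto)
  \<comment> \<open>\<open>lam \<gamma>\<close> will be the distance from \<open>v\<close> to its
    translate by \<gamma>, along a shortest path through a point of \<open>S\<close>. By invariance,
    \<kappa> at \<open>act (inv \<gamma>) s\<close> is the distance from \<open>s\<close> to that
    translate.\<close>
  define lam where "lam \<gamma> = (if \<gamma> = \<one> then 0 else MIN s\<in>S. \<kappa> s + \<kappa> (act (inv \<gamma>) s))" for \<gamma>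
  have lam_one [simp]: "lam \<one> = 0"
    by (simp add: lam_def)
  have lam_att: "\<exists>s\<in>S. lam \<gamma> = \<kappa> s + \<kappa> (act (inv \<gamma>) s)" if "\<gamma> \<noteq> \<one>" for \<gamma>
  proof -
    have "lam \<gamma> \<in> (\<lambda>s. \<kappa> s + \<kappa> (act (inv \<gamma>) s)) ` S"
      unfolding lam_def using that S by (auto intro!: Min_in)
    then show ?thesis
      by auto
  qed
  have lam_pos: "0 < lam \<gamma>" if "\<gamma> \<noteq> \<one>" for \<gamma>
    using lam_att[OF that] \<kappa>_pos by (metis add_pos_pos)
  \<comment> \<open>Paths through an arbitrary old point are no shorter than those through
    \<open>S\<close>, since \<kappa> itself is attained by passing through \<open>S\<close>.\<close>
  have lam_le: "lam \<gamma> \<le> \<kappa> x + \<kappa> (act (inv \<gamma>) x)" if \<gamma>: "\<gamma> \<in> carrier G" and x: "x \<in> Orb n" for \<gamma> x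
  proof (cases "\<gamma> = \<one>")
    case True
    then show ?thesis
      using \<kappa>_pos[of x] \<kappa>_pos[of "act (inv \<gamma>) x"] by simp
  next
    case False
    obtain s where s: "s \<in> S" "\<kappa> x = \<kappa> s + d s x"
      using \<kappa>_att by blast
    have "lam \<gamma> \<le> \<kappa> s + \<kappa> (act (inv \<gamma>) s)"
      using False s(1) S(1) by (simp add: lam_def)
    then show ?thesis
      using \<kappa>_lip[of "act (inv \<gamma>) s" "act (inv \<gamma>) x"] s S(3) \<gamma> x inv[of "inv \<gamma>" s x] by auto
  qed
  have lam_inv_le: "lam (inv \<gamma>) \<le> lam \<gamma>" if \<gamma>: "\<gamma> \<in> carrier G" for \<gamma>
  proof (cases "\<gamma> = \<one>")
    case False
    then obtain s where s: "s \<in> S" "lam \<gamma> = \<kappa> s + \<kappa> (act (inv \<gamma>) s)"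
      using lam_att by blast
    then show ?thesis
      using lam_le[of "inv \<gamma>" "act (inv \<gamma>) s"] \<gamma> subsetD[OF S(3)] act_inv(2)[of \<gamma> s n] by simp
  qed simp
  have lam_inv: "lam (inv \<gamma>) = lam \<gamma>" if "\<gamma> \<in> carrier G" for \<gamma>
    using lam_inv_le[of \<gamma>] lam_inv_le[of "inv \<gamma>"] that by simp
  have act_mult: "act (inv (\<gamma> \<otimes> \<gamma>')) x = act (inv \<gamma>') (act (inv \<gamma>) x)"
    if "\<gamma> \<in> carrier G" "\<gamma>' \<in> carrier G" "x \<in> Orb n" for \<gamma> \<gamma>' x
    using that by (simp add: act_act inv_mult_group)
  \<comment> \<open>The triangle inequality for \<open>v\<close>, its translate by \<gamma> and an
    old point \<open>x\<close>.\<close>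
  have \<kappa>_lam: "\<kappa> x \<le> lam \<gamma> + \<kappa> (act (inv \<gamma>) x)" if \<gamma>: "\<gamma> \<in> carrier G" and x: "x \<in> Orb n" for \<gamma> x
  proof (cases "\<gamma> = \<one>")
    case True
    then show ?thesis
      using x by simp
  next
    case False
    then obtain s where s: "s \<in> S" "lam \<gamma> = \<kappa> s + \<kappa> (act (inv \<gamma>) s)"
      using lam_att by blast
    then have "\<kappa> x \<le> d x s + \<kappa> s" "d (act (inv \<gamma>) s) (act (inv \<gamma>) x) \<le> \<kappa> (act (inv \<gamma>) s) + \<kappa> (act (inv \<gamma>) x)"
      using \<kappa>_lip[of x s] \<kappa>_sum subsetD[OF S(3)] \<gamma> x by simp_all
    then show ?thesis
      using s inv[of "inv \<gamma>" s x] S(3) \<gamma> x by (auto simp: commute)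
  qed
  \<comment> \<open>The triangle inequality for \<open>v\<close> and its translates by \<gamma> and
    \<open>\<gamma> \<otimes> \<gamma>'\<close>: a path realizing \<open>lam \<gamma>\<close> passes
    through \<open>s\<close>, and \<open>\<kappa>_lam\<close> continues it to the second
    translate.\<close>
  have lam_mult: "lam (\<gamma> \<otimes> \<gamma>') \<le> lam \<gamma> + lam \<gamma>'"
    if \<gamma>: "\<gamma> \<in> carrier G" "\<gamma>' \<in> carrier G" for \<gamma> \<gamma>'
  proof (cases "\<gamma> = \<one>")
    case False
    then obtain s where s: "s \<in> S" "lam \<gamma> = \<kappa> s + \<kappa> (act (inv \<gamma>) s)"
      using lam_att by blast
    have sO: "s \<in> Orb n"
      using s S(3) by auto
    have "\<kappa> (act (inv \<gamma>') (act (inv \<gamma>) s)) \<le> lam (inv \<gamma>') + \<kappa> (act (inv (inv \<gamma>')) (act (inv \<gamma>') (act (inv \<gamma>) s)))"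
      using \<kappa>_lam[of "inv \<gamma>'" "act (inv \<gamma>') (act (inv \<gamma>) s)"] \<gamma> sO by simp
    also have "act (inv (inv \<gamma>')) (act (inv \<gamma>') (act (inv \<gamma>) s)) = act (inv \<gamma>) s"
      using \<gamma> sO by (simp add: act_inv(2)[of _ _ n])
    finally show ?thesis
      using lam_le[of "\<gamma> \<otimes> \<gamma>'" s] act_mult[OF \<gamma> sO] s(2) lam_inv[OF \<gamma>(2)] \<gamma> sO by simp
  qed (use \<gamma> in simp)
  have lam_Ints: "real q * lam \<gamma> \<in> \<int>" if \<gamma>: "\<gamma> \<in> carrier G" for \<gamma>
  proof (cases "\<gamma> = \<one>")
    case False
    then obtain s where s: "s \<in> S" "lam \<gamma> = \<kappa> s + \<kappa> (act (inv \<gamma>) s)"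
      using lam_att by blast
    then show ?thesis
      using \<kappa>_Ints[of s] \<kappa>_Ints[of "act (inv \<gamma>) s"] S(3) \<gamma> by (auto simp: distrib_left)
  qed simp
  \<comment> \<open>A bound on \<open>lam \<gamma>\<close> forces some
    \<open>act (inv \<gamma>) s\<close> into a finite sublevel set of \<kappa>, and freeness leaves
    finitely many \<gamma>.\<close>
  have lam_fin: "finite {\<gamma> \<in> carrier G. lam \<gamma> \<le> r}" for r
  proof (rule finite_subset)
    show "{\<gamma> \<in> carrier G. lam \<gamma> \<le> r} \<subseteq>
        {\<one>} \<union> (\<Union>s\<in>S. {\<gamma> \<in> carrier G. act (inv \<gamma>) s \<in> {x \<in> Orb n. \<kappa> x \<le> r}})"
    proof
      fix \<gamma> assume \<gamma>: "\<gamma> \<in> {\<gamma> \<in> carrier G. lam \<gamma> \<le> r}"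
      show "\<gamma> \<in> {\<one>} \<union> (\<Union>s\<in>S. {\<gamma> \<in> carrier G. act (inv \<gamma>) s \<in> {x \<in> Orb n. \<kappa> x \<le> r}})"
      proof (cases "\<gamma> = \<one>")
        case False
        then obtain s where s: "s \<in> S" "lam \<gamma> = \<kappa> s + \<kappa> (act (inv \<gamma>) s)"
          using lam_att by blast
        then have "\<kappa> (act (inv \<gamma>) s) \<le> r"
          using \<gamma> \<kappa>_pos[of s] by simp
        then show ?thesis
          using s(1) S(3) \<gamma> by auto
      qed simp
    qed
    show "finite ({\<one>} \<union> (\<Union>s\<in>S. {\<gamma> \<in> carrier G. act (inv \<gamma>) s \<in> {x \<in> Orb n. \<kappa> x \<le> r}}))"
      using S \<kappa>_fin by (auto intro!: finite_act_inv_preimage[where n = n] simp del: mem_Collect_eq)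
  qed
  \<comment> \<open>\<delta> and \<open>f\<close> spread \<open>lam\<close> and \<kappa> over the
    new orbit by invariance: \<open>f x \<alpha>\<close> is the distance from \<open>x\<close> to
    \<open>(\<alpha>, n)\<close>.\<close>
  define \<delta> where "\<delta> = (\<lambda>\<alpha> \<beta>. if \<alpha> \<in> carrier G \<and> \<beta> \<in> carrier G then lam (inv \<alpha> \<otimes> \<beta>) else 0)"
  define f where "f x \<alpha> = \<kappa> (act (inv \<alpha>) x)" for x \<alpha>
  have \<delta>: "\<delta> \<alpha> \<beta> = lam (inv \<alpha> \<otimes> \<beta>)" if "\<alpha> \<in> carrier G" "\<beta> \<in> carrier G" for \<alpha> \<beta>
    using that by (simp add: \<delta>_def)
  have inv_inv_mult: "inv (inv \<alpha> \<otimes> \<beta>) = inv \<beta> \<otimes> \<alpha>" if "\<alpha> \<in> carrier G" "\<beta> \<in> carrier G" for \<alpha> \<beta>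
    using that by (simp add: inv_mult_group)
  have act_quot: "act (inv (inv \<alpha> \<otimes> \<beta>)) (act (inv \<alpha>) x) = act (inv \<beta>) x"
    if "\<alpha> \<in> carrier G" "\<beta> \<in> carrier G" "x \<in> Orb n" for \<alpha> \<beta> x
    using that by (simp add: inv_inv_mult act_act m_assoc)
  have \<delta>_metric: "Metric_space (carrier G) \<delta>"
    unfolding \<delta>_def
  proof (rule Metric_space_cong_on)
    fix \<alpha> \<beta> assume ab: "\<alpha> \<in> carrier G" "\<beta> \<in> carrier G"
    show "0 \<le> lam (inv \<alpha> \<otimes> \<beta>)"
      using lam_pos[of "inv \<alpha> \<otimes> \<beta>"] by (cases "inv \<alpha> \<otimes> \<beta> = \<one>") auto
    show "lam (inv \<alpha> \<otimes> \<beta>) = lam (inv \<beta> \<otimes> \<alpha>)"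
      using lam_inv[of "inv \<alpha> \<otimes> \<beta>"] inv_inv_mult ab by simp
    have "inv \<alpha> \<otimes> \<beta> = \<one> \<longleftrightarrow> \<alpha> = \<beta>"
      using ab by (metis inv_closed inv_inv l_inv inv_equality)
    then show "lam (inv \<alpha> \<otimes> \<beta>) = 0 \<longleftrightarrow> \<alpha> = \<beta>"
      using lam_pos[of "inv \<alpha> \<otimes> \<beta>"] by (cases "inv \<alpha> \<otimes> \<beta> = \<one>") auto
    fix \<epsilon> assume c: "\<epsilon> \<in> carrier G"
    have "inv \<alpha> \<otimes> \<epsilon> = (inv \<alpha> \<otimes> \<beta>) \<otimes> (inv \<beta> \<otimes> \<epsilon>)"
      using ab c by (simp add: m_assoc) (simp add: m_assoc[symmetric])
    then show "lam (inv \<alpha> \<otimes> \<epsilon>) \<le> lam (inv \<alpha> \<otimes> \<beta>) + lam (inv \<beta> \<otimes> \<epsilon>)"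
      using lam_mult[of "inv \<alpha> \<otimes> \<beta>" "inv \<beta> \<otimes> \<epsilon>"] ab c by simp
  qed
  \<comment> \<open>The last orbit is split off so that \<open>Metric_space_glue\<close> applies to
    a disjoint sum.\<close>
  define \<iota> where "\<iota> x = (if snd x < n then Inl x else Inr (fst x))" for x :: "'a \<times> nat"
  define g where "g = (\<lambda>x y. case (x, y) of (Inl a, Inl a') \<Rightarrow> d a a' | (Inr b, Inr b') \<Rightarrow> \<delta> b b'
                 | (Inl a, Inr b) \<Rightarrow> \<bar>f a b\<bar> | (Inr b, Inl a) \<Rightarrow> \<bar>f a b\<bar>)"
  define d' where "d' x y = g (\<iota> x) (\<iota> y)" for x y
  have Orb_cases: "x \<in> Orb n \<or> (\<exists>\<alpha>\<in>carrier G. x = (\<alpha>, n))" if "x \<in> Orb (Suc n)" for x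
    using that by (auto simp: Orb_def less_Suc_eq)
  have d'_simps: "\<And>x y. \<lbrakk>x \<in> Orb n; y \<in> Orb n\<rbrakk> \<Longrightarrow> d' x y = d x y"
    "\<And>x \<alpha>. x \<in> Orb n \<Longrightarrow> d' x (\<alpha>, n) = f x \<alpha>"
    "\<And>x \<alpha>. x \<in> Orb n \<Longrightarrow> d' (\<alpha>, n) x = f x \<alpha>"
    "\<And>\<alpha> \<beta>. d' (\<alpha>, n) (\<beta>, n) = \<delta> \<alpha> \<beta>"
    using \<kappa>_pos by (auto simp: d'_def g_def \<iota>_def Orb_def f_def abs_of_pos)
  have "Metric_space (Orb (Suc n)) d'"
    unfolding d'_def
  proof (rule Metric_space_pullback)
    show "Metric_space (Orb n <+> carrier G) g"
      unfolding g_def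
    proof (rule Metric_space_glue)
      show "0 < f a b" for a b
        by (simp add: f_def \<kappa>_pos)
      fix a a' b assume a: "a \<in> Orb n" "a' \<in> Orb n" "b \<in> carrier G"
      show "f a b \<le> d a a' + f a' b" "d a a' \<le> f a b + f a' b"
        using \<kappa>_lip[of "act (inv b) a" "act (inv b) a'"] \<kappa>_sum[of "act (inv b) a" "act (inv b) a'"]
          inv[of "inv b" a a'] a by (simp_all add: f_def)
    next
      fix a b b' assume a: "a \<in> Orb n" "b \<in> carrier G" "b' \<in> carrier G"
      show "f a b \<le> f a b' + \<delta> b b'"
        using \<kappa>_lam[of "inv b \<otimes> b'" "act (inv b) a"] a by (simp add: f_def \<delta> act_quot)
      show "\<delta> b b' \<le> f a b + f a b'"
        using lam_le[of "inv b \<otimes> b'" "act (inv b) a"] a by (simp add: f_def \<delta> act_quot)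
    qed (use \<delta>_metric Metric_space_axioms in auto)
    show "inj_on \<iota> (Orb (Suc n))"
      by (auto simp: inj_on_def \<iota>_def Orb_def)
    show "\<iota> ` Orb (Suc n) \<subseteq> Orb n <+> carrier G"
      by (auto simp: \<iota>_def Orb_def)
  qed
  moreover have "\<exists>q::nat. 0 < q \<and> (\<forall>x\<in>Orb (Suc n). \<forall>y\<in>Orb (Suc n). real q * d' x y \<in> \<int>)"
  proof (intro exI[of _ q] conjI ballI)
    show "0 < q"
      by (rule q_pos)
    fix x y assume xy: "x \<in> Orb (Suc n)" "y \<in> Orb (Suc n)"
    show "real q * d' x y \<in> \<int>"
      using Orb_cases[OF xy(1)] Orb_cases[OF xy(2)] q_d \<kappa>_Ints lam_Ints
      by - (elim disjE bexE; simp_all add: d'_simps f_def \<delta>)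
  qed
  moreover have "d' (act \<gamma> x) (act \<gamma> y) = d' x y"
    if \<gamma>: "\<gamma> \<in> carrier G" and "x \<in> Orb (Suc n)" "y \<in> Orb (Suc n)" for \<gamma> x y
  proof -
    have act_new: "act \<gamma> (\<alpha>, n) = (\<gamma> \<otimes> \<alpha>, n)" for \<alpha>
      by (simp add: act_def)
    have f: "f (act \<gamma> x) (\<gamma> \<otimes> \<alpha>) = f x \<alpha>" if "\<alpha> \<in> carrier G" "x \<in> Orb n" for x \<alpha>
      using \<gamma> that act_mult[of \<gamma> \<alpha> "act \<gamma> x"] by (simp add: f_def act_inv[where n = n])
    have "inv (\<gamma> \<otimes> \<alpha>) \<otimes> (\<gamma> \<otimes> \<beta>) = inv \<alpha> \<otimes> \<beta>" if "\<alpha> \<in> carrier G" "\<beta> \<in> carrier G" for \<alpha> \<beta>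
      using \<gamma> that by (simp add: inv_mult_group m_assoc) (simp add: m_assoc[symmetric])
    then have "\<delta> (\<gamma> \<otimes> \<alpha>) (\<gamma> \<otimes> \<beta>) = \<delta> \<alpha> \<beta>" if "\<alpha> \<in> carrier G" "\<beta> \<in> carrier G" for \<alpha> \<beta>
      using \<gamma> that by (simp add: \<delta>)
    then show ?thesis
      using Orb_cases[OF that(2)] Orb_cases[OF that(3)] \<gamma> f
      by - (elim disjE bexE; simp add: d'_simps inv act_new)
  qed
  moreover have "finite {y \<in> Orb (Suc n). d' x y \<le> r}" if x: "x \<in> Orb (Suc n)" for x r
  proof -
    have eq: "{y \<in> Orb (Suc n). d' x y \<le> r} =
      {y \<in> Orb n. d' x y \<le> r} \<union> (\<lambda>\<alpha>. (\<alpha>, n)) ` {\<alpha> \<in> carrier G. d' x (\<alpha>, n) \<le> r}"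
      by (auto simp: Orb_def less_Suc_eq)
    consider "x \<in> Orb n" | \<alpha> where "\<alpha> \<in> carrier G" "x = (\<alpha>, n)"
      using Orb_cases[OF x] by blast
    then show ?thesis
    proof cases
      case 1
      have "finite {\<alpha> \<in> carrier G. act (inv \<alpha>) x \<in> {y \<in> Orb n. \<kappa> y \<le> r}}"
        by (rule finite_act_inv_preimage[OF \<kappa>_fin 1])
      moreover have "{\<alpha> \<in> carrier G. d' x (\<alpha>, n) \<le> r} = {\<alpha> \<in> carrier G. act (inv \<alpha>) x \<in> {y \<in> Orb n. \<kappa> y \<le> r}}"
        using 1 by (auto simp: d'_simps f_def)
      moreover have "{y \<in> Orb n. d' x y \<le> r} = {y \<in> Orb n. d x y \<le> r}"
        using 1 by (auto simp: d'_simps)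
      ultimately show ?thesis
        unfolding eq using lf[OF 1] by simp
    next
      case (2 \<alpha>)
      have "{y \<in> Orb n. d' x y \<le> r} \<subseteq> act \<alpha> ` {y \<in> Orb n. \<kappa> y \<le> r}"
      proof
        fix y assume "y \<in> {y \<in> Orb n. d' x y \<le> r}"
        then show "y \<in> act \<alpha> ` {y \<in> Orb n. \<kappa> y \<le> r}"
          using 2 by (intro image_eqI[of _ _ "act (inv \<alpha>) y"])
            (auto simp: d'_simps f_def act_inv[where n = n])
      qed
      moreover have "{\<beta> \<in> carrier G. d' x (\<beta>, n) \<le> r} \<subseteq> (\<lambda>\<gamma>. \<alpha> \<otimes> \<gamma>) ` {\<gamma> \<in> carrier G. lam \<gamma> \<le> r}"
      proof
        fix \<beta> assume "\<beta> \<in> {\<beta> \<in> carrier G. d' x (\<beta>, n) \<le> r}"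
        then show "\<beta> \<in> (\<lambda>\<gamma>. \<alpha> \<otimes> \<gamma>) ` {\<gamma> \<in> carrier G. lam \<gamma> \<le> r}"
          using 2 by (intro image_eqI[of _ _ "inv \<alpha> \<otimes> \<beta>"]) (auto simp: d'_simps \<delta> m_assoc[symmetric])
      qed
      ultimately show ?thesis
        unfolding eq using \<kappa>_fin lam_fin by (meson finite_UnI finite_imageI finite_subset)
    qed
  qed
  ultimately have "locally_finite_metric (Suc n) d'"
    unfolding locally_finite_metric_def by blast
  moreover have "d' s (\<one>, n) = k s" if "s \<in> S" for s
  proof -
    have "s \<in> Orb n"
      using that S(3) by auto
    then show ?thesis
      using \<kappa>_S[OF that] by (simp add: d'_simps f_def)
  qed
  moreover have "(\<one>, n) \<in> Orb (Suc n)"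
    by (simp add: Orb_def)
  ultimately show thesis
    using that[of d' "(\<one>, n)"] d'_simps(1) by blast
qed

end

section \<open>Shortcuts\<close>

context group
begin

text \<open>Directed edges; taking all translates makes the set of edges invariant, and with it the
  metric defined from them.\<close>

definition shortcut_edge :: "'a \<Rightarrow> ('a \<times> nat) set \<Rightarrow> 'a \<times> nat \<Rightarrow> 'a \<times> nat \<Rightarrow> bool" where
  "shortcut_edge c F p q \<longleftrightarrow> (\<exists>\<alpha>\<in>carrier G. \<exists>x\<in>F. \<exists>y\<in>F. p = act \<alpha> x \<and> q = act \<alpha> (act c y))"

text \<open>Once the two points of \<open>F\<close> are chosen, one end of an edge determines the
  translating element, by freeness.\<close>

lemma finite_shortcut_edges:
  assumes "finite F" "F \<subseteq> Orb n" "c \<in> carrier G" "p \<in> Orb n"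
  shows "finite {q. shortcut_edge c F p q}" "finite {q. shortcut_edge c F q p}"
proof -
  have *: "{q. shortcut_edge c F p q} \<subseteq>
      (\<Union>x\<in>F. \<Union>y\<in>F. (\<lambda>\<alpha>. act \<alpha> (act c y)) ` {\<alpha> \<in> carrier G. act \<alpha> x \<in> {p}})"
    "{q. shortcut_edge c F q p} \<subseteq>
      (\<Union>x\<in>F. \<Union>y\<in>F. (\<lambda>\<alpha>. act \<alpha> x) ` {\<alpha> \<in> carrier G. act \<alpha> (act c y) \<in> {p}})"
    unfolding shortcut_edge_def by blast+
  have O: "x \<in> Orb n" "act c x \<in> Orb n" if "x \<in> F" for x
    using that assms(2,3) by auto
  show "finite {q. shortcut_edge c F p q}"
    by (rule finite_subset[OF *(1)]) (intro finite_UN_I finite_imageI finite_act_preimage[where n = n] assms(1) O; simp)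
  show "finite {q. shortcut_edge c F q p}"
    by (rule finite_subset[OF *(2)]) (intro finite_UN_I finite_imageI finite_act_preimage[where n = n] assms(1) O; simp)
qed

text \<open>\<open>h\<close> counts the rounds needed to reach a point from \<open>b\<close>, each
  round adding balls and edges. It grows by at most 1 along an edge, however long that edge is for
  \<open>D\<close>, so differences of \<open>h\<close> still bound distances from below after
  shortcuts are added.\<close>

lemma exists_potential:
  assumes lf: "\<And>x r. x \<in> X \<Longrightarrow> finite {y \<in> X. D x y \<le> (r::nat)}"
    and E: "\<And>x. x \<in> X \<Longrightarrow> finite {y \<in> X. E x y}"
    and "X \<noteq> {}"
  obtains h :: "'x \<Rightarrow> nat" where "\<And>r. finite {x \<in> X. h x \<le> r}"
    "\<And>x y. \<lbrakk>x \<in> X; y \<in> X; 0 < D x y\<rbrakk> \<Longrightarrow> h y \<le> h x + D x y"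
    "\<And>x y. \<lbrakk>x \<in> X; y \<in> X; E x y\<rbrakk> \<Longrightarrow> h y \<le> Suc (h x)"
proof -
  obtain b where b: "b \<in> X"
    using assms(3) by blast
  \<comment> \<open>The radius grows with the round because a distance \<open>r\<close> need not
    split into unit steps: after waiting \<open>r - 1\<close> rounds the radius is at least
    \<open>r\<close>, so \<open>r\<close> rounds suffice.\<close>
  define A where "A = rec_nat {b} (\<lambda>i B. B \<union> (\<Union>x\<in>B. {y \<in> X. D x y \<le> Suc i}) \<union> (\<Union>x\<in>B. {y \<in> X. E x y}))"
  have A0: "A 0 = {b}"
    and AS: "A (Suc i) = A i \<union> (\<Union>x\<in>A i. {y \<in> X. D x y \<le> Suc i}) \<union> (\<Union>x\<in>A i. {y \<in> X. E x y})" for i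
    by (simp_all add: A_def)
  have A: "finite (A i) \<and> A i \<subseteq> X" for i
  proof (induction i)
    case 0
    then show ?case
      using b by (simp add: A0)
  next
    case (Suc i)
    then have "finite (\<Union>x\<in>A i. {y \<in> X. D x y \<le> Suc i})" "finite (\<Union>x\<in>A i. {y \<in> X. E x y})"
      by (intro finite_UN_I conjunct1[OF Suc] lf E; blast)+
    then show ?case
      using Suc unfolding AS by blast
  qed
  have mono: "mono A"
    unfolding mono_iff_le_Suc AS by blast
  have reach: "y \<in> A (i + r)" if x: "x \<in> A i" and y: "y \<in> X" "D x y \<le> r" and "0 < r" for x y i r
  proof -
    obtain r' where r: "r = Suc r'"
      using \<open>0 < r\<close> by (cases r) auto
    have "x \<in> A (i + r')"
      using x mono by (meson le_add1 monoD subsetD)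
    then have "y \<in> A (Suc (i + r'))"
      unfolding AS using y r by force
    then show ?thesis
      by (simp add: r)
  qed
  have UA: "\<exists>i. x \<in> A i" if "x \<in> X" for x
    using reach[of b 0 x "Suc (D b x)"] A0 that by auto
  define h where "h x = (LEAST i. x \<in> A i)" for x
  have in_A: "x \<in> A i \<longleftrightarrow> h x \<le> i" if x: "x \<in> X" for x i
  proof
    show "h x \<le> i" if "x \<in> A i"
      using that by (simp add: h_def Least_le)
    have "x \<in> A (h x)"
      using UA[OF x] unfolding h_def by (metis LeastI)
    then show "x \<in> A i" if "h x \<le> i"
      using that mono by (meson monoD subsetD)
  qed
  show thesis
  proof
    show "finite {x \<in> X. h x \<le> r}" for r
      using A[of r] in_A by (auto elim!: rev_finite_subset)
    fix x y assume xy: "x \<in> X" "y \<in> X"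
    show "h y \<le> h x + D x y" if "0 < D x y"
      using reach[of x "h x" y "D x y"] in_A xy that by simp
    show "h y \<le> Suc (h x)" if "E x y"
    proof -
      have "x \<in> A (h x)"
        using in_A xy by simp
      then have "y \<in> A (Suc (h x))"
        unfolding AS using that xy by blast
      then show ?thesis
        using in_A xy by blast
    qed
  qed
qed

text \<open>
  Edges of length \<open>K\<close> are added between all \<open>\<alpha> x\<close> and \<open>\<alpha> c y\<close>. The new metric is the largest
  one that respects them, taken as a supremum of integer-valued pseudometrics so as to keep a
  common denominator. The pseudometric \<open>min d K\<close> shows that distances up to \<open>K\<close> are unaffected.
\<close>

lemma exists_shortcut_metric:
  assumes lfm: "locally_finite_metric n d" and inf: "infinite (carrier G)" and K: "0 < K"
    and F: "finite F" "F \<subseteq> Orb n"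
  obtains d' c where "locally_finite_metric n d'" "c \<in> carrier G"
    "\<And>x y. \<lbrakk>x \<in> Orb n; y \<in> Orb n\<rbrakk> \<Longrightarrow> d' x y \<le> d x y"
    "\<And>x y. \<lbrakk>x \<in> Orb n; y \<in> Orb n\<rbrakk> \<Longrightarrow> min (d x y) (real K) \<le> d' x y"
    "\<And>x y. \<lbrakk>x \<in> F; y \<in> F\<rbrakk> \<Longrightarrow> d' x (act c y) = real K"
proof (cases "n = 0")
  case True
  then have "Orb n = {}" "F = {}"
    using F by (auto simp: Orb_def)
  then show thesis
    using that[of d \<one>] lfm by simp
next
  case False
  interpret Metric_space "Orb n" d
    using lfm by (simp add: locally_finite_metric_def)
  have X_ne: "Orb n \<noteq> {}"
    using False by (auto simp: Orb_def)
  obtain q :: nat where q': "0 < q \<and> (\<forall>x\<in>Orb n. \<forall>y\<in>Orb n. real q * d x y \<in> \<int>)"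
    using lfm unfolding locally_finite_metric_def by blast
  then have q: "0 < q" "\<And>x y. \<lbrakk>x \<in> Orb n; y \<in> Orb n\<rbrakk> \<Longrightarrow> real q * d x y \<in> \<int>"
    by blast+
  have inv: "d (act \<gamma> x) (act \<gamma> y) = d x y"
    if "\<gamma> \<in> carrier G" "x \<in> Orb n" "y \<in> Orb n" for \<gamma> x y
    using lfm that unfolding locally_finite_metric_def by blast
  have lf: "finite {y \<in> Orb n. d x y \<le> r}" if "x \<in> Orb n" for x r
    using lfm that unfolding locally_finite_metric_def by blast
  \<comment> \<open>The rounding is exact, by the choice of the denominator
    \<open>q\<close>.\<close>
  define D where "D x y = nat \<lfloor>real q * d x y\<rfloor>" for x y
  have D: "real (D x y) = real q * d x y" if xy: "x \<in> Orb n" "y \<in> Orb n" for x y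
  proof -
    have "of_int \<lfloor>real q * d x y\<rfloor> = real q * d x y"
      using q(2)[OF xy] by (metis Ints_cases floor_of_int)
    moreover have "0 \<le> real q * d x y"
      by simp
    ultimately show ?thesis
      unfolding D_def by (simp add: of_nat_nat)
  qed
  have D_eq_0: "D x y = 0 \<longleftrightarrow> x = y" if xy: "x \<in> Orb n" "y \<in> Orb n" for x y
    using D[OF xy] q(1) zero[OF xy] by (metis mult_eq_0_iff of_nat_0_eq_iff not_gr_zero)
  have D_sym: "D x y = D y x" for x y
    by (simp add: D_def commute)
  have D_triangle: "D x z \<le> D x y + D y z" if "x \<in> Orb n" "y \<in> Orb n" "z \<in> Orb n" for x y z
  proof -
    have "real q * d x z \<le> real q * (d x y + d y z)"
      using triangle[OF that] by (intro mult_left_mono) auto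
    then have "real (D x z) \<le> real (D x y + D y z)"
      using that by (simp add: D distrib_left)
    then show ?thesis
      by (simp only: of_nat_le_iff)
  qed
  have D_inv: "D (act \<gamma> x) (act \<gamma> y) = D x y" if "\<gamma> \<in> carrier G" "x \<in> Orb n" "y \<in> Orb n" for \<gamma> x y
    using inv[OF that] by (simp add: D_def)
  have D_fin: "finite {y \<in> Orb n. D x y \<le> r}" if x: "x \<in> Orb n" for x r
  proof (rule rev_finite_subset[OF lf[OF x, of "real r / real q"]])
    show "{y \<in> Orb n. D x y \<le> r} \<subseteq> {y \<in> Orb n. d x y \<le> real r / real q}"
    proof safe
      fix a b assume y: "(a, b) \<in> Orb n" "D x (a, b) \<le> r"
      then have "real q * d x (a, b) \<le> real r"
        using D[OF x y(1)] by simp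
      then show "d x (a, b) \<le> real r / real q"
        using q(1) by (simp add: field_simps)
    qed
  qed
  \<comment> \<open>Finite balls and freeness exclude only finitely many elements, so the infinite
    group has a \<open>c\<close> for which all these distances exceed \<open>K\<close> before the
    shortcuts are added.\<close>
  obtain c where c: "c \<in> carrier G" "\<And>x y. \<lbrakk>x \<in> F; y \<in> F\<rbrakk> \<Longrightarrow> q * K < D x (act c y)"
  proof -
    have "finite (\<Union>x\<in>F. \<Union>y\<in>F. {\<gamma> \<in> carrier G. act \<gamma> y \<in> {z \<in> Orb n. D x z \<le> q * K}})"
      using F by (intro finite_UN_I finite_act_preimage[where n = n] D_fin) auto
    then obtain c where "c \<in> carrier G"
        "c \<notin> (\<Union>x\<in>F. \<Union>y\<in>F. {\<gamma> \<in> carrier G. act \<gamma> y \<in> {z \<in> Orb n. D x z \<le> q * K}})"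
      using inf by (meson finite_subset subsetI)
    then show thesis
      using that[of c] F(2) by (auto simp: subset_iff not_le)
  qed
  define E where "E p r \<longleftrightarrow> shortcut_edge c F p r \<or> shortcut_edge c F r p" for p r
  have E_fin: "finite {r \<in> Orb n. E p r}" if "p \<in> Orb n" for p
    using finite_shortcut_edges[OF F c(1) that] unfolding E_def
    by (auto intro: rev_finite_subset[of "{r. shortcut_edge c F p r} \<union> {r. shortcut_edge c F r p}"])
  obtain h where h_fin: "\<And>r. finite {x \<in> Orb n. h x \<le> r}"
    and h_D: "\<And>x y. \<lbrakk>x \<in> Orb n; y \<in> Orb n; 0 < D x y\<rbrakk> \<Longrightarrow> h y \<le> h x + D x y"
    and h_E: "\<And>x y. \<lbrakk>x \<in> Orb n; y \<in> Orb n; E x y\<rbrakk> \<Longrightarrow> h y \<le> Suc (h x)"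
    using exists_potential[where X = "Orb n" and D = D and E = E, OF D_fin E_fin X_ne] by blast
  \<comment> \<open>The scaled pseudometrics below \<open>D\<close> that respect the shortcuts; an
    edge of length \<open>K\<close> has scaled length \<open>q * K\<close>.\<close>
  define R where "R = {\<rho> :: 'a \<times> nat \<Rightarrow> 'a \<times> nat \<Rightarrow> nat.
     (\<forall>x\<in>Orb n. \<forall>y\<in>Orb n. \<rho> x y = \<rho> y x \<and> \<rho> x y \<le> D x y \<and> (E x y \<longrightarrow> \<rho> x y \<le> q * K)) \<and>
     (\<forall>x\<in>Orb n. \<forall>y\<in>Orb n. \<forall>z\<in>Orb n. \<rho> x z \<le> \<rho> x y + \<rho> y z)}"
  have R_le: "\<rho> x y \<le> D x y" "\<rho> x y = \<rho> y x" "E x y \<Longrightarrow> \<rho> x y \<le> q * K"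
    if "\<rho> \<in> R" "x \<in> Orb n" "y \<in> Orb n" for \<rho> x y
    using that unfolding R_def by blast+
  have R_triangle: "\<rho> x z \<le> \<rho> x y + \<rho> y z"
    if "\<rho> \<in> R" "x \<in> Orb n" "y \<in> Orb n" "z \<in> Orb n" for \<rho> x y z
    using that unfolding R_def by blast
  have min_R: "(\<lambda>x y. min (D x y) (q * K)) \<in> R"
    unfolding R_def
  proof (intro CollectI conjI ballI impI)
    fix x y z assume "x \<in> Orb n" "y \<in> Orb n" "z \<in> Orb n"
    then show "min (D x z) (q * K) \<le> min (D x y) (q * K) + min (D y z) (q * K)"
      using D_triangle[of x y z] by auto
  qed (auto simp: D_sym)
  \<comment> \<open>This member bounds the supremum from below by differences of \<open>h\<close>,
    which will keep balls finite. It is admissible because an edge changes \<open>h\<close> by at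
    most 1, hence by at most \<open>q * K\<close>.\<close>
  have h_R: "(\<lambda>x y. nat \<bar>int (h x) - int (h y)\<bar>) \<in> R"
    unfolding R_def
  proof (intro CollectI conjI ballI impI)
    fix x y assume xy: "x \<in> Orb n" "y \<in> Orb n"
    show "nat \<bar>int (h x) - int (h y)\<bar> \<le> D x y"
    proof (cases "x = y")
      case False
      then show ?thesis
        using h_D[of x y] h_D[of y x] D_eq_0[of x y] xy D_sym[of x y] by auto
    qed simp
    show "nat \<bar>int (h x) - int (h y)\<bar> \<le> q * K" if "E x y"
    proof -
      have "E y x"
        using that by (auto simp: E_def)
      then have "nat \<bar>int (h x) - int (h y)\<bar> \<le> 1"
        using that h_E[of x y] h_E[of y x] xy by auto
      also have "1 \<le> q * K"
        using q(1) K by (simp add: Suc_le_eq)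
      finally show ?thesis .
    qed
  qed auto
  define e where "e x y = (SUP \<rho>\<in>R. \<rho> x y)" for x y
  have bdd: "bdd_above ((\<lambda>\<rho>. \<rho> x y) ` R)" if "x \<in> Orb n" "y \<in> Orb n" for x y
    using R_le(1)[OF _ that] by (auto intro!: bdd_aboveI2)
  have R_ne: "R \<noteq> {}"
    using min_R by blast
  have le_e: "\<rho> x y \<le> e x y" if "\<rho> \<in> R" "x \<in> Orb n" "y \<in> Orb n" for \<rho> x y
    unfolding e_def by (rule cSUP_upper[OF that(1) bdd[OF that(2,3)]])
  have e_le: "e x y \<le> b" if "\<And>\<rho>. \<rho> \<in> R \<Longrightarrow> \<rho> x y \<le> b" for x y b
    unfolding e_def by (rule cSUP_least[OF R_ne that])
  have e_D: "e x y \<le> D x y" if "x \<in> Orb n" "y \<in> Orb n" for x y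
    using R_le(1) that by (intro e_le)
  have D_e: "min (D x y) (q * K) \<le> e x y" if "x \<in> Orb n" "y \<in> Orb n" for x y
    using le_e[OF min_R that] .
  have e_sym: "e x y = e y x" if "x \<in> Orb n" "y \<in> Orb n" for x y
    unfolding e_def using R_le(2)[OF _ that] by (intro SUP_cong) auto
  have e_triangle: "e x z \<le> e x y + e y z" if "x \<in> Orb n" "y \<in> Orb n" "z \<in> Orb n" for x y z
  proof (rule e_le)
    fix \<rho> assume "\<rho> \<in> R"
    then show "\<rho> x z \<le> e x y + e y z"
      using R_triangle[of \<rho> x y z] le_e[of \<rho> x y] le_e[of \<rho> y z] that by linarith
  qed
  \<comment> \<open>\<open>R\<close> is closed under precomposition with translations because the
    edges are invariant, and so is the supremum.\<close>
  have e_inv_le: "e (act \<gamma> x) (act \<gamma> y) \<le> e x y" if \<gamma>: "\<gamma> \<in> carrier G" and xy: "x \<in> Orb n" "y \<in> Orb n" for \<gamma> x y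
  proof (rule e_le)
    fix \<rho> assume \<rho>: "\<rho> \<in> R"
    have edge: "shortcut_edge c F (act \<gamma> x) (act \<gamma> y)" if E: "shortcut_edge c F x y" for x y
    proof -
      obtain \<alpha> u v where "\<alpha> \<in> carrier G" "u \<in> F" "v \<in> F" "x = act \<alpha> u" "y = act \<alpha> (act c v)"
        using E unfolding shortcut_edge_def by blast
      moreover have "act \<gamma> (act \<alpha> u) = act (\<gamma> \<otimes> \<alpha>) u" "act \<gamma> (act \<alpha> (act c v)) = act (\<gamma> \<otimes> \<alpha>) (act c v)"
        using calculation \<gamma> c(1) F(2) by (auto intro!: act_act[where n = n])
      ultimately show ?thesis
        unfolding shortcut_edge_def using \<gamma> by (metis m_closed)
    qed
    have "(\<lambda>x y. \<rho> (act \<gamma> x) (act \<gamma> y)) \<in> R"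
      unfolding R_def
    proof (intro CollectI conjI ballI impI)
      fix x y assume xy: "x \<in> Orb n" "y \<in> Orb n"
      then have O: "act \<gamma> x \<in> Orb n" "act \<gamma> y \<in> Orb n"
        using \<gamma> by auto
      show "\<rho> (act \<gamma> x) (act \<gamma> y) = \<rho> (act \<gamma> y) (act \<gamma> x)"
        by (rule R_le(2)[OF \<rho> O])
      show "\<rho> (act \<gamma> x) (act \<gamma> y) \<le> D x y"
        using R_le(1)[OF \<rho> O] D_inv[OF \<gamma> xy] by simp
      show "\<rho> (act \<gamma> x) (act \<gamma> y) \<le> q * K" if "E x y"
        using R_le(3)[OF \<rho> O] edge that unfolding E_def by blast
      show "\<rho> (act \<gamma> x) (act \<gamma> z) \<le> \<rho> (act \<gamma> x) (act \<gamma> y) + \<rho> (act \<gamma> y) (act \<gamma> z)" if "z \<in> Orb n" for z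
        using R_triangle[OF \<rho> O, of "act \<gamma> z"] \<gamma> that by simp
    qed
    from le_e[OF this xy] show "\<rho> (act \<gamma> x) (act \<gamma> y) \<le> e x y" .
  qed
  have e_inv: "e (act \<gamma> x) (act \<gamma> y) = e x y" if \<gamma>: "\<gamma> \<in> carrier G" and xy: "x \<in> Orb n" "y \<in> Orb n" for \<gamma> x y
    using e_inv_le[OF that] e_inv_le[of "inv \<gamma>" "act \<gamma> x" "act \<gamma> y"] that by simp
  define d' where "d' = (\<lambda>x y. if x \<in> Orb n \<and> y \<in> Orb n then real (e x y) / real q else 0)"
  have d': "d' x y = real (e x y) / real q" if "x \<in> Orb n" "y \<in> Orb n" for x y
    using that by (simp add: d'_def)
  have "Metric_space (Orb n) d'"
    unfolding d'_def
  proof (rule Metric_space_cong_on)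
    fix x y assume xy: "x \<in> Orb n" "y \<in> Orb n"
    show "real (e x y) / real q = real (e y x) / real q"
      using e_sym[OF xy] by simp
    have "e x y = 0 \<longleftrightarrow> x = y"
      using e_D[OF xy] D_e[OF xy] D_eq_0[OF xy] q(1) K
      by (metis le_zero_eq min_def mult_is_0 not_gr_zero)
    then show "real (e x y) / real q = 0 \<longleftrightarrow> x = y"
      using q(1) by simp
    fix z assume "z \<in> Orb n"
    then have "real (e x z) \<le> real (e x y) + real (e y z)"
      using e_triangle[OF xy] by (metis of_nat_add of_nat_le_iff)
    then show "real (e x z) / real q \<le> real (e x y) / real q + real (e y z) / real q"
      by (simp add: add_divide_distrib[symmetric] divide_right_mono)
  qed simp
  moreover have "\<exists>q::nat. 0 < q \<and> (\<forall>x\<in>Orb n. \<forall>y\<in>Orb n. real q * d' x y \<in> \<int>)"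
    using q(1) by (intro exI[of _ q]) (simp add: d')
  moreover have "d' (act \<gamma> x) (act \<gamma> y) = d' x y" if "\<gamma> \<in> carrier G" "x \<in> Orb n" "y \<in> Orb n" for \<gamma> x y
    using that e_inv[OF that] by (simp add: d')
  moreover have "finite {y \<in> Orb n. d' x y \<le> r}" if x: "x \<in> Orb n" for x r
  proof (rule finite_subset[OF _ h_fin[of "h x + nat \<lfloor>r * real q\<rfloor>"]])
    show "{y \<in> Orb n. d' x y \<le> r} \<subseteq> {y \<in> Orb n. h y \<le> h x + nat \<lfloor>r * real q\<rfloor>}"
    proof (intro subsetI CollectI conjI)
      fix y assume y': "y \<in> {y \<in> Orb n. d' x y \<le> r}"
      then show y: "y \<in> Orb n"
        by simp
      have "real (e x y) \<le> r * real q"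
        using y' q(1) by (simp add: d'[OF x y] field_simps)
      then have "e x y \<le> nat \<lfloor>r * real q\<rfloor>"
        by (rule le_nat_floor)
      then show "h y \<le> h x + nat \<lfloor>r * real q\<rfloor>"
        using le_e[OF h_R x y] by linarith
    qed
  qed
  ultimately have "locally_finite_metric n d'"
    unfolding locally_finite_metric_def by blast
  moreover have "d' x y \<le> d x y" if "x \<in> Orb n" "y \<in> Orb n" for x y
  proof -
    have "real (e x y) \<le> real q * d x y"
      using e_D[OF that] D[OF that] by (metis of_nat_le_iff)
    then show ?thesis
      using q(1) that by (simp add: d' field_simps)
  qed
  moreover have lower: "min (d x y) (real K) \<le> d' x y" if "x \<in> Orb n" "y \<in> Orb n" for x y
  proof -
    have "min (real q * d x y) (real q * real K) \<le> real (e x y)"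
      using D_e[OF that] D[OF that] by (metis of_nat_le_iff of_nat_min of_nat_mult)
    then have "real q * min (d x y) (real K) \<le> real (e x y)"
      by (auto simp: min_def split: if_splits dest: mult_left_le_imp_le)
        (use q(1) in \<open>auto simp: mult_le_cancel_left\<close>)
    then show ?thesis
      using q(1) that by (simp add: d' field_simps)
  qed
  moreover have "d' x (act c y) = real K" if "x \<in> F" "y \<in> F" for x y
  proof -
    have O: "x \<in> Orb n" "act c y \<in> Orb n"
      using that F(2) c(1) by auto
    have "shortcut_edge c F x (act c y)"
      unfolding shortcut_edge_def using that F(2) O
      by (intro bexI[of _ \<one>] bexI[of _ x] bexI[of _ y]) (auto simp: act_one[where n = n])
    then have "e x (act c y) \<le> q * K"
      using R_le(3)[OF _ O] by (intro e_le) (auto simp: E_def)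
    \<comment> \<open>By the choice of \<open>c\<close> the truncated metric equals
      \<open>q * K\<close> here, so the shortcut has exactly this length.\<close>
    moreover have "q * K \<le> e x (act c y)"
      using D_e[OF O] c(2)[OF that] by simp
    ultimately show ?thesis
      using q(1) by (simp add: d'[OF O])
  qed
  ultimately show thesis
    using that[of d' c] c(1) by blast
qed

end

section \<open>Spreading actions on the limit of a tower\<close>

text \<open>The extension property in one-point form. It suits both the limit of the tower, where
  Katetov functions are handled one at a time, and back and forth.\<close>

locale one_point_space = Metric_space U d for U :: "'u set" and d +
  assumes countable: "countable U"
    and rational: "\<lbrakk>x \<in> U; y \<in> U\<rbrakk> \<Longrightarrow> d x y \<in> \<rat>"
    and nonempty: "U \<noteq> {}"
    and one_point: "\<lbrakk>finite S; S \<noteq> {}; S \<subseteq> U; katetov S d k; \<And>s. s \<in> S \<Longrightarrow> 0 < k s; \<And>s. s \<in> S \<Longrightarrow> k s \<in> \<rat>\<rbrakk>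
      \<Longrightarrow> \<exists>v\<in>U. \<forall>s\<in>S. d s v = k s"

text \<open>Infinite repetition lets a task wait for a stage at which the points and distances that
  it mentions have settled.\<close>

lemma enumerate_infinitely_often:
  assumes "countable A" "A \<noteq> {}"
  obtains e :: "nat \<Rightarrow> 'x" where "\<And>a m. a \<in> A \<Longrightarrow> \<exists>n\<ge>m. e n = a"
proof
  show "\<exists>n\<ge>m. from_nat_into A (fst (prod_decode n)) = a" if "a \<in> A" for a m
    using that assms
    by (intro exI[of _ "prod_encode (to_nat_on A a, m)"]) (simp add: le_prod_encode_2)
qed

context group
begin

text \<open>First an orbit realizing \<open>k\<close> over \<open>S\<close> is adjoined, then
  shortcuts of length \<open>Suc m\<close> are added. The bound
  \<open>k s \<le> real (Suc m)\<close> protects the prescribed distances from the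
  shortcuts.\<close>

lemma tower_step:
  assumes lfm: "locally_finite_metric (Suc m) d" and inf: "infinite (carrier G)"
    and F: "finite F" "F \<subseteq> Orb (Suc m)" and "finite S"
  obtains d' c where "locally_finite_metric (Suc (Suc m)) d'" "c \<in> carrier G"
    "\<And>x y. \<lbrakk>x \<in> Orb (Suc m); y \<in> Orb (Suc m)\<rbrakk> \<Longrightarrow> d' x y \<le> d x y"
    "\<And>x y. \<lbrakk>x \<in> Orb (Suc m); y \<in> Orb (Suc m)\<rbrakk> \<Longrightarrow> min (d x y) (real (Suc m)) \<le> d' x y"
    "\<And>x y. \<lbrakk>x \<in> F; y \<in> F\<rbrakk> \<Longrightarrow> d' x (act c y) = real (Suc m)"
    "\<lbrakk>S \<noteq> {}; S \<subseteq> Orb (Suc m); katetov S d k; \<forall>s\<in>S. 0 < k s \<and> k s \<in> \<rat> \<and> k s \<le> real (Suc m)\<rbrakk>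
       \<Longrightarrow> \<exists>v\<in>Orb (Suc (Suc m)). \<forall>s\<in>S. d' s v = k s"
proof -
  interpret Metric_space "Orb (Suc m)" d
    using lfm by (simp add: locally_finite_metric_def)
  define ok where "ok \<longleftrightarrow> S \<noteq> {} \<and> S \<subseteq> Orb (Suc m) \<and> katetov S d k \<and>
    (\<forall>s\<in>S. 0 < k s \<and> k s \<in> \<rat> \<and> k s \<le> real (Suc m))"
  have Orb_mono: "x \<in> Orb (Suc (Suc m))" if "x \<in> Orb (Suc m)" for x
    using that by (auto simp: Orb_def)
  obtain d1 where d1: "locally_finite_metric (Suc (Suc m)) d1"
      "\<And>x y. \<lbrakk>x \<in> Orb (Suc m); y \<in> Orb (Suc m)\<rbrakk> \<Longrightarrow> d1 x y = d x y"
      "ok \<Longrightarrow> \<exists>v\<in>Orb (Suc (Suc m)). \<forall>s\<in>S. d1 s v = k s"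
  proof (cases ok)
    case True
    obtain d' v where d': "locally_finite_metric (Suc (Suc m)) d'"
        "\<And>x y. \<lbrakk>x \<in> Orb (Suc m); y \<in> Orb (Suc m)\<rbrakk> \<Longrightarrow> d' x y = d x y"
        "v \<in> Orb (Suc (Suc m))" "\<And>s. s \<in> S \<Longrightarrow> d' s v = k s"
      by (rule extend_metric_by_orbit[OF lfm \<open>finite S\<close>, of k]) (use True ok_def in auto)
    have "\<exists>v\<in>Orb (Suc (Suc m)). \<forall>s\<in>S. d' s v = k s"
      by (rule bexI[OF _ d'(3)]) (intro ballI d'(4))
    then show thesis
      using that[OF d'(1,2)] by blast
  next
    case False
    \<comment> \<open>An inadmissible task is answered by a new orbit at distance 1 from an
      arbitrary point, so that every step adds exactly one orbit.\<close>
    have one_in: "(\<one>, 0) \<in> Orb (Suc m)"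
      by (simp add: Orb_def)
    obtain d' v where d': "locally_finite_metric (Suc (Suc m)) d'"
        "\<And>x y. \<lbrakk>x \<in> Orb (Suc m); y \<in> Orb (Suc m)\<rbrakk> \<Longrightarrow> d' x y = d x y"
      by (rule extend_metric_by_orbit[OF lfm, of "{(\<one>, 0)}" "\<lambda>_. 1"]) (use one_in in \<open>auto simp: katetov_def\<close>)
    show thesis
      by (rule that[OF d']) (use False in auto)
  qed
  have "F \<subseteq> Orb (Suc (Suc m))"
    using F(2) Orb_mono by blast
  from exists_shortcut_metric[OF d1(1) inf zero_less_Suc[of m] F(1) this]
  obtain d' c where d': "locally_finite_metric (Suc (Suc m)) d'" "c \<in> carrier G"
    "\<And>x y. \<lbrakk>x \<in> Orb (Suc (Suc m)); y \<in> Orb (Suc (Suc m))\<rbrakk> \<Longrightarrow> d' x y \<le> d1 x y"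
    "\<And>x y. \<lbrakk>x \<in> Orb (Suc (Suc m)); y \<in> Orb (Suc (Suc m))\<rbrakk> \<Longrightarrow> min (d1 x y) (real (Suc m)) \<le> d' x y"
    "\<And>x y. \<lbrakk>x \<in> F; y \<in> F\<rbrakk> \<Longrightarrow> d' x (act c y) = real (Suc m)"
    by blast
  show thesis
  proof (rule that[OF d'(1,2)])
    show "d' x y \<le> d x y" "min (d x y) (real (Suc m)) \<le> d' x y"
      if "x \<in> Orb (Suc m)" "y \<in> Orb (Suc m)" for x y
      using that d'(3,4)[of x y] d1(2)[of x y] Orb_mono by auto
    show "d' x (act c y) = real (Suc m)" if "x \<in> F" "y \<in> F" for x y
      by (rule d'(5)[OF that])
    assume S: "S \<noteq> {}" "S \<subseteq> Orb (Suc m)" "katetov S d k" "\<forall>s\<in>S. 0 < k s \<and> k s \<in> \<rat> \<and> k s \<le> real (Suc m)"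
    then obtain v where v: "v \<in> Orb (Suc (Suc m))" "\<forall>s\<in>S. d1 s v = k s"
      using d1(3) unfolding ok_def by blast
    \<comment> \<open>The upper and lower bounds for \<open>d'\<close> coincide, since
      \<open>d1 s v = k s\<close> is at most the shortcut length.\<close>
    have "d' s v = k s" if "s \<in> S" for s
      using d'(3,4)[of s v] v S(4) that Orb_mono[of s] S(2) by (force simp: min_def)
    then show "\<exists>v\<in>Orb (Suc (Suc m)). \<forall>s\<in>S. d' s v = k s"
      using v(1) by blast
  qed
qed

proposition exists_spreading_model:
  fixes V :: "('a \<times> nat) set"
  assumes ctb: "countable (carrier G)" and inf: "infinite (carrier G)"
  defines "V \<equiv> carrier G \<times> UNIV"
  obtains D c where "one_point_space V D"
    "\<And>\<gamma> x y. \<lbrakk>\<gamma> \<in> carrier G; x \<in> V; y \<in> V\<rbrakk> \<Longrightarrow> D (act \<gamma> x) (act \<gamma> y) = D x y"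
    "\<And>n. c n \<in> carrier G"
    "\<And>x y. \<lbrakk>x \<in> V; y \<in> V\<rbrakk> \<Longrightarrow> \<forall>\<^sub>F n in sequentially. D x (act (c n) y) = real n"
proof -
  define a where "a = from_nat_into (carrier G)"
  have a: "a n \<in> carrier G" for n
    by (simp add: a_def from_nat_into carrier_not_empty)
  \<comment> \<open>Increasing finite sets that eventually contain each point of \<open>V\<close>;
    the shortcuts of stage \<open>m\<close> are added for the pairs in \<open>F m\<close>.\<close>
  define F where "F m = a ` {..m} \<times> {..m}" for m :: nat
  have F: "finite (F m)" "F m \<subseteq> Orb (Suc m)" for m
    using a by (auto simp: F_def Orb_def)
  have V_Orb: "\<forall>\<^sub>F m in sequentially. x \<in> Orb (Suc m)" if "x \<in> V" for x
    using eventually_ge_at_top[of "snd x"] by eventually_elim (use that in \<open>auto simp: V_def Orb_def\<close>)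
  have V_F: "\<forall>\<^sub>F m in sequentially. x \<in> F m" if x: "x \<in> V" for x
  proof -
    obtain n where n: "a n = fst x"
      using from_nat_into_surj[OF ctb, of "fst x"] x by (auto simp: a_def V_def)
    show ?thesis
      using eventually_ge_at_top[of "max n (snd x)"]
      by eventually_elim (use n in \<open>auto simp: F_def mem_Times_iff intro!: rev_image_eqI[of n]\<close>)
  qed
  have Orb_V: "Orb m \<subseteq> V" for m
    by (auto simp: Orb_def V_def)
  \<comment> \<open>A task is a finite list of points with prescribed rational distances, read as a
    finite partial map.\<close>
  have "countable (lists (V \<times> (\<rat> :: real set)))"
    using ctb by (intro countable_lists countable_SIGMA countable_rat) (auto simp: V_def)
  then obtain e :: "nat \<Rightarrow> (('a \<times> nat) \<times> real) list"
    where e: "\<And>xs m. xs \<in> lists (V \<times> \<rat>) \<Longrightarrow> \<exists>n\<ge>m. e n = xs"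
    using enumerate_infinitely_often[of "lists (V \<times> (\<rat> :: real set))"] by blast
  define S where "S m = dom (map_of (e m))" for m
  define k where "k m s = the (map_of (e m) s)" for m s
  define P where "P m d \<longleftrightarrow> locally_finite_metric (Suc m) d" for m d
  define Q where "Q m d d' \<longleftrightarrow>
    (\<forall>x\<in>Orb (Suc m). \<forall>y\<in>Orb (Suc m). d' x y \<le> d x y \<and> min (d x y) (real (Suc m)) \<le> d' x y) \<and>
    (\<exists>c\<in>carrier G. \<forall>x\<in>F m. \<forall>y\<in>F m. d' x (act c y) = real (Suc m)) \<and>
    (S m \<noteq> {} \<longrightarrow> S m \<subseteq> Orb (Suc m) \<longrightarrow> katetov (S m) d (k m) \<longrightarrow>
       (\<forall>s\<in>S m. 0 < k m s \<and> k m s \<in> \<rat> \<and> k m s \<le> real (Suc m)) \<longrightarrow>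
       (\<exists>v\<in>Orb (Suc (Suc m)). \<forall>s\<in>S m. d' s v = k m s))" for m d d'
  have "\<exists>d. P 0 d"
    using exists_base_metric[OF ctb] by (simp add: P_def)
  moreover have "\<exists>d'. P (Suc m) d' \<and> Q m d d'" if d: "P m d" for m d
  proof -
    obtain d' c where d': "locally_finite_metric (Suc (Suc m)) d'" "c \<in> carrier G"
      "\<And>x y. \<lbrakk>x \<in> Orb (Suc m); y \<in> Orb (Suc m)\<rbrakk> \<Longrightarrow> d' x y \<le> d x y"
      "\<And>x y. \<lbrakk>x \<in> Orb (Suc m); y \<in> Orb (Suc m)\<rbrakk> \<Longrightarrow> min (d x y) (real (Suc m)) \<le> d' x y"
      "\<And>x y. \<lbrakk>x \<in> F m; y \<in> F m\<rbrakk> \<Longrightarrow> d' x (act c y) = real (Suc m)"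
      "\<lbrakk>S m \<noteq> {}; S m \<subseteq> Orb (Suc m); katetov (S m) d (k m);
         \<forall>s\<in>S m. 0 < k m s \<and> k m s \<in> \<rat> \<and> k m s \<le> real (Suc m)\<rbrakk>
         \<Longrightarrow> \<exists>v\<in>Orb (Suc (Suc m)). \<forall>s\<in>S m. d' s v = k m s"
      by (rule tower_step[OF d[unfolded P_def] inf F, where S = "S m" and k = "k m"])
        (auto simp: S_def finite_dom_map_of)
    show ?thesis
      unfolding P_def Q_def
      by (intro exI[of _ d'] conjI impI ballI bexI[of _ c] d') auto
  qed
  ultimately obtain f where f: "\<And>m. P m (f m)" "\<And>m. Q m (f m) (f (Suc m))"
    using dependent_nat_choice[of P Q] by metis
  have lfm: "locally_finite_metric (Suc m) (f m)" for m
    using f(1) by (simp add: P_def)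
  have met: "Metric_space (Orb (Suc m)) (f m)" for m
    using lfm by (simp add: locally_finite_metric_def)
  have f_Suc: "f (Suc m) x y \<le> f m x y" "min (f m x y) (real (Suc m)) \<le> f (Suc m) x y"
    if "x \<in> Orb (Suc m)" "y \<in> Orb (Suc m)" for m x y
    using f(2)[of m] that unfolding Q_def by blast+
  obtain c0 where c0: "\<And>m. c0 m \<in> carrier G"
      "\<And>m x y. \<lbrakk>x \<in> F m; y \<in> F m\<rbrakk> \<Longrightarrow> f (Suc m) x (act (c0 m) y) = real (Suc m)"
  proof -
    have "\<forall>m. \<exists>c. c \<in> carrier G \<and> (\<forall>x\<in>F m. \<forall>y\<in>F m. f (Suc m) x (act c y) = real (Suc m))"
      using f(2) unfolding Q_def by blast
    from choice[OF this] show thesis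
      using that by blast
  qed
  have f_point: "\<exists>v\<in>Orb (Suc (Suc m)). \<forall>s\<in>S m. f (Suc m) s v = k m s"
    if "S m \<noteq> {}" "S m \<subseteq> Orb (Suc m)" "katetov (S m) (f m) (k m)"
      "\<forall>s\<in>S m. 0 < k m s \<and> k m s \<in> \<rat> \<and> k m s \<le> real (Suc m)" for m
    using f(2)[of m] that unfolding Q_def by blast
  have Orb_mono: "x \<in> Orb (Suc m')" if "x \<in> Orb (Suc m)" "m \<le> m'" for x m m'
    using that by (auto simp: Orb_def)
  have f_decr: "f m' x y \<le> f m x y" if "x \<in> Orb (Suc m)" "y \<in> Orb (Suc m)" "m \<le> m'" for m m' x y
    using that(3)
  proof (induction m' rule: dec_induct)
    case (step i)
    then show ?case
      using f_Suc(1)[OF Orb_mono[OF that(1) step(1)] Orb_mono[OF that(2) step(1)]] by linarith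
  qed simp
  \<comment> \<open>A distance that is at most \<open>Suc m\<close> at stage \<open>m\<close> does
    not exceed any later shortcut length and is therefore frozen.\<close>
  have f_stable: "f m' x y = f m x y"
    if "x \<in> Orb (Suc m)" "y \<in> Orb (Suc m)" "f m x y \<le> real (Suc m)" "m \<le> m'" for m m' x y
    using that(4)
  proof (induction m' rule: dec_induct)
    case (step i)
    then have "f i x y \<le> real (Suc i)"
      using that(3) by simp
    then show ?case
      using f_Suc[OF Orb_mono[OF that(1) step(1)] Orb_mono[OF that(2) step(1)]] step(3) by linarith
  qed simp
  \<comment> \<open>Distances only decrease while the threshold grows, so every distance freezes at
    some stage.\<close>
  have ex_lim: "\<exists>r. \<forall>\<^sub>F m in sequentially. f m x y = r" if xy: "x \<in> V" "y \<in> V" for x y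
  proof -
    obtain n where n: "x \<in> Orb (Suc n)" "y \<in> Orb (Suc n)"
      using eventually_happens[OF eventually_conj[OF V_Orb[OF xy(1)] V_Orb[OF xy(2)]]] by auto
    obtain m where m: "n \<le> m" "f n x y \<le> real (Suc m)"
      by (metis nat_le_linear real_nat_ceiling_ge order_trans of_nat_le_iff le_SucI)
    have "f m x y \<le> real (Suc m)"
      using f_decr[OF n m(1)] m(2) by linarith
    then have "f m' x y = f m x y" if "m \<le> m'" for m'
      using f_stable[of x m y m'] Orb_mono[OF n(1) m(1)] Orb_mono[OF n(2) m(1)] that by blast
    then show ?thesis
      unfolding eventually_sequentially by blast
  qed
  define D where "D x y = (if x \<in> V \<and> y \<in> V then THE r. \<forall>\<^sub>F m in sequentially. f m x y = r else 0)" for x y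
  have lim_unique: "r = r'"
    if "\<forall>\<^sub>F m in sequentially. f m x y = r" "\<forall>\<^sub>F m in sequentially. f m x y = r'" for x y r r'
    using eventually_happens[OF eventually_conj[OF that]] by auto
  have D_lim: "\<forall>\<^sub>F m in sequentially. f m x y = D x y" if "x \<in> V" "y \<in> V" for x y
  proof -
    have "\<exists>!r. \<forall>\<^sub>F m in sequentially. f m x y = r"
      using ex_lim[OF that] lim_unique by blast
    from theI'[OF this] show ?thesis
      using that by (simp add: D_def)
  qed
  have D_eq: "D x y = r" if "x \<in> V" "y \<in> V" "\<forall>\<^sub>F m in sequentially. f m x y = r" for x y r
    using lim_unique[OF D_lim[OF that(1,2)] that(3)] .
  have D_stable: "D x y = f m x y" if "x \<in> Orb (Suc m)" "y \<in> Orb (Suc m)" "f m x y \<le> real (Suc m)" for m x y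
  proof (rule D_eq)
    show "x \<in> V" "y \<in> V"
      using that(1,2) Orb_V by blast+
    show "\<forall>\<^sub>F m' in sequentially. f m' x y = f m x y"
      unfolding eventually_sequentially using f_stable[OF that] by blast
  qed
  \<comment> \<open>Each axiom mentions finitely many distances, hence holds at a stage where all of
    them have reached their limit values.\<close>
  have "Metric_space V (\<lambda>x y. if x \<in> V \<and> y \<in> V then D x y else 0)"
  proof (rule Metric_space_cong_on)
    fix x y assume xy: "x \<in> V" "y \<in> V"
    have "\<forall>\<^sub>F m in sequentially. 0 \<le> D x y"
      using D_lim[OF xy] by eventually_elim (use Metric_space.nonneg[OF met] in metis)
    then show "0 \<le> D x y"
      by simp
    have "\<forall>\<^sub>F m in sequentially. D x y = D y x"
      using D_lim[OF xy] D_lim[OF xy(2,1)]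
      by eventually_elim (use Metric_space.commute[OF met] in metis)
    then show "D x y = D y x"
      by simp
    have "\<forall>\<^sub>F m in sequentially. D x y = 0 \<longleftrightarrow> x = y"
      using D_lim[OF xy] V_Orb[OF xy(1)] V_Orb[OF xy(2)]
      by eventually_elim (use Metric_space.zero[OF met] in metis)
    then show "D x y = 0 \<longleftrightarrow> x = y"
      by simp
    fix z assume z: "z \<in> V"
    have "\<forall>\<^sub>F m in sequentially. D x z \<le> D x y + D y z"
      using D_lim[OF xy] D_lim[OF xy(1) z] D_lim[OF xy(2) z]  V_Orb[OF xy(1)] V_Orb[OF xy(2)] V_Orb[OF z]
      by eventually_elim (use Metric_space.triangle[OF met] in metis)
    then show "D x z \<le> D x y + D y z"
      by simp
  qed
  moreover have "(\<lambda>x y. if x \<in> V \<and> y \<in> V then D x y else 0) = D"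
    by (auto simp: D_def fun_eq_iff)
  ultimately have D_metric: "Metric_space V D"
    by simp
  have D_rat: "D x y \<in> \<rat>" if xy: "x \<in> V" "y \<in> V" for x y
  proof -
    obtain m where m: "f m x y = D x y" "x \<in> Orb (Suc m)" "y \<in> Orb (Suc m)"
      using eventually_happens[OF eventually_conj[OF D_lim[OF xy] eventually_conj[OF V_Orb[OF xy(1)] V_Orb[OF xy(2)]]]]
      by auto
    obtain q :: nat where "0 < q" "real q * f m x y \<in> \<int>"
      using lfm[of m] m(2,3) unfolding locally_finite_metric_def by blast
    then have "real q * f m x y \<in> \<rat>" "f m x y = real q * f m x y / real q"
      using Ints_subset_Rats by auto
    then show ?thesis
      using m(1) by (metis Rats_divide Rats_of_nat)
  qed
  have act_V: "act \<gamma> x \<in> V" if "\<gamma> \<in> carrier G" "x \<in> V" for \<gamma> x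
    using that by (auto simp: V_def act_def)
  have D_inv: "D (act \<gamma> x) (act \<gamma> y) = D x y" if \<gamma>: "\<gamma> \<in> carrier G" and xy: "x \<in> V" "y \<in> V" for \<gamma> x y
  proof (rule D_eq)
    show "\<forall>\<^sub>F m in sequentially. f m (act \<gamma> x) (act \<gamma> y) = D x y"
      using D_lim[OF xy] V_Orb[OF xy(1)] V_Orb[OF xy(2)]
    proof eventually_elim
      case (elim m)
      then show ?case
        using lfm[of m] \<gamma> unfolding locally_finite_metric_def by metis
    qed
  qed (use act_V \<gamma> xy in auto)
  have point: "\<exists>v\<in>V. \<forall>s\<in>T. D s v = h s"
    if T: "finite T" "T \<noteq> {}" "T \<subseteq> V" and h: "katetov T D h" "\<And>s. s \<in> T \<Longrightarrow> 0 < h s" "\<And>s. s \<in> T \<Longrightarrow> h s \<in> \<rat>"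
    for T h
  proof -
    obtain ys where ys: "set ys = T"
      using finite_list[OF T(1)] by blast
    define xs where "xs = map (\<lambda>y. (y, h y)) ys"
    have xs: "xs \<in> lists (V \<times> \<rat>)" "dom (map_of xs) = T" "\<And>s. s \<in> T \<Longrightarrow> the (map_of xs s) = h s"
      using ys T h(3) by (auto simp: xs_def map_of_map_restrict dom_map_of_conv_image_fst image_image)
    obtain b where b: "\<forall>s\<in>T. h s \<le> real b"
    proof -
      have "\<forall>s\<in>T. h s \<le> real (nat \<lceil>Max (h ` T)\<rceil>)"
        using T(1) by (auto intro: order_trans[OF Max_ge real_nat_ceiling_ge])
      then show thesis
        using that by blast
    qed
    have "\<forall>\<^sub>F m in sequentially. \<forall>x\<in>T. \<forall>y\<in>T. f m x y = D x y"
      by (intro eventually_ball_finite ballI D_lim subsetD[OF T(3)] T(1))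
    moreover have "\<forall>\<^sub>F m in sequentially. \<forall>x\<in>T. x \<in> Orb (Suc m)"
      using V_Orb T(1,3) by (intro eventually_ball_finite ballI) auto
    ultimately have "\<forall>\<^sub>F m in sequentially. (\<forall>x\<in>T. \<forall>y\<in>T. f m x y = D x y) \<and> (\<forall>x\<in>T. x \<in> Orb (Suc m)) \<and> b \<le> m"
      using eventually_ge_at_top[of b] by eventually_elim blast
    then obtain N where N: "\<And>m. N \<le> m \<Longrightarrow> (\<forall>x\<in>T. \<forall>y\<in>T. f m x y = D x y) \<and> (\<forall>x\<in>T. x \<in> Orb (Suc m)) \<and> b \<le> m"
      unfolding eventually_sequentially by blast
    \<comment> \<open>The task comes up again after stage \<open>N\<close>, when \<open>T\<close>
      lies in the stage, its distances have settled and the values of \<open>h\<close> are below the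
      shortcut length.\<close>
    obtain m where m: "N \<le> m" "e m = xs"
      using e[OF xs(1)] by blast
    have Sm: "S m = T" "\<And>s. s \<in> T \<Longrightarrow> k m s = h s"
      using xs m(2) by (simp_all add: S_def k_def)
    have hm: "h s \<le> real (Suc m)" if "s \<in> T" for s
      using b N[OF m(1)] that by force
    have "\<exists>v\<in>Orb (Suc (Suc m)). \<forall>s\<in>S m. f (Suc m) s v = k m s"
    proof (rule f_point)
      show "katetov (S m) (f m) (k m)"
        using h(1) N[OF m(1)] by (simp add: katetov_def Sm)
      show "S m \<noteq> {}" "S m \<subseteq> Orb (Suc m)"
        using T N[OF m(1)] by (auto simp: Sm)
      show "\<forall>s\<in>S m. 0 < k m s \<and> k m s \<in> \<rat> \<and> k m s \<le> real (Suc m)"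
        using h(2,3) hm by (simp add: Sm)
    qed
    then obtain v where v: "v \<in> Orb (Suc (Suc m))" "\<And>s. s \<in> T \<Longrightarrow> f (Suc m) s v = h s"
      by (auto simp: Sm)
    have "D s v = h s" if "s \<in> T" for s
    proof -
      have "s \<in> Orb (Suc (Suc m))"
        using N[OF m(1)] that Orb_mono[of s m "Suc m"] by simp
      then show ?thesis
        using D_stable[of s "Suc m" v] v that hm[OF that] by simp
    qed
    then show ?thesis
      using v(1) Orb_V by blast
  qed
  have "one_point_space V D"
  proof (intro one_point_space.intro one_point_space_axioms.intro D_metric)
    show "countable V"
      using ctb by (auto simp: V_def)
    show "V \<noteq> {}"
      by (auto simp: V_def)
  qed (use D_rat point in auto)
  \<comment> \<open>Stage \<open>m\<close> creates shortcuts of length \<open>Suc m\<close>, hence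
    the shift by one.\<close>
  moreover define c where "c n = (case n of 0 \<Rightarrow> \<one> | Suc m \<Rightarrow> c0 m)" for n
  moreover have "c n \<in> carrier G" for n
    using c0(1) by (auto simp: c_def split: nat.split)
  moreover have "\<forall>\<^sub>F n in sequentially. D x (act (c n) y) = real n" if xy: "x \<in> V" "y \<in> V" for x y
  proof -
    have "\<forall>\<^sub>F m in sequentially. D x (act (c (Suc m)) y) = real (Suc m)"
      using V_F[OF xy(1)] V_F[OF xy(2)]
    proof eventually_elim
      case (elim m)
      then have xy: "x \<in> Orb (Suc (Suc m))" "y \<in> Orb (Suc (Suc m))"
        using F(2)[of m] Orb_mono[OF _ le_SucI[OF order_refl]] by blast+
      then have "x \<in> Orb (Suc (Suc m))" "act (c0 m) y \<in> Orb (Suc (Suc m))"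
        using c0(1) by simp_all
      then show ?case
        using D_stable[of x "Suc m" "act (c0 m) y"] c0(2)[OF elim] by (simp add: c_def)
    qed
    then show ?thesis
      using eventually_sequentially_Suc[of "\<lambda>n. D x (act (c n) y) = real n"] by simp
  qed
  ultimately show thesis
    using that[of D c] D_inv by blast
qed

end

section \<open>Extending finite partial isometries\<close>

context one_point_space
begin

lemma exists_bound:
  assumes "finite A"
  obtains N :: nat where "0 < N" "\<And>x y. \<lbrakk>x \<in> A; y \<in> A\<rbrakk> \<Longrightarrow> d x y \<le> real N"
proof -
  have "\<exists>N::nat. \<forall>x\<in>A. \<forall>y\<in>A. d x y \<le> real N"
  proof (intro exI ballI)
    fix x y assume "x \<in> A" "y \<in> A"
    then have "d x y \<le> Max ((\<lambda>(x, y). d x y) ` (A \<times> A))"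
      using assms by (intro Max_ge) auto
    also have "\<dots> \<le> real (nat \<lceil>Max ((\<lambda>(x, y). d x y) ` (A \<times> A))\<rceil>)"
      by (rule real_nat_ceiling_ge)
    finally show "d x y \<le> real (nat \<lceil>Max ((\<lambda>(x, y). d x y) ` (A \<times> A))\<rceil>)" .
  qed
  then obtain N :: nat where N: "\<forall>x\<in>A. \<forall>y\<in>A. d x y \<le> real N"
    by blast
  show thesis
    by (rule that[of "Suc N"]) (use N in fastforce)+
qed

text \<open>Extending \<open>k\<close> to \<open>Z\<close> by \<open>kext\<close> prescribes
  positive distances from the points of \<open>Z\<close> in \<open>U\<close>, so the realizing point
  is none of them.\<close>

lemma exists_point_avoiding:
  assumes "finite S" "S \<subseteq> U" "katetov S d k" "\<And>s. s \<in> S \<Longrightarrow> 0 < k s" "\<And>s. s \<in> S \<Longrightarrow> k s \<in> \<rat>" "finite Z"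
  obtains v where "v \<in> U" "v \<notin> Z" "\<And>s. s \<in> S \<Longrightarrow> d s v = k s"
proof -
  obtain z where z: "z \<in> U"
    using nonempty by blast
  \<comment> \<open>For empty \<open>S\<close> a single point with prescribed distance 1 serves
    instead.\<close>
  define S' where "S' = (if S = {} then {z} else S)"
  define k' where "k' = (if S = {} then (\<lambda>_. 1) else k)"
  have S': "finite S'" "S' \<noteq> {}" "S' \<subseteq> U" "katetov S' d k'"
      "\<And>s. s \<in> S' \<Longrightarrow> 0 < k' s" "\<And>s. s \<in> S' \<Longrightarrow> k' s \<in> \<rat>"
    using assms z by (auto simp: S'_def k'_def katetov_def split: if_splits)
  define h where "h = kext S' d k'"
  have sub: "S' \<union> (Z \<inter> U) \<subseteq> U"
    using S'(3) by blast
  have "katetov U d h"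
    unfolding h_def by (rule katetov_kext[OF S'(1-4)])
  then have "katetov (S' \<union> (Z \<inter> U)) d h"
    using sub unfolding katetov_def by blast
  moreover have h_pos: "0 < h x" for x
    unfolding h_def by (rule kext_pos[OF S'(1,2,5)])
  moreover have "h x \<in> \<rat>" if "x \<in> U" for x
  proof -
    obtain s where "s \<in> S'" "h x = k' s + d s x"
      unfolding h_def by (rule kext_attained[OF S'(1,2)])
    then show ?thesis
      using S'(3,6) rational[of s x] that by auto
  qed
  ultimately have "\<exists>v\<in>U. \<forall>x\<in>S' \<union> (Z \<inter> U). d x v = h x"
    using S'(1,2) assms(6) sub by (intro one_point) auto
  then obtain v where v: "v \<in> U" "\<And>x. x \<in> S' \<union> (Z \<inter> U) \<Longrightarrow> d x v = h x"
    by blast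
  have "v \<notin> Z"
    using v(2)[of v] h_pos[of v] v(1) by auto
  moreover have "d s v = k s" if "s \<in> S" for s
  proof -
    have "S' = S" "k' = k"
      using that by (auto simp: S'_def k'_def)
    then show ?thesis
      using v(2)[of s] kext_eq[OF S'(1,3,4), of s] that by (simp add: h_def)
  qed
  ultimately show thesis
    using that v(1) by blast
qed

end

text \<open>A relation instead of a function, so that converses and unions are at hand for back and
  forth. Single-valuedness and injectivity follow from the distances.\<close>

definition partial_isometry :: "'u set \<Rightarrow> ('u \<Rightarrow> 'u \<Rightarrow> real) \<Rightarrow> 'v set \<Rightarrow> ('v \<Rightarrow> 'v \<Rightarrow> real) \<Rightarrow> ('u \<times> 'v) set \<Rightarrow> bool" where
  "partial_isometry U d V e p \<longleftrightarrow>
     finite p \<and> p \<subseteq> U \<times> V \<and> (\<forall>x y x' y'. (x, y) \<in> p \<longrightarrow> (x', y') \<in> p \<longrightarrow> e y y' = d x x')"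

lemma partial_isometryD:
  assumes "partial_isometry U d V e p"
  shows "finite p" "\<And>x y. (x, y) \<in> p \<Longrightarrow> x \<in> U" "\<And>x y. (x, y) \<in> p \<Longrightarrow> y \<in> V"
    "\<And>x y x' y'. \<lbrakk>(x, y) \<in> p; (x', y') \<in> p\<rbrakk> \<Longrightarrow> e y y' = d x x'"
  using assms unfolding partial_isometry_def by blast+

lemma partial_isometry_converse:
  "partial_isometry U d V e p \<Longrightarrow> partial_isometry V e U d (p\<inverse>)"
  by (auto simp: partial_isometry_def)

section \<open>Back and forth between two Urysohn spaces\<close>

locale two_one_point_spaces = X: one_point_space U d + Y: one_point_space V e
  for U :: "'u set" and d and V :: "'v set" and e
begin

lemma partial_isometry_functional:
  assumes "partial_isometry U d V e p" "(x, y) \<in> p" "(x', y') \<in> p"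
  shows "x = x' \<longleftrightarrow> y = y'"
  using partial_isometryD[OF assms(1)] assms(2,3) X.zero[of x x'] Y.zero[of y y'] by metis

lemma partial_isometry_Un:
  assumes p: "partial_isometry U d V e p" and r: "partial_isometry U d V e r"
    and pr: "\<And>x y x' y'. \<lbrakk>(x, y) \<in> p; (x', y') \<in> r\<rbrakk> \<Longrightarrow> e y y' = d x x'"
  shows "partial_isometry U d V e (p \<union> r)"
proof -
  have "e y' y = d x' x" if "(x, y) \<in> p" "(x', y') \<in> r" for x y x' y'
    using pr[OF that] by (simp add: X.commute Y.commute)
  then show ?thesis
    using p r pr unfolding partial_isometry_def by blast
qed

text \<open>Transported along \<open>p\<close>, the distances from \<open>x\<close> form a Katetov
  function on \<open>Range p\<close>, positive because \<open>x\<close> is new. A realizing point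
  can be chosen outside any finite set.\<close>

lemma extend_partial_isometry:
  assumes p: "partial_isometry U d V e p" and x: "x \<in> U" "x \<notin> Domain p" and "finite Z"
  obtains y where "y \<in> V" "y \<notin> Z" "y \<notin> Range p" "partial_isometry U d V e (insert (x, y) p)"
proof -
  note pD = partial_isometryD[OF p]
  define g where "g y = (SOME x'. (x', y) \<in> p)" for y
  have g: "g y = x'" if "(x', y) \<in> p" for x' y
    unfolding g_def
  proof (rule some_equality)
    show "x'' = x'" if "(x'', y) \<in> p" for x''
      using partial_isometry_functional[OF p that \<open>(x', y) \<in> p\<close>] by simp
  qed (rule that)
  obtain y where y: "y \<in> V" "y \<notin> Z \<union> Range p" "\<And>s. s \<in> Range p \<Longrightarrow> e s y = d (g s) x"
  proof (rule Y.exists_point_avoiding[of "Range p" "\<lambda>s. d (g s) x" "Z \<union> Range p"])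
    show "finite (Range p)" "finite (Z \<union> Range p)"
      using pD(1) \<open>finite Z\<close> by (simp_all add: finite_Range)
    show "Range p \<subseteq> V"
      using pD(3) by blast
    show "katetov (Range p) e (\<lambda>s. d (g s) x)"
      unfolding katetov_def
    proof (intro ballI)
      fix s t assume "s \<in> Range p" "t \<in> Range p"
      then obtain a b where ab: "(a, s) \<in> p" "(b, t) \<in> p"
        by blast
      then have "a \<in> U" "b \<in> U"
        using pD(2) by blast+
      then show "e s t \<le> d (g s) x + d (g t) x \<and> d (g s) x \<le> e s t + d (g t) x"
        using X.triangle[of a x b] X.triangle[of a b x] x(1) pD(4)[OF ab] by (simp add: g[OF ab(1)] g[OF ab(2)] X.commute)
    qed
    fix s assume "s \<in> Range p"
    then obtain a where a: "(a, s) \<in> p"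
      by blast
    then have "a \<in> U" "a \<noteq> x"
      using pD(2) x by blast+
    then show "0 < d (g s) x" "d (g s) x \<in> \<rat>"
      using x(1) X.rational[of a x] by (simp_all add: g[OF a] order_less_le)
  qed blast
  have "partial_isometry U d V e (insert (x, y) p)"
  proof -
    have "e s y = d a x" if "(a, s) \<in> p" for a s
      using y(3)[of s] that g[OF that] by blast
    then show ?thesis
      using p x(1) y(1) unfolding partial_isometry_def
      by (auto simp: X.commute Y.commute)
  qed
  then show thesis
    using that y(1,2) by blast
qed

text \<open>Back and forth that meets countably many dense sets of finite partial isometries on the
  way. With \<open>\<D>\<close> empty this is the uniqueness of the Urysohn space.\<close>

lemma exists_generic_isometry:
  assumes \<D>: "countable \<D>" and dense: "\<And>D p. \<lbrakk>D \<in> \<D>; partial_isometry U d V e p\<rbrakk>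
      \<Longrightarrow> \<exists>p'\<in>D. partial_isometry U d V e p' \<and> p \<subseteq> p'"
  obtains w where "bij_betw w U V" "\<And>x y. \<lbrakk>x \<in> U; y \<in> U\<rbrakk> \<Longrightarrow> e (w x) (w y) = d x y"
    "\<And>D. D \<in> \<D> \<Longrightarrow> \<exists>p\<in>D. partial_isometry U d V e p \<and> (\<forall>(x, y)\<in>p. w x = y)"
proof -
  \<comment> \<open>The added sets put every point of \<open>U\<close> into the domain and every
    point of \<open>V\<close> into the range.\<close>
  define \<E> where "\<E> = \<D> \<union> (\<lambda>x. {p. x \<in> Domain p}) ` U \<union> (\<lambda>y. {p. y \<in> Range p}) ` V"
  have \<E>: "countable \<E>" "\<E> \<noteq> {}"
    using \<D> X.countable Y.countable X.nonempty by (auto simp: \<E>_def)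
  have \<E>_dense: "\<exists>p'\<in>D. partial_isometry U d V e p' \<and> p \<subseteq> p'"
    if D: "D \<in> \<E>" and p: "partial_isometry U d V e p" for D p
  proof -
    \<comment> \<open>Exchanging the two spaces turns the extension of domains into the extension of
      ranges.\<close>
    interpret C: two_one_point_spaces V e U d
      by unfold_locales
    consider "D \<in> \<D>" | x where "x \<in> U" "D = {p. x \<in> Domain p}" | y where "y \<in> V" "D = {p. y \<in> Range p}"
      using D unfolding \<E>_def by blast
    then show ?thesis
    proof cases
      case 1
      then show ?thesis
        using dense p by blast
    next
      case (2 x)
      show ?thesis
      proof (cases "x \<in> Domain p")
        case False
        then obtain y where "partial_isometry U d V e (insert (x, y) p)"
          using extend_partial_isometry[OF p 2(1) _ finite.emptyI] by blast
        then show ?thesis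
          using 2(2) by (intro bexI[of _ "insert (x, y) p"]) auto
      qed (use 2 p in blast)
    next
      case (3 y)
      show ?thesis
      proof (cases "y \<in> Range p")
        case False
        then have "y \<notin> Domain (p\<inverse>)"
          by simp
        then obtain x where "partial_isometry V e U d (insert (y, x) (p\<inverse>))"
          using C.extend_partial_isometry[OF partial_isometry_converse[OF p] 3(1) _ finite.emptyI] by blast
        moreover have "(insert (y, x) (p\<inverse>))\<inverse> = insert (x, y) p"
          by auto
        ultimately have "partial_isometry U d V e (insert (x, y) p)"
          using partial_isometry_converse by metis
        then show ?thesis
          using 3(2) by (intro bexI[of _ "insert (x, y) p"]) auto
      qed (use 3 p in blast)
    qed
  qed
  define En where "En = from_nat_into \<E>"
  have En: "En n \<in> \<E>" for n
    by (simp add: En_def from_nat_into[OF \<E>(2)])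
  have "\<exists>p. partial_isometry U d V e p"
    by (intro exI[of _ "{}"]) (simp add: partial_isometry_def)
  moreover have "\<exists>p'. partial_isometry U d V e p' \<and> (p \<subseteq> p' \<and> p' \<in> En n)"
    if "partial_isometry U d V e p" for n p
    using \<E>_dense[OF En that] by blast
  ultimately obtain f where f: "\<And>n. partial_isometry U d V e (f n)" "\<And>n. f n \<subseteq> f (Suc n)" "\<And>n. f (Suc n) \<in> En n"
    using dependent_nat_choice[of "\<lambda>_. partial_isometry U d V e" "\<lambda>n p p'. p \<subseteq> p' \<and> p' \<in> En n"] by metis
  have mono: "f m \<subseteq> f n" if "m \<le> n" for m n
    by (rule lift_Suc_mono_le[of f, OF f(2) that])
  have meets: "\<exists>n. f n \<in> D" if "D \<in> \<E>" for D
    using f(3) from_nat_into_surj[OF \<E>(1) that] unfolding En_def by metis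
  define W where "W = (\<Union>n. f n)"
  have common: "\<exists>n. (x, y) \<in> f n \<and> (x', y') \<in> f n" if W: "(x, y) \<in> W" "(x', y') \<in> W" for x y x' y'
  proof -
    obtain m n where "(x, y) \<in> f m" "(x', y') \<in> f n"
      using W unfolding W_def by blast
    then show ?thesis
      using mono[of m "max m n"] mono[of n "max m n"] by (intro exI[of _ "max m n"]) auto
  qed
  have W_iso: "e y y' = d x x'" "x = x' \<longleftrightarrow> y = y'" if "(x, y) \<in> W" "(x', y') \<in> W" for x y x' y'
    using common[OF that] partial_isometryD(4)[OF f(1)] partial_isometry_functional[OF f(1)] by metis+
  have W_in: "x \<in> U" "y \<in> V" if "(x, y) \<in> W" for x y
    using that partial_isometryD(2,3)[OF f(1)] unfolding W_def by blast+
  have W_dom: "\<exists>y. (x, y) \<in> W" if "x \<in> U" for x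
  proof -
    have "{p. x \<in> Domain p} \<in> \<E>"
      using that by (auto simp: \<E>_def)
    from meets[OF this] show ?thesis
      unfolding W_def by blast
  qed
  have W_ran: "\<exists>x. (x, y) \<in> W" if "y \<in> V" for y
  proof -
    have "{p. y \<in> Range p} \<in> \<E>"
      using that by (auto simp: \<E>_def)
    from meets[OF this] show ?thesis
      unfolding W_def by blast
  qed
  obtain w where w: "\<And>x. x \<in> U \<Longrightarrow> (x, w x) \<in> W"
    using W_dom by metis
  have w_eq: "w x = y" if "(x, y) \<in> W" for x y
    using W_iso(2)[OF w[OF W_in(1)[OF that]] that] by simp
  show thesis
  proof
    show "bij_betw w U V"
      unfolding bij_betw_def
    proof
      show "inj_on w U"
        using W_iso(2)[OF w w] by (auto intro!: inj_onI)
      show "w ` U = V"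
        using w w_eq W_ran W_in by force
    qed
    show "e (w x) (w y) = d x y" if "x \<in> U" "y \<in> U" for x y
      by (rule W_iso(1)[OF w[OF that(1)] w[OF that(2)]])
    show "\<exists>p\<in>D. partial_isometry U d V e p \<and> (\<forall>(x, y)\<in>p. w x = y)" if D: "D \<in> \<D>" for D
    proof -
      obtain n where "f n \<in> D"
        using meets[of D] D by (auto simp: \<E>_def)
      moreover have "\<forall>(x, y)\<in>f n. w x = y"
        using w_eq unfolding W_def by blast
      ultimately show ?thesis
        using f(1) by blast
    qed
  qed
qed

end

text \<open>Points are adjoined one at a time; the distances to the next point, carried over by the
  embedding so far, form a Katetov function.\<close>

lemma (in one_point_space) exists_isometric_embedding:
  assumes "Metric_space Y e" "finite Y" "\<And>x y. \<lbrakk>x \<in> Y; y \<in> Y\<rbrakk> \<Longrightarrow> e x y \<in> \<rat>"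
    and "X \<subseteq> Y" "f \<in> X \<rightarrow> U" "isometric_on X e d f"
  obtains g where "g \<in> Y \<rightarrow> U" "isometric_on Y e d g" "\<And>x. x \<in> X \<Longrightarrow> g x = f x"
proof -
  interpret Y: Metric_space Y e
    by fact
  have "\<exists>g. g \<in> X \<union> T \<rightarrow> U \<and> isometric_on (X \<union> T) e d g \<and> (\<forall>x\<in>X. g x = f x)" if "T \<subseteq> Y" "finite T" for T
    using that(2,1)
  proof (induction T)
    case empty
    then show ?case
      using assms(5,6) by auto
  next
    case (insert y T)
    then obtain g where g: "g \<in> X \<union> T \<rightarrow> U" "isometric_on (X \<union> T) e d g" "\<forall>x\<in>X. g x = f x"
      by auto
    have sub: "X \<union> T \<subseteq> Y" "y \<in> Y" and fin: "finite (X \<union> T)"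
      using insert.prems assms(2,4) by (auto intro: finite_subset)
    show ?case
    proof (cases "y \<in> X \<union> T")
      case True
      then show ?thesis
        using g by (intro exI[of _ g]) (simp add: insert_absorb)
    next
      case False
      have g_d: "d (g s) (g t) = e s t" if "s \<in> X \<union> T" "t \<in> X \<union> T" for s t
        using g(2) that by (auto simp: isometric_on_def)
      have g_inj: "s = t" if "s \<in> X \<union> T" "t \<in> X \<union> T" "g s = g t" for s t
      proof -
        have "s \<in> Y" "t \<in> Y" "g t \<in> U"
          using that(1,2) sub(1) g(1) by auto
        then show ?thesis
          using g_d[OF that(1,2)] that(3) by simp
      qed
      have inv: "inv_into (X \<union> T) g (g s) = s" if "s \<in> X \<union> T" for s
        using that g_inj by (intro inv_into_f_f inj_onI) auto
      obtain v where v: "v \<in> U" "\<And>s. s \<in> g ` (X \<union> T) \<Longrightarrow> d s v = e (inv_into (X \<union> T) g s) y"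
      proof (rule exists_point_avoiding[of "g ` (X \<union> T)" "\<lambda>s. e (inv_into (X \<union> T) g s) y" "{}"])
        show "katetov (g ` (X \<union> T)) d (\<lambda>s. e (inv_into (X \<union> T) g s) y)"
          unfolding katetov_def
        proof (intro ballI)
          fix a b assume "a \<in> g ` (X \<union> T)" "b \<in> g ` (X \<union> T)"
          then obtain s t where st: "s \<in> X \<union> T" "t \<in> X \<union> T" "a = g s" "b = g t"
            by blast
          then have "s \<in> Y" "t \<in> Y"
            using sub by auto
          then show "d a b \<le> e (inv_into (X \<union> T) g a) y + e (inv_into (X \<union> T) g b) y \<and>
              e (inv_into (X \<union> T) g a) y \<le> d a b + e (inv_into (X \<union> T) g b) y"
            using Y.triangle[of s y t] Y.triangle[of s t y] sub(2)
            by (simp add: st(3,4) inv[OF st(1)] inv[OF st(2)] g_d[OF st(1,2)] Y.commute)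
        qed
        fix a assume "a \<in> g ` (X \<union> T)"
        then obtain s where s: "s \<in> X \<union> T" "a = g s"
          by blast
        then have "s \<in> Y" "s \<noteq> y"
          using sub False by auto
        then show "0 < e (inv_into (X \<union> T) g a) y" "e (inv_into (X \<union> T) g a) y \<in> \<rat>"
          using sub(2) assms(3)[of s y] by (simp_all add: s(2) inv[OF s(1)] order_less_le)
      qed (use g(1) fin in auto)
      define g' where "g' = g(y := v)"
      have g'_y: "g' y = v" and g'_s: "\<And>s. s \<in> X \<union> T \<Longrightarrow> g' s = g s"
        using False by (auto simp: g'_def)
      have d_v: "d (g s) v = e s y" if "s \<in> X \<union> T" for s
        using v(2)[of "g s"] inv[OF that] that by simp
      have d_v': "d v (g s) = e y s" if "s \<in> X \<union> T" for s
        using d_v[OF that] by (simp add: commute[of v "g s"] Y.commute[of y s])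
      have "d (g' s) (g' t) = e s t" if st: "s \<in> insert y (X \<union> T)" "t \<in> insert y (X \<union> T)" for s t
      proof -
        consider "s = y" "t = y" | "s = y" "t \<in> X \<union> T" | "s \<in> X \<union> T" "t = y" | "s \<in> X \<union> T" "t \<in> X \<union> T"
          using st by blast
        then show ?thesis
          by cases (use v(1) sub(2) in \<open>simp_all add: g'_y g'_s g_d d_v d_v' del: Un_iff\<close>)
      qed
      moreover have "g' \<in> insert y (X \<union> T) \<rightarrow> U"
        using g(1) g'_y g'_s v(1) by auto
      ultimately show ?thesis
        using g(3) g'_s by (intro exI[of _ g']) (simp add: isometric_on_def)
    qed
  qed
  from this[of Y] assms(2,4) show thesis
    using that by (auto simp: Un_absorb1)
qed

text \<open>\<open>Z\<close> and \<open>A\<close> are glued as disjoint sets, even if they meet,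
  with all mixed distances \<open>R\<close>. A constant no smaller than the given distances
  satisfies the mixed triangle inequalities. The embedding is the identity on
  \<open>Z\<close>.\<close>

lemma (in one_point_space) exists_far_copy:
  assumes "finite Z" "Z \<subseteq> U" "finite A" "A \<subseteq> U" "0 < R" "R \<in> \<rat>"
    "\<And>x y. \<lbrakk>x \<in> Z \<union> A; y \<in> Z \<union> A\<rbrakk> \<Longrightarrow> d x y \<le> R"
  obtains f where "f \<in> A \<rightarrow> U" "isometric_on A d d f" "\<And>z a. \<lbrakk>z \<in> Z; a \<in> A\<rbrakk> \<Longrightarrow> d z (f a) = R"
proof -
  define g where "g = (\<lambda>x y. case (x, y) of (Inl a, Inl a') \<Rightarrow> d a a' | (Inr b, Inr b') \<Rightarrow> d b b'
                 | (Inl a, Inr b) \<Rightarrow> \<bar>R\<bar> | (Inr b, Inl a) \<Rightarrow> \<bar>R\<bar>)"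
  have R: "d x y \<le> R + R" "R \<le> d x y + R" if "x \<in> Z \<union> A" "y \<in> Z \<union> A" for x y
    using assms(7)[OF that] assms(5) by (simp_all add: add_increasing2)
  have g: "Metric_space (Z <+> A) g"
    unfolding g_def
    by (rule Metric_space_glue[where f = "\<lambda>_ _. R"]) (use R assms subspace[OF assms(2)] subspace[OF assms(4)] in \<open>auto simp: add.commute\<close>)
  obtain h where h: "h \<in> Z <+> A \<rightarrow> U" "isometric_on (Z <+> A) g d h" "\<And>x. x \<in> Inl ` Z \<Longrightarrow> h x = projl x"
  proof (rule exists_isometric_embedding[OF g, of "Inl ` Z" projl])
    show "g x y \<in> \<rat>" if "x \<in> Z <+> A" "y \<in> Z <+> A" for x y
      using that assms(5,6) rational[OF subsetD[OF assms(2)] subsetD[OF assms(2)]]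
        rational[OF subsetD[OF assms(4)] subsetD[OF assms(4)]] by (auto simp: g_def)
    show "isometric_on (Inl ` Z) g d projl"
      by (auto simp: isometric_on_def g_def)
  qed (use assms in auto)
  show thesis
  proof (rule that[of "\<lambda>a. h (Inr a)"])
    show "(\<lambda>a. h (Inr a)) \<in> A \<rightarrow> U"
      using h(1) by auto
    have h_d: "d (h x) (h y) = g x y" if "x \<in> Z <+> A" "y \<in> Z <+> A" for x y
      using h(2) that by (auto simp: isometric_on_def)
    show "isometric_on A d d (\<lambda>a. h (Inr a))"
      using h_d by (auto simp: isometric_on_def g_def InrI)
    show "d z (h (Inr a)) = R" if "z \<in> Z" "a \<in> A" for z a
      using h_d[of "Inl z" "Inr a"] h(3)[of "Inl z"] that assms(5) by (simp add: g_def InlI InrI)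
  qed
qed

text \<open>\<open>S\<close> with a point added is a finite metric space. It is coded on
  \<open>{..n}\<close> because the axiom speaks of sets of naturals: \<open>n\<close> is the new
  point and the smaller numbers enumerate \<open>S\<close>.\<close>

lemma rational_urysohn_space_one_point:
  fixes U :: "'u set"
  assumes "rational_urysohn_space U d"
  shows "one_point_space U d"
proof -
  interpret rational_urysohn_space U d
    by fact
  have ext: "\<exists>v\<in>U. \<forall>s\<in>S. d s v = k s"
    if S: "finite S" "S \<subseteq> U" and k: "katetov S d k" "\<And>s. s \<in> S \<Longrightarrow> 0 < k s" "\<And>s. s \<in> S \<Longrightarrow> k s \<in> \<rat>"
    for S k
  proof -
    obtain f where f: "bij_betw f {..<card S} S"
      using ex_bij_betw_nat_finite[OF S(1)] by (auto simp: atLeast0LessThan)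
    define n where "n = card S"
    define \<iota> where "\<iota> i = (if i < n then Inl (f i) else Inr ())" for i
    define g :: "'u + unit \<Rightarrow> 'u + unit \<Rightarrow> real"
      where "g = (\<lambda>x y. case (x, y) of (Inl a, Inl a') \<Rightarrow> d a a' | (Inr b, Inr b') \<Rightarrow> 0
                 | (Inl a, Inr b) \<Rightarrow> \<bar>k a\<bar> | (Inr b, Inl a) \<Rightarrow> \<bar>k a\<bar>)"
    have f_in: "f i \<in> S" if "i < n" for i
      using f that by (auto simp: n_def bij_betw_def)
    have "Metric_space (S <+> {()}) g"
      unfolding g_def
      by (rule Metric_space_glue[where f = "\<lambda>a _. k a" and e = "\<lambda>_ _. 0"])
        (use subspace[OF S(2)] k katetovD[OF k(1)] in \<open>auto simp: Metric_space_def intro: order_less_imp_le add_nonneg_nonneg\<close>)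
    then have m: "Metric_space {..n} (\<lambda>i j. g (\<iota> i) (\<iota> j))"
    proof (rule Metric_space_pullback)
      show "inj_on \<iota> {..n}"
        using f by (auto simp: inj_on_def \<iota>_def bij_betw_def n_def)
      show "\<iota> ` {..n} \<subseteq> S <+> {()}"
        using f_in by (auto simp: \<iota>_def)
    qed
    obtain h where h: "h \<in> {..n} \<rightarrow> U" "isometric_on {..n} (\<lambda>i j. g (\<iota> i) (\<iota> j)) d h" "\<forall>i\<in>{..<n}. h i = f i"
    proof -
      have rat: "g (\<iota> i) (\<iota> j) \<in> \<rat>" for i j
        using f_in k(3) rational[OF subsetD[OF S(2)] subsetD[OF S(2)]] by (simp add: g_def \<iota>_def)
      have "isometric_on {..<n} (\<lambda>i j. g (\<iota> i) (\<iota> j)) d f"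
        by (simp add: isometric_on_def g_def \<iota>_def)
      moreover have "f \<in> {..<n} \<rightarrow> U"
        using f_in S(2) by auto
      moreover have "{..<n} \<subseteq> {..n}"
        by auto
      ultimately have "\<exists>h. h \<in> {..n} \<rightarrow> U \<and> isometric_on {..n} (\<lambda>i j. g (\<iota> i) (\<iota> j)) d h \<and> (\<forall>i\<in>{..<n}. h i = f i)"
        using extension[OF finite_atMost m rat, of "{..<n}" f] by blast
      then show thesis
        using that by blast
    qed
    have "d s (h n) = k s" if s: "s \<in> S" for s
    proof -
      have "s \<in> f ` {..<n}"
        using bij_betw_imp_surj_on[OF f] s by (simp add: n_def)
      then obtain i where i: "i < n" "f i = s"
        by auto
      then have "d (h i) (h n) = g (\<iota> i) (\<iota> n)"
        using h(2) by (simp add: isometric_on_def)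
      then show ?thesis
        using h(3) i k(2)[OF s] by (simp add: g_def \<iota>_def)
    qed
    then show ?thesis
      using h(1) by (intro bexI[of _ "h n"]) auto
  qed
  show ?thesis
  proof
    have "\<exists>v\<in>U. \<forall>s\<in>{}. d s v = 1"
      by (rule ext) (auto simp: katetov_def)
    then show "U \<noteq> {}"
      by blast
    show "countable U"
      by (rule countable)
    show "d x y \<in> \<rat>" if "x \<in> U" "y \<in> U" for x y
      by (rule rational[OF that])
    fix S k
    assume S: "finite S" "S \<noteq> {}" "S \<subseteq> U" "katetov S d k"
      and k: "\<And>s. s \<in> S \<Longrightarrow> 0 < k s" "\<And>s. s \<in> S \<Longrightarrow> k s \<in> \<rat>"
    show "\<exists>v\<in>U. \<forall>s\<in>S. d s v = k s"
      by (rule ext[OF S(1,3,4)]) (simp_all add: k)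
  qed
qed

section \<open>Spreading actions\<close>

text \<open>\<open>BijGroup U\<close> consists of extensional functions, hence the first condition
  on \<open>\<phi>\<close>; bijectivity comes from the inverse group element.\<close>

lemma group_actionI:
  assumes "group G"
    and ext: "\<And>\<gamma>. \<gamma> \<in> carrier G \<Longrightarrow> \<phi> \<gamma> \<in> extensional U"
    and closed: "\<And>\<gamma> x. \<lbrakk>\<gamma> \<in> carrier G; x \<in> U\<rbrakk> \<Longrightarrow> \<phi> \<gamma> x \<in> U"
    and one: "\<And>x. x \<in> U \<Longrightarrow> \<phi> \<one>\<^bsub>G\<^esub> x = x"
    and mult: "\<And>\<gamma> \<gamma>' x. \<lbrakk>\<gamma> \<in> carrier G; \<gamma>' \<in> carrier G; x \<in> U\<rbrakk> \<Longrightarrow> \<phi> (\<gamma> \<otimes>\<^bsub>G\<^esub> \<gamma>') x = \<phi> \<gamma> (\<phi> \<gamma>' x)"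
  shows "group_action G U \<phi>"
proof -
  interpret group G
    by fact
  have Bij: "\<phi> \<gamma> \<in> Bij U" if \<gamma>: "\<gamma> \<in> carrier G" for \<gamma>
  proof -
    have "bij_betw (\<phi> \<gamma>) U U"
      by (rule bij_betw_byWitness[where f' = "\<phi> (inv\<^bsub>G\<^esub> \<gamma>)"])
        (use \<gamma> closed one mult[of \<gamma> "inv\<^bsub>G\<^esub> \<gamma>"] mult[of "inv\<^bsub>G\<^esub> \<gamma>" \<gamma>] in auto)
    then show ?thesis
      using ext[OF \<gamma>] by (simp add: Bij_def)
  qed
  have "\<phi> (\<gamma> \<otimes>\<^bsub>G\<^esub> \<gamma>') = compose U (\<phi> \<gamma>) (\<phi> \<gamma>')" if \<gamma>: "\<gamma> \<in> carrier G" "\<gamma>' \<in> carrier G" for \<gamma> \<gamma>'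
    by (rule extensionalityI[OF ext compose_extensional]) (use \<gamma> mult in \<open>auto simp: compose_eq\<close>)
  then have "\<phi> \<in> hom G (BijGroup U)"
    using Bij by (auto simp: hom_def BijGroup_def)
  then show ?thesis
    by (simp add: group_action_def group_hom_def group_hom_axioms_def group_BijGroup group_axioms)
qed

lemma (in group_action) action_closed: "\<lbrakk>\<gamma> \<in> carrier G; x \<in> E\<rbrakk> \<Longrightarrow> \<phi> \<gamma> x \<in> E"
  using element_image by blast

lemma (in group_action) action_one: "x \<in> E \<Longrightarrow> \<phi> \<one> x = x"
  using id_eq_one by (metis restrict_apply')

lemma (in group_action) action_inv:
  assumes "\<gamma> \<in> carrier G" "x \<in> E"
  shows "\<phi> (inv \<gamma>) (\<phi> \<gamma> x) = x" "\<phi> \<gamma> (\<phi> (inv \<gamma>) x) = x"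
proof -
  interpret group G
    using group_hom group_hom.axioms(1) by auto
  show "\<phi> (inv \<gamma>) (\<phi> \<gamma> x) = x" "\<phi> \<gamma> (\<phi> (inv \<gamma>) x) = x"
    using composition_rule[of x "inv \<gamma>" \<gamma>] composition_rule[of x \<gamma> "inv \<gamma>"] assms action_one by simp_all
qed

text \<open>Freeness serves faithfulness. The sequence \<open>c\<close> serves homogeneity: it makes
  all distances between two finite sets equal to one large number, so that partial isometries can be
  united.\<close>

locale spreading_action = group_action G U \<alpha> + Metric_space U d
  for G :: "('g, 'm) monoid_scheme" (structure) and U :: "'u set" and d and \<alpha> +
  fixes c :: "nat \<Rightarrow> 'g"
  assumes isometric: "\<lbrakk>\<gamma> \<in> carrier G; x \<in> U; y \<in> U\<rbrakk> \<Longrightarrow> d (\<alpha> \<gamma> x) (\<alpha> \<gamma> y) = d x y"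
    and free: "\<lbrakk>\<gamma> \<in> carrier G; x \<in> U; \<alpha> \<gamma> x = x\<rbrakk> \<Longrightarrow> \<gamma> = \<one>"
    and c_closed: "c n \<in> carrier G"
    and spread: "\<lbrakk>x \<in> U; y \<in> U\<rbrakk> \<Longrightarrow> \<forall>\<^sub>F n in sequentially. d x (\<alpha> (c n) y) = real n"
begin

lemma spread_finite:
  assumes "finite A" "finite B" "A \<subseteq> U" "B \<subseteq> U"
  shows "\<forall>\<^sub>F n in sequentially. \<forall>x\<in>A. \<forall>y\<in>B. d x (\<alpha> (c n) y) = real n"
  using assms by (intro eventually_ball_finite ballI spread) auto

end

text \<open>The action on the limit of the tower is carried over along an isometry from
  \<open>U\<close>.\<close>

proposition (in group) exists_spreading_action:
  fixes U :: "'u set"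
  assumes "countable (carrier G)" "infinite (carrier G)" "one_point_space U d"
  obtains \<alpha> c where "spreading_action G U d \<alpha> c"
proof -
  interpret U: one_point_space U d
    by fact
  define V :: "('a \<times> nat) set" where "V = carrier G \<times> UNIV"
  obtain D c where V: "one_point_space V D"
    and D_inv: "\<And>\<gamma> x y. \<lbrakk>\<gamma> \<in> carrier G; x \<in> V; y \<in> V\<rbrakk> \<Longrightarrow> D (act \<gamma> x) (act \<gamma> y) = D x y"
    and c: "\<And>n. c n \<in> carrier G"
    and spread: "\<And>x y. \<lbrakk>x \<in> V; y \<in> V\<rbrakk> \<Longrightarrow> \<forall>\<^sub>F n in sequentially. D x (act (c n) y) = real n"
    using exists_spreading_model[OF assms(1,2)] unfolding V_def by blast
  interpret two_one_point_spaces U d V D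
    using V by (simp add: two_one_point_spaces_def U.one_point_space_axioms)
  obtain u where u: "bij_betw u U V" and uD: "\<And>x y. \<lbrakk>x \<in> U; y \<in> U\<rbrakk> \<Longrightarrow> D (u x) (u y) = d x y"
    by (rule exists_generic_isometry[of "{}"]) auto
  define u' where "u' = inv_into U u"
  have u_in: "u x \<in> V" if "x \<in> U" for x
    using u that by (auto simp: bij_betw_def)
  have u'_in: "u' y \<in> U" and uu': "u (u' y) = y" if "y \<in> V" for y
    using u that by (auto simp: u'_def bij_betw_def inv_into_into f_inv_into_f)
  have u'u: "u' (u x) = x" if "x \<in> U" for x
    using u that by (simp add: u'_def bij_betw_inv_into_left)
  have act_V: "act \<gamma> y \<in> V" if "\<gamma> \<in> carrier G" "y \<in> V" for \<gamma> y
    using that by (auto simp: V_def act_def)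
  define \<alpha> where "\<alpha> \<gamma> = (\<lambda>x\<in>U. u' (act \<gamma> (u x)))" for \<gamma>
  have u_\<alpha>: "u (\<alpha> \<gamma> x) = act \<gamma> (u x)" and \<alpha>_in: "\<alpha> \<gamma> x \<in> U" if "\<gamma> \<in> carrier G" "x \<in> U" for \<gamma> x
    using that u_in act_V uu' u'_in by (simp_all add: \<alpha>_def)
  have "group_action G U \<alpha>"
  proof (rule group_actionI[OF group_axioms])
    show "\<alpha> \<gamma> \<in> extensional U" for \<gamma>
      by (simp add: \<alpha>_def)
    show "\<alpha> \<gamma> x \<in> U" if "\<gamma> \<in> carrier G" "x \<in> U" for \<gamma> x
      by (rule \<alpha>_in[OF that])
    show "\<alpha> \<one> x = x" if "x \<in> U" for x
    proof -
      have "act \<one> (u x) = u x"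
        using u_in[OF that] by (auto simp: V_def act_def)
      then show ?thesis
        using that u'u by (simp add: \<alpha>_def)
    qed
    show "\<alpha> (\<gamma> \<otimes> \<gamma>') x = \<alpha> \<gamma> (\<alpha> \<gamma>' x)" if "\<gamma> \<in> carrier G" "\<gamma>' \<in> carrier G" "x \<in> U" for \<gamma> \<gamma>' x
    proof -
      have "act (\<gamma> \<otimes> \<gamma>') (u x) = act \<gamma> (act \<gamma>' (u x))"
        using u_in[OF that(3)] that(1,2) by (auto simp: V_def act_def m_assoc)
      then show ?thesis
        using that u_\<alpha>[of \<gamma>' x] \<alpha>_in[of \<gamma>' x] by (simp add: \<alpha>_def)
    qed
  qed
  moreover have "spreading_action_axioms G U d \<alpha> c"
  proof
    show "d (\<alpha> \<gamma> x) (\<alpha> \<gamma> y) = d x y" if "\<gamma> \<in> carrier G" "x \<in> U" "y \<in> U" for \<gamma> x y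
      using uD[of "\<alpha> \<gamma> x" "\<alpha> \<gamma> y"] uD[of x y] D_inv[of \<gamma> "u x" "u y"] that u_in \<alpha>_in by (simp add: u_\<alpha>)
    show "\<gamma> = \<one>" if \<gamma>: "\<gamma> \<in> carrier G" and x: "x \<in> U" and fix_x: "\<alpha> \<gamma> x = x" for \<gamma> x
    proof -
      have "fst (act \<gamma> (u x)) = fst (u x)" "fst (u x) \<in> carrier G"
        using u_\<alpha>[OF \<gamma> x] fix_x u_in[OF x] by (auto simp: V_def)
      then show ?thesis
        using \<gamma> by (simp add: act_def)
    qed
    show "c n \<in> carrier G" for n
      by (rule c)
    show "\<forall>\<^sub>F n in sequentially. d x (\<alpha> (c n) y) = real n" if "x \<in> U" "y \<in> U" for x y
      using spread[OF u_in[OF that(1)] u_in[OF that(2)]]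
    proof eventually_elim
      case (elim n)
      then show ?case
        using uD[of x "\<alpha> (c n) y"] that c \<alpha>_in by (simp add: u_\<alpha>)
    qed
  qed
  ultimately have "spreading_action G U d \<alpha> c"
    by (simp add: spreading_action_def U.Metric_space_axioms)
  then show thesis
    using that by blast
qed

section \<open>Generic conjugates\<close>

locale two_spreading_actions = X: one_point_space U d + A: spreading_action G U d \<alpha> c + B: spreading_action H U d \<beta> c'
  for U :: "'u set" and d and G :: "('a, 'm) monoid_scheme" and \<alpha> c
    and H :: "('b, 'n) monoid_scheme" and \<beta> c'
begin

section \<open>Realizing partial isometries by words\<close>

sublocale two_one_point_spaces U d U d
  by unfold_locales

abbreviation piso :: "('u \<times> 'u) set \<Rightarrow> bool" where
  "piso \<equiv> partial_isometry U d U d"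

text \<open>How large \<open>R\<close> must be depends on \<open>A\<close> alone, so that one
  \<open>R\<close> serves different pairs of copies of \<open>A\<close> and different
  \<open>p\<close>.\<close>

lemma realize_at_distance:
  assumes A: "finite A" "A \<subseteq> U"
  shows "\<forall>\<^sub>F R in sequentially. \<forall>\<phi> \<psi> p. \<phi> \<in> A \<rightarrow> U \<and> \<psi> \<in> A \<rightarrow> U \<and> isometric_on A d d \<phi> \<and> isometric_on A d d \<psi> \<and>
       (\<forall>a\<in>A. \<forall>b\<in>A. d (\<phi> a) (\<psi> b) = real R) \<and> piso p \<longrightarrow>
     (\<exists>p' g h. piso p' \<and> p \<subseteq> p' \<and> g \<in> carrier G \<and> h \<in> carrier H \<and>
       (\<forall>a\<in>A. \<exists>z. (\<alpha> g (\<phi> a), z) \<in> p' \<and> (\<alpha> g (\<psi> a), \<beta> h z) \<in> p'))"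
  using B.spread_finite[OF A(1) A(1) A(2) A(2)]
proof (eventually_elim, intro allI impI)
  fix R :: nat and \<phi> \<psi> :: "'u \<Rightarrow> 'u" and p
  assume R: "\<forall>x\<in>A. \<forall>y\<in>A. d x (\<beta> (c' R) y) = real R"
    and *: "\<phi> \<in> A \<rightarrow> U \<and> \<psi> \<in> A \<rightarrow> U \<and> isometric_on A d d \<phi> \<and> isometric_on A d d \<psi> \<and>
       (\<forall>a\<in>A. \<forall>b\<in>A. d (\<phi> a) (\<psi> b) = real R) \<and> piso p"
  then have p: "piso p"
    by blast
  note pD = partial_isometryD[OF p]
  have in_U: "a \<in> U" "\<phi> a \<in> U" "\<psi> a \<in> U" if "a \<in> A" for a
    using * A(2) that by auto
  \<comment> \<open>\<open>h0\<close> puts \<open>A\<close> and its translate at mutual distance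
    \<open>R\<close>, just as the images of \<phi> and \<psi> are.\<close>
  define h0 where "h0 = c' R"
  have h0: "h0 \<in> carrier H"
    by (simp add: h0_def B.c_closed)
  have h0_in: "\<beta> h0 a \<in> U" if "a \<in> A" for a
    using B.action_closed[OF h0 in_U(1)[OF that]] .
  have Ap: "finite (Domain p)" "finite (Range p)" "Domain p \<subseteq> U" "Range p \<subseteq> U"
    using pD by (auto simp: finite_Domain finite_Range)
  have "\<forall>\<^sub>F K in sequentially. \<forall>x\<in>Domain p. \<forall>y\<in>\<phi> ` A \<union> \<psi> ` A. d x (\<alpha> (c K) y) = real K"
    using A(1) Ap in_U by (intro A.spread_finite) auto
  moreover have "\<forall>\<^sub>F K in sequentially. \<forall>x\<in>Range p. \<forall>y\<in>A \<union> \<beta> h0 ` A. d x (\<beta> (c' K) y) = real K"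
    using A(1) Ap in_U h0_in by (intro B.spread_finite) auto
  ultimately have "\<forall>\<^sub>F K in sequentially.
      (\<forall>x\<in>Domain p. \<forall>y\<in>\<phi> ` A \<union> \<psi> ` A. d x (\<alpha> (c K) y) = real K) \<and>
      (\<forall>x\<in>Range p. \<forall>y\<in>A \<union> \<beta> h0 ` A. d x (\<beta> (c' K) y) = real K)"
    by (rule eventually_conj)
  from eventually_happens[OF this] obtain K where
      "(\<forall>x\<in>Domain p. \<forall>y\<in>\<phi> ` A \<union> \<psi> ` A. d x (\<alpha> (c K) y) = real K) \<and>
      (\<forall>x\<in>Range p. \<forall>y\<in>A \<union> \<beta> h0 ` A. d x (\<beta> (c' K) y) = real K)"
    by auto
  then have
    K: "\<And>x y. \<lbrakk>x \<in> Domain p; y \<in> \<phi> ` A \<union> \<psi> ` A\<rbrakk> \<Longrightarrow> d x (\<alpha> (c K) y) = real K"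
      "\<And>x y. \<lbrakk>x \<in> Range p; y \<in> A \<union> \<beta> h0 ` A\<rbrakk> \<Longrightarrow> d x (\<beta> (c' K) y) = real K"
    by blast+
  \<comment> \<open>Using the same \<open>K\<close> in both groups makes the new pairs compatible
    with \<open>p\<close>.\<close>
  define g where "g = c K"
  define k where "k = c' K"
  have g: "g \<in> carrier G" and k: "k \<in> carrier H"
    by (simp_all add: g_def k_def A.c_closed B.c_closed)
  \<comment> \<open>Conjugation by \<open>k\<close> makes \<open>h\<close> map
    \<open>\<beta> k a\<close> to \<open>\<beta> k (\<beta> h0 a)\<close>.\<close>
  define h where "h = k \<otimes>\<^bsub>H\<^esub> (h0 \<otimes>\<^bsub>H\<^esub> inv\<^bsub>H\<^esub> k)"
  interpret H: group H
    using B.group_hom group_hom.axioms(1) by auto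
  have h: "h \<in> carrier H"
    using k h0 by (simp add: h_def)
  have h_k: "\<beta> h (\<beta> k a) = \<beta> k (\<beta> h0 a)" if "a \<in> A" for a
    using that k h0 in_U(1)[OF that] h0_in[OF that]
    by (simp add: h_def B.composition_rule B.action_closed B.action_inv)
  \<comment> \<open>\<open>r\<close> and \<open>s\<close> send the two copies, moved by
    \<open>g\<close>, to \<open>A\<close> and its \<open>h0\<close>-translate, moved by
    \<open>k\<close>. The distances between the two copies are \<open>R\<close> on either
    side.\<close>
  define r where "r = (\<lambda>a. (\<alpha> g (\<phi> a), \<beta> k a)) ` A"
  define s where "s = (\<lambda>a. (\<alpha> g (\<psi> a), \<beta> k (\<beta> h0 a))) ` A"
  have r: "piso r"
    unfolding partial_isometry_def r_def
    using * in_U A(1) g k by (auto simp: A.action_closed B.action_closed A.isometric B.isometric isometric_on_def)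
  have s: "piso s"
    unfolding partial_isometry_def s_def
    using * in_U A(1) g k h0 h0_in
    by (auto simp: A.action_closed B.action_closed A.isometric B.isometric isometric_on_def)
  have rs: "piso (r \<union> s)"
  proof (rule partial_isometry_Un[OF r s])
    fix x y x' y' assume "(x, y) \<in> r" "(x', y') \<in> s"
    then obtain a b where ab: "a \<in> A" "b \<in> A" "x = \<alpha> g (\<phi> a)" "y = \<beta> k a"
        "x' = \<alpha> g (\<psi> b)" "y' = \<beta> k (\<beta> h0 b)"
      unfolding r_def s_def by blast
    then have "d y y' = d a (\<beta> h0 b)" "d x x' = d (\<phi> a) (\<psi> b)"
      using in_U h0_in g k by (simp_all add: A.isometric B.isometric)
    then show "d y y' = d x x'"
      using ab(1,2) R * by (simp add: h0_def)
  qed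
  have "piso (p \<union> (r \<union> s))"
  proof (rule partial_isometry_Un[OF p rs])
    fix x y x' y' assume xy: "(x, y) \<in> p" "(x', y') \<in> r \<union> s"
    then have "d x x' = real K"
      using K(1)[of x] unfolding r_def s_def g_def by blast
    moreover have "d y y' = real K"
      using xy K(2)[of y] unfolding r_def s_def k_def by blast
    ultimately show "d y y' = d x x'"
      by simp
  qed
  moreover have "\<exists>z. (\<alpha> g (\<phi> a), z) \<in> p \<union> (r \<union> s) \<and> (\<alpha> g (\<psi> a), \<beta> h z) \<in> p \<union> (r \<union> s)" if "a \<in> A" for a
    using that h_k[OF that] by (intro exI[of _ "\<beta> k a"]) (auto simp: r_def s_def)
  ultimately show "\<exists>p' g h. piso p' \<and> p \<subseteq> p' \<and> g \<in> carrier G \<and> h \<in> carrier H \<and>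
       (\<forall>a\<in>A. \<exists>z. (\<alpha> g (\<phi> a), z) \<in> p' \<and> (\<alpha> g (\<psi> a), \<beta> h z) \<in> p')"
    using g h by (intro exI[of _ "p \<union> (r \<union> s)"] exI[of _ g] exI[of _ h]) auto
qed

text \<open>
  Whenever \<open>w\<close> extends \<open>p\<close>, the word \<open>g\<inverse> w\<inverse> h w g\<close> maps \<open>x\<close> to \<open>y\<close>.
\<close>

definition linked :: "('u \<times> 'u) set \<Rightarrow> 'a \<Rightarrow> 'b \<Rightarrow> 'u \<Rightarrow> 'u \<Rightarrow> bool" where
  "linked p g h x y \<longleftrightarrow> (\<exists>z. (\<alpha> g x, z) \<in> p \<and> (\<alpha> g y, \<beta> h z) \<in> p)"

lemma linked_mono: "\<lbrakk>linked p g h x y; p \<subseteq> p'\<rbrakk> \<Longrightarrow> linked p' g h x y"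
  unfolding linked_def by blast

text \<open>The distances between \<open>Domain q\<close> and \<open>Range q\<close> are arbitrary,
  so the map is factored through a copy of the domain at distance \<open>R\<close> from
  both.\<close>

lemma realize_partial_isometry:
  assumes q: "piso q" and p: "piso p"
  obtains p' g h g' h' where "piso p'" "p \<subseteq> p'" "g \<in> carrier G" "h \<in> carrier H" "g' \<in> carrier G" "h' \<in> carrier H"
    "\<And>a b. (a, b) \<in> q \<Longrightarrow> \<exists>m\<in>U. linked p' g h a m \<and> linked p' g' h' m b"
proof -
  note qD = partial_isometryD[OF q]
  define A where "A = Domain q"
  have A: "finite A" "A \<subseteq> U"
    using qD by (auto simp: A_def finite_Domain)
  define \<phi> where "\<phi> a = (SOME b. (a, b) \<in> q)" for a
  have \<phi>: "(a, \<phi> a) \<in> q" if "a \<in> A" for a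
    using that unfolding A_def \<phi>_def by (auto intro: someI)
  have \<phi>_eq: "a \<in> A" "b = \<phi> a" if "(a, b) \<in> q" for a b
  proof -
    show "a \<in> A"
      using that by (auto simp: A_def)
    then show "b = \<phi> a"
      using partial_isometry_functional[OF q that \<phi>] by blast
  qed
  have \<phi>_in: "\<phi> a \<in> U" if "a \<in> A" for a
    using qD(3)[OF \<phi>[OF that]] .
  have \<phi>_iso: "isometric_on A d d \<phi>"
    using qD(4)[OF \<phi> \<phi>] by (auto simp: isometric_on_def)
  have fin: "finite (A \<union> \<phi> ` A)"
    using A(1) by simp
  \<comment> \<open>For the far copy to exist, \<open>R\<close> must also be at least every distance
    within the two sets together.\<close>
  obtain N where N: "0 < N" "\<And>x y. \<lbrakk>x \<in> A \<union> \<phi> ` A; y \<in> A \<union> \<phi> ` A\<rbrakk> \<Longrightarrow> d x y \<le> real N"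
    using X.exists_bound[OF fin] by blast
  from eventually_happens[OF eventually_conj[OF eventually_ge_at_top[of N] realize_at_distance[OF A]]]
  obtain R where R: "N \<le> R"
    and step: "\<And>\<phi> \<psi> p. \<lbrakk>\<phi> \<in> A \<rightarrow> U; \<psi> \<in> A \<rightarrow> U; isometric_on A d d \<phi>; isometric_on A d d \<psi>;
       \<forall>a\<in>A. \<forall>b\<in>A. d (\<phi> a) (\<psi> b) = real R; piso p\<rbrakk> \<Longrightarrow>
     \<exists>p' g h. piso p' \<and> p \<subseteq> p' \<and> g \<in> carrier G \<and> h \<in> carrier H \<and> (\<forall>a\<in>A. linked p' g h (\<phi> a) (\<psi> a))"
    unfolding linked_def by auto
  obtain f where f: "f \<in> A \<rightarrow> U" "isometric_on A d d f" "\<And>z a. \<lbrakk>z \<in> A \<union> \<phi> ` A; a \<in> A\<rbrakk> \<Longrightarrow> d z (f a) = real R"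
  proof (rule X.exists_far_copy[of "A \<union> \<phi> ` A" A "real R"])
    show "d x y \<le> real R" if "x \<in> A \<union> \<phi> ` A \<union> A" "y \<in> A \<union> \<phi> ` A \<union> A" for x y
      using N(2)[of x y] that R by fastforce
  qed (use A \<phi>_in N R in auto)
  have "\<exists>p' g h. piso p' \<and> p \<subseteq> p' \<and> g \<in> carrier G \<and> h \<in> carrier H \<and> (\<forall>a\<in>A. linked p' g h (id a) (f a))"
    by (rule step[OF _ f(1) _ f(2) _ p]) (use A(2) f(3) in \<open>auto simp: isometric_on_def\<close>)
  then obtain p1 g h where 1: "piso p1" "p \<subseteq> p1" "g \<in> carrier G" "h \<in> carrier H" "\<And>a. a \<in> A \<Longrightarrow> linked p1 g h a (f a)"
    by auto
  have "\<exists>p' g h. piso p' \<and> p1 \<subseteq> p' \<and> g \<in> carrier G \<and> h \<in> carrier H \<and> (\<forall>a\<in>A. linked p' g h (f a) (\<phi> a))"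
    by (rule step[OF f(1) _ f(2) \<phi>_iso _ 1(1)]) (use f(3) \<phi>_in in \<open>auto simp: X.commute[of "f _"]\<close>)
  then obtain p2 g' h' where 2: "piso p2" "p1 \<subseteq> p2" "g' \<in> carrier G" "h' \<in> carrier H"
      "\<And>a. a \<in> A \<Longrightarrow> linked p2 g' h' (f a) (\<phi> a)"
    by auto
  show thesis
  proof (rule that[OF 2(1) _ 1(3,4) 2(3,4)])
    show "p \<subseteq> p2"
      using 1(2) 2(2) by blast
    show "\<exists>m\<in>U. linked p2 g h a m \<and> linked p2 g' h' m b" if "(a, b) \<in> q" for a b
      using \<phi>_eq[OF that] f(1) 1(5)[of a] 2(5)[of a] linked_mono[OF _ 2(2)] by (intro bexI[of _ "f a"]) auto
  qed
qed

section \<open>Words moving a point\<close>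

text \<open>Whenever \<open>w\<close> extends \<open>p\<close>, the word \<open>u\<close> with letters \<open>b\<close> of \<open>H\<close> read as \<open>w\<inverse> b w\<close> maps \<open>x\<close> to \<open>y\<close>.\<close>

fun run :: "('u \<times> 'u) set \<Rightarrow> ('a + 'b) list \<Rightarrow> 'u \<Rightarrow> 'u \<Rightarrow> bool" where
  "run p [] x y \<longleftrightarrow> y = x"
| "run p (Inl a # u) x y \<longleftrightarrow> (\<exists>z. run p u x z \<and> y = \<alpha> a z)"
| "run p (Inr b # u) x y \<longleftrightarrow> (\<exists>z t. run p u x z \<and> (z, t) \<in> p \<and> (y, \<beta> b t) \<in> p)"

lemma run_mono: "\<lbrakk>run p u x y; p \<subseteq> p'\<rbrakk> \<Longrightarrow> run p' u x y"
  by (induction p u x y rule: run.induct) (simp; blast)+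

text \<open>The image \<open>t\<close> of the fresh point \<open>z\<close> is chosen so that
  \<open>\<beta> b t\<close> is a fresh value as well: it is outside \<open>Range p\<close> by the
  choice of \<open>t\<close> and differs from \<open>t\<close> by freeness. Its preimage
  \<open>y\<close> can then be placed outside \<open>Z\<close>.\<close>

lemma extend_along_letter:
  assumes p: "piso p" and z: "z \<in> U" "z \<notin> Domain p" and b: "b \<in> carrier H" "b \<noteq> \<one>\<^bsub>H\<^esub>" and Z: "finite Z"
  obtains p' t y where "piso p'" "p \<subseteq> p'" "(z, t) \<in> p'" "(y, \<beta> b t) \<in> p'" "y \<in> U" "y \<notin> Z"
    "Domain p' = Domain p \<union> {z, y}"
proof -
  interpret H: group H
    using B.group_hom group_hom.axioms(1) by auto
  have "finite (\<beta> (inv\<^bsub>H\<^esub> b) ` Range p)"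
    using partial_isometryD(1)[OF p] by (simp add: finite_Range)
  then obtain t where t: "t \<in> U" "t \<notin> \<beta> (inv\<^bsub>H\<^esub> b) ` Range p" "t \<notin> Range p" "piso (insert (z, t) p)"
    using extend_partial_isometry[OF p z] by blast
  have "\<beta> b t \<noteq> t"
    using B.free[OF b(1) t(1)] b(2) by blast
  moreover have "\<beta> b t \<notin> Range p"
    using t(2) B.action_inv(1)[OF b(1) t(1)] by (metis imageI)
  ultimately have "\<beta> b t \<notin> Domain ((insert (z, t) p)\<inverse>)"
    by auto
  then obtain y where y: "y \<in> U" "y \<notin> Z" "piso (insert (\<beta> b t, y) ((insert (z, t) p)\<inverse>))"
    using extend_partial_isometry[OF partial_isometry_converse[OF t(4)] B.action_closed[OF b(1) t(1)] _ Z] by blast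
  have "(insert (\<beta> b t, y) ((insert (z, t) p)\<inverse>))\<inverse> = insert (y, \<beta> b t) (insert (z, t) p)"
    by auto
  then have "piso (insert (y, \<beta> b t) (insert (z, t) p))"
    using partial_isometry_converse[OF y(3)] by simp
  then show thesis
    by (rule that[of _ t y]) (use y in auto)
qed

text \<open>Words are read from the right, two letters at a time. A letter of \<open>H\<close> needs
  a starting point whose image under \<open>w\<close> is undecided. After such a letter the endpoint
  lies in the domain, and the next letter of \<open>G\<close> moves it out again; hence the
  condition on the head.\<close>

lemma extend_along_word:
  assumes "u \<in> fp_words G H" "u = [] \<or> isl (hd u)" "piso p" "finite Z"
  shows "\<exists>p' x y. piso p' \<and> p \<subseteq> p' \<and> x \<in> U \<and> y \<in> U \<and> run p' u x y \<and> y \<notin> Z \<union> Domain p' \<and> (u \<noteq> [] \<longrightarrow> x \<noteq> y)"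
  using assms
proof (induction u arbitrary: Z rule: induct_list012)
  case 1
  have "finite (Z \<union> Domain p)"
    using 1(4) finite_Domain[OF partial_isometryD(1)[OF 1(3)]] by simp
  then obtain x where "x \<in> U" "x \<notin> Z \<union> Domain p"
    using X.exists_point_avoiding[of "{}" "\<lambda>_. 1" "Z \<union> Domain p"] by (auto simp: katetov_def)
  then show ?case
    using 1 by (intro exI[of _ p] exI[of _ x]) auto
next
  case (2 l)
  then obtain a where a: "l = Inl a" "a \<in> carrier G" "a \<noteq> \<one>\<^bsub>G\<^esub>"
    by (cases l) auto
  have "finite (\<alpha> (inv\<^bsub>G\<^esub> a) ` (Z \<union> Domain p))"
    using 2(4) finite_Domain[OF partial_isometryD(1)[OF 2(3)]] by simp
  then obtain x where x: "x \<in> U" "x \<notin> \<alpha> (inv\<^bsub>G\<^esub> a) ` (Z \<union> Domain p)"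
    using X.exists_point_avoiding[of "{}" "\<lambda>_. 1" "\<alpha> (inv\<^bsub>G\<^esub> a) ` (Z \<union> Domain p)"] by (auto simp: katetov_def)
  have "\<alpha> a x \<notin> Z \<union> Domain p" "\<alpha> a x \<noteq> x"
    using x A.action_inv(1)[OF a(2) x(1)] A.free[OF a(2) x(1)] a(3) by (metis imageI)+
  then show ?case
    using 2 x A.action_closed[OF a(2) x(1)] by (intro exI[of _ p] exI[of _ x] exI[of _ "\<alpha> a x"]) (auto simp: a)
next
  case (3 l l' u)
  obtain a b where ab: "l = Inl a" "l' = Inr b"
    using 3(3,4) by (cases l; cases l') (auto simp: fp_words_def)
  have words: "[Inl a] \<in> fp_words G H" "[Inr b] \<in> fp_words G H" "u \<in> fp_words G H"
    using 3(3) fp_words_ConsD ab by blast+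
  then have a: "a \<in> carrier G" "a \<noteq> \<one>\<^bsub>G\<^esub>" and b: "b \<in> carrier H" "b \<noteq> \<one>\<^bsub>H\<^esub>"
    by auto
  have "u = [] \<or> isl (hd u)"
    using 3(3) ab by (cases u) (auto simp: fp_words_def)
  from 3(1)[OF words(3) this 3(5,6)]
  obtain p' x z where 1: "piso p'" "p \<subseteq> p'" "x \<in> U" "z \<in> U" "run p' u x z" "z \<notin> Domain p'"
    by auto
  \<comment> \<open>With this set avoided by \<open>y\<close>, the point \<open>\<alpha> a y\<close>
    is outside the old domain and differs from \<open>x\<close> and \<open>z\<close>; freeness
    separates it from \<open>y\<close>, the other new element of the domain.\<close>
  have "finite (\<alpha> (inv\<^bsub>G\<^esub> a) ` (Z \<union> Domain p' \<union> {x, z}))"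
    using 3(6) partial_isometryD(1)[OF 1(1)] by (auto simp: finite_Domain)
  from extend_along_letter[OF 1(1,4,6) b this]
  obtain p'' t y where 2: "piso p''" "p' \<subseteq> p''" "(z, t) \<in> p''" "(y, \<beta> b t) \<in> p''" "y \<in> U"
      "y \<notin> \<alpha> (inv\<^bsub>G\<^esub> a) ` (Z \<union> Domain p' \<union> {x, z})" "Domain p'' = Domain p' \<union> {z, y}"
    by blast
  have "\<alpha> a y \<notin> Z \<union> Domain p' \<union> {x, z}" "\<alpha> a y \<noteq> y"
    using 2(6) A.action_inv(1)[OF a(1) 2(5)] A.free[OF a(1) 2(5)] a(2) by (metis imageI)+
  moreover have "run p'' (l # l' # u) x (\<alpha> a y)"
    using run_mono[OF 1(5) 2(2)] 2(3,4) by (auto simp: ab)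
  ultimately show ?case
    using 1 2 A.action_closed[OF a(1) 2(5)]
    by (intro exI[of _ p''] exI[of _ x] exI[of _ "\<alpha> a y"]) auto
qed

text \<open>A leading letter of \<open>H\<close> is treated separately, as the last step of the
  walk: there the endpoint may lie in the domain and only has to avoid \<open>x\<close>.\<close>

lemma move_point:
  assumes u: "u \<in> fp_words G H" "u \<noteq> []" and p: "piso p"
  obtains p' x y where "piso p'" "p \<subseteq> p'" "x \<in> U" "run p' u x y" "x \<noteq> y"
proof (cases "isl (hd u)")
  case True
  show thesis
    using extend_along_word[OF u(1) disjI2[OF True] p finite.emptyI] u(2) that by blast
next
  case False
  then obtain b v where bv: "u = Inr b # v"
    using u(2) by (cases u; cases "hd u") auto
  have "[Inr b] \<in> fp_words G H" "v \<in> fp_words G H"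
    using u(1) fp_words_ConsD bv by blast+
  then have b: "b \<in> carrier H" "b \<noteq> \<one>\<^bsub>H\<^esub>" and v: "v \<in> fp_words G H"
    by auto
  have "v = [] \<or> isl (hd v)"
    using u(1) bv by (cases v) (auto simp: fp_words_def)
  from extend_along_word[OF v this p finite.emptyI]
  obtain p' x z where 1: "piso p'" "p \<subseteq> p'" "x \<in> U" "z \<in> U" "run p' v x z" "z \<notin> Domain p'"
    by auto
  have "finite {x}"
    by simp
  from extend_along_letter[OF 1(1,4,6) b this]
  obtain p'' t y where 2: "piso p''" "p' \<subseteq> p''" "(z, t) \<in> p''" "(y, \<beta> b t) \<in> p''" "y \<in> U" "y \<notin> {x}"
      "Domain p'' = Domain p' \<union> {z, y}"
    by blast
  have "run p'' u x y"
    using run_mono[OF 1(5) 2(2)] 2(3,4) by (auto simp: bv)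
  then show thesis
    using that[OF 2(1), of x y] 1(2,3) 2(2,6) by auto
qed

lemma exists_generic_conjugator:
  assumes "countable (carrier G)" "countable (carrier H)"
  obtains w where "bij_betw w U U" "isometric_on U d d w"
    "\<forall>q. piso q \<longrightarrow> (\<exists>p g h g' h'. piso p \<and> (\<forall>(x, y)\<in>p. w x = y) \<and>
       g \<in> carrier G \<and> h \<in> carrier H \<and> g' \<in> carrier G \<and> h' \<in> carrier H \<and>
       (\<forall>(a, b)\<in>q. \<exists>m\<in>U. linked p g h a m \<and> linked p g' h' m b))"
    "\<forall>u\<in>fp_words G H - {[]}. \<exists>p x y. piso p \<and> (\<forall>(x, y)\<in>p. w x = y) \<and> x \<in> U \<and> run p u x y \<and> x \<noteq> y"
proof -
  \<comment> \<open>Dense sets that decide finitely much of \<open>w\<close>: \<open>\<H> q\<close>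
    forces a word extending \<open>q\<close>, and \<open>\<F> u\<close> forces \<open>u\<close> to
    move a point.\<close>
  define \<H> where "\<H> q = {p. \<exists>g\<in>carrier G. \<exists>h\<in>carrier H. \<exists>g'\<in>carrier G. \<exists>h'\<in>carrier H.
    \<forall>(a, b)\<in>q. \<exists>m\<in>U. linked p g h a m \<and> linked p g' h' m b}" for q
  define \<F> where "\<F> u = {p. \<exists>x\<in>U. \<exists>y. run p u x y \<and> x \<noteq> y}" for u
  have "countable {q. finite q \<and> q \<subseteq> U \<times> U}"
    using X.countable by (intro countable_Collect_finite_subset countable_SIGMA)
  then have "countable {q. piso q}"
    by (rule countable_subset[rotated]) (auto simp: partial_isometry_def)
  moreover have "countable (lists (Inl ` carrier G \<union> Inr ` carrier H))"
    using assms by (intro countable_lists) auto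
  then have "countable (fp_words G H)"
    by (rule countable_subset[rotated]) (auto simp: fp_words_def)
  ultimately have "countable (\<H> ` {q. piso q} \<union> \<F> ` (fp_words G H - {[]}))"
    by auto
  then obtain w where w: "bij_betw w U U" "\<And>x y. \<lbrakk>x \<in> U; y \<in> U\<rbrakk> \<Longrightarrow> d (w x) (w y) = d x y"
    "\<And>D. D \<in> \<H> ` {q. piso q} \<union> \<F> ` (fp_words G H - {[]}) \<Longrightarrow> \<exists>p\<in>D. piso p \<and> (\<forall>(x, y)\<in>p. w x = y)"
  proof (rule exists_generic_isometry)
    fix D p assume D: "D \<in> \<H> ` {q. piso q} \<union> \<F> ` (fp_words G H - {[]})" and p: "piso p"
    then consider q where "piso q" "D = \<H> q" | u where "u \<in> fp_words G H" "u \<noteq> []" "D = \<F> u"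
      by blast
    then show "\<exists>p'\<in>D. piso p' \<and> p \<subseteq> p'"
    proof cases
      case (1 q)
      obtain p' g h g' h' where r: "piso p'" "p \<subseteq> p'" "g \<in> carrier G" "h \<in> carrier H" "g' \<in> carrier G" "h' \<in> carrier H"
          "\<And>a b. (a, b) \<in> q \<Longrightarrow> \<exists>m\<in>U. linked p' g h a m \<and> linked p' g' h' m b"
        using realize_partial_isometry[OF 1(1) p] by blast
      have "p' \<in> \<H> q"
        unfolding \<H>_def using r(3-7) by blast
      then show ?thesis
        using r(1,2) 1(2) by blast
    next
      case (2 u)
      obtain p' x y where r: "piso p'" "p \<subseteq> p'" "x \<in> U" "run p' u x y" "x \<noteq> y"
        by (rule move_point[OF 2(1,2) p])
      have "p' \<in> \<F> u"
        unfolding \<F>_def using r(3-5) by blast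
      then show ?thesis
        using r(1,2) 2(3) by blast
    qed
  qed blast
  show thesis
  proof (rule that[OF w(1)]; (intro allI impI ballI)?)
    show "isometric_on U d d w"
      using w(2) by (simp add: isometric_on_def)
    fix q assume "piso q"
    then obtain p where "p \<in> \<H> q" "piso p" "\<forall>(x, y)\<in>p. w x = y"
      using w(3)[of "\<H> q"] by blast
    then show "\<exists>p g h g' h'. piso p \<and> (\<forall>(x, y)\<in>p. w x = y) \<and>
       g \<in> carrier G \<and> h \<in> carrier H \<and> g' \<in> carrier G \<and> h' \<in> carrier H \<and>
       (\<forall>(a, b)\<in>q. \<exists>m\<in>U. linked p g h a m \<and> linked p g' h' m b)"
      unfolding \<H>_def by blast
  next
    fix u assume "u \<in> fp_words G H - {[]}"
    then obtain p where "p \<in> \<F> u" "piso p" "\<forall>(x, y)\<in>p. w x = y"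
      using w(3)[of "\<F> u"] by blast
    then show "\<exists>p x y. piso p \<and> (\<forall>(x, y)\<in>p. w x = y) \<and> x \<in> U \<and> run p u x y \<and> x \<noteq> y"
      unfolding \<F>_def by blast
  qed
qed

end

section \<open>The action of the free product\<close>

lemma (in group_action) group_action_conjugate:
  assumes "bij_betw w U E"
  shows "group_action G U (\<lambda>\<gamma>. \<lambda>x\<in>U. inv_into U w (\<phi> \<gamma> (w x)))"
proof (rule group_actionI)
  show "group G"
    using group_hom group_hom.axioms(1) by auto
  have w: "w x \<in> E" if "x \<in> U" for x
    using assms that by (auto simp: bij_betw_def)
  have w': "inv_into U w y \<in> U" "w (inv_into U w y) = y" if "y \<in> E" for y
    using assms that by (auto simp: bij_betw_def inv_into_into f_inv_into_f)
  show "(\<lambda>x\<in>U. inv_into U w (\<phi> \<gamma> (w x))) x \<in> U" if "\<gamma> \<in> carrier G" "x \<in> U" for \<gamma> x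
    using that w w' action_closed by simp
  show "(\<lambda>x\<in>U. inv_into U w (\<phi> \<one> (w x))) x = x" if "x \<in> U" for x
    using that w action_one bij_betw_inv_into_left[OF assms] by simp
  show "(\<lambda>x\<in>U. inv_into U w (\<phi> (\<gamma> \<otimes> \<gamma>') (w x))) x =
      (\<lambda>x\<in>U. inv_into U w (\<phi> \<gamma> (w x))) ((\<lambda>x\<in>U. inv_into U w (\<phi> \<gamma>' (w x))) x)"
    if "\<gamma> \<in> carrier G" "\<gamma>' \<in> carrier G" "x \<in> U" for \<gamma> \<gamma>' x
    using that w w' action_closed composition_rule by simp
qed simp

context two_spreading_actions
begin

text \<open>\<open>G\<close> acts by \<alpha> and \<open>H\<close> by the conjugate of \<beta> under
  a generic \<open>w\<close>; the universal property combines the two.\<close>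

proposition exists_homogeneous_faithful_action:
  assumes "countable (carrier G)" "countable (carrier H)"
  obtains F where "faithful_action (free_product G H) U F" "homogeneous_action (free_product G H) U d F"
proof -
  interpret G: group G
    using A.group_hom group_hom.axioms(1) by auto
  interpret H: group H
    using B.group_hom group_hom.axioms(1) by auto
  interpret P: group "free_product G H"
    by (intro group_free_product G.group_axioms H.group_axioms)
  obtain w where w: "bij_betw w U U" and w_isometric: "isometric_on U d d w"
    and w_hom: "\<forall>q. piso q \<longrightarrow> (\<exists>p g h g' h'. piso p \<and> (\<forall>(x, y)\<in>p. w x = y) \<and>
       g \<in> carrier G \<and> h \<in> carrier H \<and> g' \<in> carrier G \<and> h' \<in> carrier H \<and>
       (\<forall>(a, b)\<in>q. \<exists>m\<in>U. linked p g h a m \<and> linked p g' h' m b))"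
    and w_faithful: "\<forall>u\<in>fp_words G H - {[]}.
       \<exists>p x y. piso p \<and> (\<forall>(x, y)\<in>p. w x = y) \<and> x \<in> U \<and> run p u x y \<and> x \<noteq> y"
    by (rule exists_generic_conjugator[OF assms])
  have w_iso: "d (w x) (w y) = d x y" if "x \<in> U" "y \<in> U" for x y
    using w_isometric that by (simp add: isometric_on_def)
  define \<beta>' where "\<beta>' b = (\<lambda>x\<in>U. inv_into U w (\<beta> b (w x)))" for b
  interpret B': group_action H U \<beta>'
    unfolding \<beta>'_def by (rule B.group_action_conjugate[OF w])
  have w_in: "w x \<in> U" if "x \<in> U" for x
    using w that by (auto simp: bij_betw_def)
  have w_\<beta>': "w (\<beta>' b x) = \<beta> b (w x)" if "b \<in> carrier H" "x \<in> U" for b x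
    using that w w_in B.action_closed by (auto simp: \<beta>'_def bij_betw_def f_inv_into_f)
  have w_inj: "x = y" if "x \<in> U" "y \<in> U" "w x = w y" for x y
    using w that by (auto simp: bij_betw_def inj_on_def)
  have \<beta>'_iso: "d (\<beta>' b x) (\<beta>' b y) = d x y" if "b \<in> carrier H" "x \<in> U" "y \<in> U" for b x y
    using w_iso[of "\<beta>' b x" "\<beta>' b y"] w_iso[of x y] that
    by (simp add: B'.action_closed w_\<beta>' B.isometric w_in)
  \<comment> \<open>Pairs in \<open>p\<close> are values of \<open>w\<close>, so \<open>p\<close>
    decides the conjugated action at \<open>x\<close>.\<close>
  have \<beta>'_eq: "\<beta>' b x = y" if p: "piso p" "\<forall>(x, y)\<in>p. w x = y" and b: "b \<in> carrier H"
    and xy: "(x, z) \<in> p" "(y, \<beta> b z) \<in> p" for p b x y z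
  proof (rule w_inj)
    note pD = partial_isometryD[OF p(1)]
    show "\<beta>' b x \<in> U" "y \<in> U"
      using pD xy b B'.action_closed by blast+
    have "w x = z" "w y = \<beta> b z" "x \<in> U"
      using p(2) xy pD(2)[OF xy(1)] by auto
    then show "w (\<beta>' b x) = w y"
      using w_\<beta>' b by simp
  qed
  obtain F where F: "F \<in> hom (free_product G H) (BijGroup U)"
    and F_inl: "\<And>a. a \<in> carrier G \<Longrightarrow> F (fp_inl G a) = \<alpha> a"
    and F_inr: "\<And>b. b \<in> carrier H \<Longrightarrow> F (fp_inr H b) = \<beta>' b"
    by (rule free_product_universal[OF G.group_axioms H.group_axioms group_BijGroup
          group_hom.homh[OF A.group_hom] group_hom.homh[OF B'.group_hom]]) blast
  interpret F: group_action "free_product G H" U F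
    using F by (simp add: group_action_def group_hom_def group_hom_axioms_def group_BijGroup P.group_axioms)
  have F_letter: "F [Inl a] = \<alpha> a" if "[Inl a] \<in> fp_words G H" for a
    using F_inl[of a] that by (simp add: fp_inl_def)
  have F_letter': "F [Inr b] = \<beta>' b" if "[Inr b] \<in> fp_words G H" for b
    using F_inr[of b] that by (simp add: fp_inr_def)
  have F_Cons: "F (l # u) x = F [l] (F u x)" if lu: "l # u \<in> fp_words G H" and x: "x \<in> U" for l u x
  proof -
    have "[l] \<in> carrier (free_product G H)" "u \<in> carrier (free_product G H)"
      using fp_words_ConsD[OF lu] by simp_all
    from F.composition_rule[OF x this] show ?thesis
      using fp_push_reduced[OF lu] by simp
  qed
  have F_Nil: "F [] x = x" if "x \<in> U" for x
    using F.action_one[OF that] by simp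
  have F_closed: "F u x \<in> U" if "u \<in> fp_words G H" "x \<in> U" for u x
    using F.action_closed[of u x] that by simp
  have F_iso: "d (F u x) (F u y) = d x y" if "u \<in> fp_words G H" "x \<in> U" "y \<in> U" for u x y
    using that(1)
  proof (induction u)
    case Nil
    then show ?case
      using that F_Nil by simp
  next
    case (Cons l u)
    have l: "[l] \<in> fp_words G H" and u: "u \<in> fp_words G H"
      using fp_words_ConsD[OF Cons.prems] by blast+
    have "d (F [l] (F u x)) (F [l] (F u y)) = d (F u x) (F u y)"
      using l F_closed[OF u] that(2,3) F_letter F_letter' A.isometric \<beta>'_iso by (cases l) auto
    then show ?case
      using Cons.IH[OF u] F_Cons[OF Cons.prems] that(2,3) by simp
  qed
  \<comment> \<open>\<open>run\<close> computes the action of a word from a finite part of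
    \<open>w\<close>, letter by letter.\<close>
  have F_run: "F u x = y" if p: "piso p" "\<forall>(x, y)\<in>p. w x = y" and "u \<in> fp_words G H" "x \<in> U" "run p u x y"
    for p u x y
    using that(3,5)
  proof (induction u arbitrary: y)
    case Nil
    then show ?case
      using that(4) F_Nil by simp
  next
    case (Cons l u)
    have l: "[l] \<in> fp_words G H" and u: "u \<in> fp_words G H"
      using fp_words_ConsD[OF Cons.prems(1)] by blast+
    have "F [l] (F u x) = y"
    proof (cases l)
      case (Inl a)
      then show ?thesis
        using Cons.prems(2) Cons.IH[OF u] F_letter l by auto
    next
      case (Inr b)
      then obtain z t where z: "run p u x z" "(z, t) \<in> p" "(y, \<beta> b t) \<in> p"
        using Cons.prems(2) by auto
      have "\<beta>' b z = y"
        by (rule \<beta>'_eq[OF p _ z(2,3)]) (use l Inr in simp)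
      then show ?thesis
        using Cons.IH[OF u z(1)] F_letter' l Inr by simp
    qed
    then show ?case
      using F_Cons[OF Cons.prems(1) that(4)] by simp
  qed
  have faithful: "inj_on F (carrier (free_product G H))"
  proof -
    have "u = []" if u: "u \<in> fp_words G H" and Fu: "F u = \<one>\<^bsub>BijGroup U\<^esub>" for u
    proof (rule ccontr)
      assume "u \<noteq> []"
      then obtain p x y where p: "piso p" "\<forall>(x, y)\<in>p. w x = y" "x \<in> U" "run p u x y" "x \<noteq> y"
        using w_faithful u by blast
      from F_run[OF p(1,2) u p(3,4)] show False
        using Fu p(3,5) by (simp add: BijGroup_def)
    qed
    then show ?thesis
      using F.action_one by (subst group_hom.inj_iff_trivial_ker[OF F.group_hom])
        (auto simp: kernel_def group_hom.hom_one[OF F.group_hom, simplified])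
  qed
  have "faithful_action (free_product G H) U F"
    using faithful by (simp add: faithful_action_def faithful_action_axioms_def F.group_action_axioms)
  moreover have "homogeneous_action (free_product G H) U d F"
    unfolding homogeneous_action_def acts_by_isometries_def
  proof (intro conjI allI impI ballI)
    show "group_action (free_product G H) U F"
      by (rule F.group_action_axioms)
    show "isometric_on U d d (F u)" if "u \<in> carrier (free_product G H)" for u
      using that F_iso by (simp add: isometric_on_def)
    fix A B \<phi> assume *: "finite A \<and> A \<subseteq> U \<and> finite B \<and> B \<subseteq> U \<and> bij_betw \<phi> A B \<and> isometric_on A d d \<phi>"
    define q where "q = (\<lambda>a. (a, \<phi> a)) ` A"
    have q: "piso q"
      using * by (auto simp: partial_isometry_def q_def bij_betw_def isometric_on_def)
    obtain p g h g' h' where p: "piso p" "\<forall>(x, y)\<in>p. w x = y"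
      and gh: "g \<in> carrier G" "h \<in> carrier H" "g' \<in> carrier G" "h' \<in> carrier H"
      and link: "\<forall>(a, b)\<in>q. \<exists>m\<in>U. linked p g h a m \<and> linked p g' h' m b"
      using mp[OF spec[OF w_hom] q] by (elim exE conjE) (rule that)
    \<comment> \<open>The word belonging to \<open>linked\<close>: an element of \<open>H\<close>
      conjugated by one of \<open>G\<close>.\<close>
    define el where "el g h = fp_inl G (inv\<^bsub>G\<^esub> g) \<otimes>\<^bsub>free_product G H\<^esub>
      (fp_inr H h \<otimes>\<^bsub>free_product G H\<^esub> fp_inl G g)" for g h
    have inl: "fp_inl G a \<in> carrier (free_product G H)" if "a \<in> carrier G" for a
      by (rule hom_in_carrier[OF fp_inl_hom[OF G.group_axioms] that])
    have inr: "fp_inr H b \<in> carrier (free_product G H)" if "b \<in> carrier H" for b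
      by (rule hom_in_carrier[OF fp_inr_hom[OF H.group_axioms] that])
    have el: "el g h \<in> carrier (free_product G H)" if "g \<in> carrier G" "h \<in> carrier H" for g h
      unfolding el_def using that by (intro P.m_closed inl inr G.inv_closed)
    have F_el: "F (el g h) x = y" if g: "g \<in> carrier G" and h: "h \<in> carrier H"
      and x: "x \<in> U" and y: "y \<in> U" and l: "linked p g h x y" for g h x y
    proof -
      obtain z where "(\<alpha> g x, z) \<in> p" "(\<alpha> g y, \<beta> h z) \<in> p"
        using l unfolding linked_def by blast
      from \<beta>'_eq[OF p h this] have "\<beta>' h (\<alpha> g x) = \<alpha> g y" .
      moreover have "F (el g h) x = \<alpha> (inv\<^bsub>G\<^esub> g) (\<beta>' h (\<alpha> g x))"
        unfolding el_def using g h x inl inr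
        by (simp add: F.composition_rule P.m_closed F_inl F_inr del: free_product_simps)
      ultimately show ?thesis
        using A.action_inv(1)[OF g y] by simp
    qed
    show "\<exists>\<gamma>\<in>carrier (free_product G H). \<forall>x\<in>A. F \<gamma> x = \<phi> x"
    \<comment> \<open>The right factor acts first and leads to the intermediate point
      \<open>m\<close>, the left one from there to \<open>\<phi> x\<close>.\<close>
    proof (intro bexI[of _ "el g' h' \<otimes>\<^bsub>free_product G H\<^esub> el g h"] ballI)
      show "el g' h' \<otimes>\<^bsub>free_product G H\<^esub> el g h \<in> carrier (free_product G H)"
        using gh by (intro P.m_closed el)
      fix x assume x: "x \<in> A"
      then have xU: "x \<in> U" "\<phi> x \<in> U"
        using * by (auto simp: bij_betw_def)
      obtain m where m: "m \<in> U" "linked p g h x m" "linked p g' h' m (\<phi> x)"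
        using link x unfolding q_def by auto
      have "F (el g' h' \<otimes>\<^bsub>free_product G H\<^esub> el g h) x = F (el g' h') (F (el g h) x)"
        using gh by (intro F.composition_rule xU el)
      also have "\<dots> = \<phi> x"
        using F_el[OF gh(1,2) xU(1) m(1,2)] F_el[OF gh(3,4) m(1) xU(2) m(3)] by simp
      finally show "F (el g' h' \<otimes>\<^bsub>free_product G H\<^esub> el g h) x = \<phi> x" .
    qed
  qed
  ultimately show thesis
    using that by blast
qed

end

theorem theorem3:
  fixes G :: "('a, 'm) monoid_scheme" and H :: "('b, 'n) monoid_scheme"
    and U :: "'u set" and d :: "'u \<Rightarrow> 'u \<Rightarrow> real"
  assumes "rational_urysohn_space U d"
    and "group G" and "countable (carrier G)" and "infinite (carrier G)"
    and "group H" and "countable (carrier H)" and "infinite (carrier H)"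
  shows "free_product G H \<in> homogeneous_class U d"
proof -
  have U: "one_point_space U d"
    by (rule rational_urysohn_space_one_point[OF assms(1)])
  obtain \<alpha> c where \<alpha>: "spreading_action G U d \<alpha> c"
    by (rule group.exists_spreading_action[OF assms(2,3,4) U])
  obtain \<beta> c' where \<beta>: "spreading_action H U d \<beta> c'"
    by (rule group.exists_spreading_action[OF assms(5,6,7) U])
  interpret two_spreading_actions U d G \<alpha> c H \<beta> c'
    by (intro two_spreading_actions.intro U \<alpha> \<beta>)
  obtain F where "faithful_action (free_product G H) U F" "homogeneous_action (free_product G H) U d F"
    by (rule exists_homogeneous_faithful_action[OF assms(3,6)])
  moreover have "countable (carrier (free_product G H))"
  proof -
    have "countable (lists (Inl ` carrier G \<union> Inr ` carrier H))"
      using assms(3,6) by (intro countable_lists) auto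
    then show ?thesis
      by (rule countable_subset[rotated]) (auto simp: fp_words_def)
  qed
  ultimately show ?thesis
    using group_free_product[OF assms(2,5)] unfolding homogeneous_class_def by blast
qed

end
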